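(* Let $\mathcal{P}$ be a Poisson algebra over a field $K$, $U(\mathcal{P})$ its universal enveloping algebra (as a Lie algebra) and $\mathcal{U}(\mathcal{P})$ its Poisson enveloping algebra. Then: (1) $\mathcal{U}(\mathcal{P})\simeq\mathcal{P}\rtimes_{\mathrm{pad}}U(\mathcal{P})/\mathcal{I}(\mathcal{P})$, where $\mathcal{I}(\mathcal{P})=(\delta_{ab}-a\delta_b-b\delta_a)_{a,b\in\mathcal{P}}$ is the ideal of the algebra $\mathcal{P}\rtimes_{\mathrm{pad}}U(\mathcal{P})$ generated by the set $\{\delta_{ab}-a\delta_b-b\delta_a\mid a,b\in\mathcal{P}\}$. (2) Suppose $\mathcal{P}=S^{-1}K[x_i]_{i\in\Lambda}/(f_s)_{s\in\Gamma}$, where $S$ is a multiplicative subset of the polynomial algebra $K[x_i]_{i\in\Lambda}$ ($\Lambda$ and $\Gamma$ are index sets). Then the algebra $\mathcal{U}(\mathcal{P})$ is generated by the algebra $\mathcal{P}$ and the elements $\{\delta_i:=\delta_{x_i}\mid i\in\Lambda\}$ subject to the defining relations: for all $i,j\in\Lambda$ and $s\in\Gamma$, (a) $[\delta_i,\delta_j]=\sum_{k\in\Lambda}\frac{\partial\{x_i,x_j\}}{\partial x_k}\delta_k$ (for $i\neq j$), (b) $[\delta_i,x_j]=\{x_i,x_j\}$, and (c) $\sum_{i\in\Lambda}\frac{\partial f_s}{\partial x_i}\delta_i=0$. So, the algebra $\mathcal{U}(\mathcal{P})$ is generated by the algebra $\mathcal{P}$ and the set $\delta_{\mathcal{P}}=\{\delta_a\mid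 a\in\mathcal{P}\}$ subject to the defining relations: for all $a,b\in\mathcal{P}$ and $\lambda,\mu\in K$, $[\delta_a,\delta_b]=\delta_{\{a,b\}}$; $[\delta_a,b]=\{a,b\}$; $\delta_{ab}=a\delta_b+b\delta_a$; $\delta_{\lambda a+\mu b}=\lambda\delta_a+\mu\delta_b$ and $\delta_1=0$. (3) The map $\pi_{\mathcal{P}}:\mathcal{U}(\mathcal{P})\to\mathcal{D}(\mathcal{P})$, $a\mapsto a$, $\delta_b\mapsto\mathrm{pad}_b=\{b,\cdot\}$ ($a,b\in\mathcal{P}$), is an algebra homomorphism and its image is the algebra $P\mathcal{D}(\mathcal{P})$ of Poisson differential operators of the Poisson algebra $\mathcal{P}$. (4) The algebra $\mathcal{P}$ is a subalgebra of $\mathcal{U}(\mathcal{P})$. Furthermore, $\mathcal{U}(\mathcal{P})=\mathcal{P}\oplus\mathrm{ann}_{\mathcal{U}(\mathcal{P})}(1)$ is a direct sum of left $\mathcal{P}$-modules, where $\mathrm{ann}_{\mathcal{U}(\mathcal{P})}(1)=\sum_{i\in\Lambda}\mathcal{U}(\mathcal{P})\delta_i$ is the annihilator of the identity element of the Poisson $\mathcal{P}$-module $\mathcal{P}$. The Poisson $\mathcal{P}$-module structure on the Poisson algebra $\mathcal{P}$ is obtained from the $\mathcal{D}(\mathcal{P})$-module structure on $\mathcal{P}$ by restriction of scalars via $\pi_{\mathcal{P}}$.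
   Context: A Poisson algebra over $K$ is a commutative associative (unital) $K$-algebra with a $K$-bilinear Lie bracket $\{\cdot,\cdot\}$ satisfying $\{a,xy\}=\{a,x\}y+x\{a,y\}$. The Poisson enveloping algebra of $\mathcal{P}$ is the universal triple $(\mathcal{U}(\mathcal{P}),\alpha,\beta)$ with $\mathcal{U}(\mathcal{P})$ an associative algebra, $\alpha:\mathcal{P}\to\mathcal{U}(\mathcal{P})$ an algebra homomorphism, $\beta:\mathcal{P}\to\mathcal{U}(\mathcal{P})$ a Lie algebra homomorphism such that $[\beta(a),\alpha(b)]=\alpha(\{a,b\})$ and $\beta(ab)=\beta(a)\alpha(b)+\alpha(a)\beta(b)$ for all $a,b\in\mathcal{P}$ (for any other such triple $(\mathcal{U}',\alpha',\beta')$ there is a unique algebra homomorphism $f:\mathcal{U}(\mathcal{P})\to\mathcal{U}'$ with $\alpha'=f\alpha$, $\beta'=f\beta$). One writes $a=\alpha(a)$, $\delta_a=\beta(a)$. $\mathcal{P}\rtimes_{\mathrm{pad}}U(\mathcal{P})$ is the algebra generated by the algebras $\mathcal{P}$ and $U(\mathcal{P})$ subject to the relations $\delta_a b=b\delta_a+\{a,b\}$ ($a,b\in\mathcal{P}$), where $\delta_a\in U(\mathcal{P})$ denotes the image of the element $a$ of the Lie algebra $\mathcal{P}$; it is a free left $\mathcal{P}$-module on a PBW basis of $U(\mathcal{P})$. In (2), $(f_s)_{s\in\Gamma}$ denotes the ideal of $S^{-1}K[x_i]_{i\in\Lambda}$ generated by the $f_s$, and $\frac{\partial\{x_i,x_j\}}{\partial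 x_k}$ is the image in $\mathcal{P}$ of the partial derivative of a representative of $\{x_i,x_j\}$. In (4), $\Lambda$ and $\delta_i$ are as in a presentation of $\mathcal{P}$ of the form in (2). $\mathcal{D}(\mathcal{P})$ is the algebra of ($K$-linear) differential operators on $\mathcal{P}$; $P\mathcal{D}(\mathcal{P})$ is the subalgebra of $\mathrm{End}_K(\mathcal{P})$ generated by the multiplications by elements of $\mathcal{P}$ and all $\mathrm{pad}_a=\{a,\cdot\}$. A Poisson $\mathcal{P}$-module is the same thing as a left $\mathcal{U}(\mathcal{P})$-module; $\mathcal{P}$ is a Poisson $\mathcal{P}$-module with $a\cdot b=ab$ and $\delta_a\cdot b=\{a,b\}$.
   Formalization: In the definition of the Poisson enveloping algebra the relation β(ab)=β(a)α(b)+α(a)β(b) is corrected to β(ab)=α(b)β(a)+α(a)β(b); the original form forces 2α({a,b})=0, so for ℚ[x,y] with {x,y}=1 it gives U=0 and (4) fails. *)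

theory Defs
  imports
    "HOL-Algebra.Algebraic_Closure_Type"
    "HOL-Algebra.QuotRing"
    "HOL-Algebra.Module"
    "HOL-Algebra.Subrings"
    "HOL-Library.Poly_Mapping"
begin

text \<open>
  The ground field is a type \<open>'k::field\<close>; it enters HOL-Algebra as
  \<^term>\<open>ring_of_type_algebra :: 'k::field ring\<close>.  Algebras over it are records with an explicit
  carrier, so that subalgebras, quotients and arbitrary test algebras can be quantified over.
\<close>

section \<open>Associative algebras, homomorphisms, quotients\<close>

locale assoc_algebra =
  module "ring_of_type_algebra :: 'k::field ring" A + ring A
  for A :: "('k::field, 'a, 'm) module_scheme" (structure) +
  assumes smult_mult_left:
      "\<lbrakk>x \<in> carrier A; y \<in> carrier A\<rbrakk> \<Longrightarrow> (c \<odot> x) \<otimes> y = c \<odot> (x \<otimes> y)"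
    and smult_mult_right:
      "\<lbrakk>x \<in> carrier A; y \<in> carrier A\<rbrakk> \<Longrightarrow> x \<otimes> (c \<odot> y) = c \<odot> (x \<otimes> y)"

definition alg_hom ::
  "('k, 'a, 'm) module_scheme \<Rightarrow> ('k, 'b, 'n) module_scheme \<Rightarrow> ('a \<Rightarrow> 'b) set" where
  "alg_hom A B =
     {h \<in> ring_hom A B. \<forall>c. \<forall>x \<in> carrier A. h (c \<odot>\<^bsub>A\<^esub> x) = c \<odot>\<^bsub>B\<^esub> h x}"

definition alg_iso ::
  "('k, 'a, 'm) module_scheme \<Rightarrow> ('k, 'b, 'n) module_scheme \<Rightarrow> ('a \<Rightarrow> 'b) set" where
  "alg_iso A B = {h \<in> alg_hom A B. bij_betw h (carrier A) (carrier B)}"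

definition alg_quot :: "('k, 'a, 'm) module_scheme \<Rightarrow> 'a set \<Rightarrow> ('k, 'a set) module" where
  "alg_quot A I =
     \<lparr>carrier = carrier (A Quot I), monoid.mult = monoid.mult (A Quot I), monoid.one = monoid.one (A Quot I),
      ring.zero = ring.zero (A Quot I), ring.add = ring.add (A Quot I),
      module.smult = (\<lambda>c C. \<Union>x\<in>C. I +>\<^bsub>A\<^esub> (c \<odot>\<^bsub>A\<^esub> x))\<rparr>"

definition subalgebra_of :: "'a set \<Rightarrow> ('k, 'a, 'm) module_scheme \<Rightarrow> bool" where
  "subalgebra_of B A \<longleftrightarrow>
     subring B A \<and> (\<forall>c. \<forall>x \<in> B. c \<odot>\<^bsub>A\<^esub> x \<in> B)"

definition generated_subalgebra :: "('k, 'a, 'm) module_scheme \<Rightarrow> 'a set \<Rightarrow> 'a set" where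
  "generated_subalgebra A G = \<Inter>{B. subalgebra_of B A \<and> G \<subseteq> B}"

section \<open>Algebras given by generators and relations\<close>

text \<open>
  The free associative unital algebra on \<open>G\<close>: finitely supported functions on the words over \<open>G\<close>,
  multiplied by convolution along concatenation.
\<close>
definition free_alg :: "'x set \<Rightarrow> ('k::field, 'x list \<Rightarrow> 'k) module" where
  "free_alg G =
     \<lparr>carrier = {p. finite {w. p w \<noteq> 0} \<and> (\<forall>w. p w \<noteq> 0 \<longrightarrow> set w \<subseteq> G)},
      monoid.mult = (\<lambda>p q w. \<Sum>i\<le>length w. p (take i w) * q (drop i w)),
      monoid.one = (\<lambda>w. if w = [] then 1 else 0),
      ring.zero = (\<lambda>w. 0),
      ring.add = (\<lambda>p q w. p w + q w),
      module.smult = (\<lambda>c p w. c * p w)\<rparr>"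

definition free_gen :: "'x \<Rightarrow> 'x list \<Rightarrow> 'k::field" where
  "free_gen x = (\<lambda>w. if w = [x] then 1 else 0)"

text \<open>A relation \<open>l = r\<close> is recorded as the element \<open>l - r\<close> of the free algebra.\<close>
definition presented_alg ::
  "'x set \<Rightarrow> ('x list \<Rightarrow> 'k::field) set \<Rightarrow> ('k, ('x list \<Rightarrow> 'k) set) module" where
  "presented_alg G R = alg_quot (free_alg G) (Idl\<^bsub>free_alg G\<^esub> R)"

definition presented_gen ::
  "'x set \<Rightarrow> ('x list \<Rightarrow> 'k::field) set \<Rightarrow> 'x \<Rightarrow> ('x list \<Rightarrow> 'k) set" where
  "presented_gen G R x = (Idl\<^bsub>free_alg G\<^esub> R) +>\<^bsub>free_alg G\<^esub> free_gen x"

text \<open>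
  For a map \<open>\<iota>\<close> from \<open>M\<close> into a free algebra \<open>F\<close>: the relations making \<open>\<iota>\<close> linear, respectively
  an algebra homomorphism.  With the latter, ``the algebra generated by the algebra \<open>A\<close> and
  elements \<open>y\<^sub>j\<close> subject to \<open>R\<close>'' is the presented algebra on the disjoint union of \<open>carrier A\<close>
  and the index set of the \<open>y\<^sub>j\<close>, with relations \<open>alg_rels F A \<iota> \<union> R\<close>.
\<close>
definition lin_rels ::
  "('k, 'f, 'm) module_scheme \<Rightarrow> ('k, 'a, 'n) module_scheme \<Rightarrow> ('a \<Rightarrow> 'f) \<Rightarrow> 'f set" where
  "lin_rels F M \<iota> =
     {\<iota> (a \<oplus>\<^bsub>M\<^esub> b) \<ominus>\<^bsub>F\<^esub> (\<iota> a \<oplus>\<^bsub>F\<^esub> \<iota> b) | a b. a \<in> carrier M \<and> b \<in> carrier M} \<union>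
     {\<iota> (c \<odot>\<^bsub>M\<^esub> a) \<ominus>\<^bsub>F\<^esub> (c \<odot>\<^bsub>F\<^esub> \<iota> a) | c a. a \<in> carrier M}"

definition alg_rels ::
  "('k, 'f, 'm) module_scheme \<Rightarrow> ('k, 'a, 'n) module_scheme \<Rightarrow> ('a \<Rightarrow> 'f) \<Rightarrow> 'f set" where
  "alg_rels F A \<iota> =
     lin_rels F A \<iota> \<union>
     {\<iota> (a \<otimes>\<^bsub>A\<^esub> b) \<ominus>\<^bsub>F\<^esub> (\<iota> a \<otimes>\<^bsub>F\<^esub> \<iota> b) | a b. a \<in> carrier A \<and> b \<in> carrier A} \<union>
     {\<iota> \<one>\<^bsub>A\<^esub> \<ominus>\<^bsub>F\<^esub> \<one>\<^bsub>F\<^esub>}"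

definition commutator :: "('a, 'm) ring_scheme \<Rightarrow> 'a \<Rightarrow> 'a \<Rightarrow> 'a" where
  "commutator A x y = (x \<otimes>\<^bsub>A\<^esub> y) \<ominus>\<^bsub>A\<^esub> (y \<otimes>\<^bsub>A\<^esub> x)"

section \<open>Poisson algebras and their enveloping algebras\<close>

record ('k, 'p) poisson = "('k, 'p) module" +
  pbracket :: "'p \<Rightarrow> 'p \<Rightarrow> 'p"  (\<open>\<lbrace>_,/ _\<rbrace>\<index>\<close>)

locale poisson_algebra =
  algebra "ring_of_type_algebra :: 'k::field ring" P
  for P :: "('k::field, 'p, 'm) poisson_scheme" (structure) +
  assumes bracket_closed:
      "\<lbrakk>a \<in> carrier P; b \<in> carrier P\<rbrakk> \<Longrightarrow> \<lbrace>a, b\<rbrace> \<in> carrier P"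
    and bracket_add_left:
      "\<lbrakk>a \<in> carrier P; b \<in> carrier P; x \<in> carrier P\<rbrakk> \<Longrightarrow>
       \<lbrace>a \<oplus>\<^bsub>P\<^esub> b, x\<rbrace> = \<lbrace>a, x\<rbrace> \<oplus>\<^bsub>P\<^esub> \<lbrace>b, x\<rbrace>"
    and bracket_add_right:
      "\<lbrakk>a \<in> carrier P; b \<in> carrier P; x \<in> carrier P\<rbrakk> \<Longrightarrow>
       \<lbrace>x, a \<oplus>\<^bsub>P\<^esub> b\<rbrace> = \<lbrace>x, a\<rbrace> \<oplus>\<^bsub>P\<^esub> \<lbrace>x, b\<rbrace>"
    and bracket_smult_left:
      "\<lbrakk>a \<in> carrier P; x \<in> carrier P\<rbrakk> \<Longrightarrow> \<lbrace>c \<odot>\<^bsub>P\<^esub> a, x\<rbrace> = c \<odot>\<^bsub>P\<^esub> \<lbrace>a, x\<rbrace>"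
    and bracket_smult_right:
      "\<lbrakk>a \<in> carrier P; x \<in> carrier P\<rbrakk> \<Longrightarrow> \<lbrace>x, c \<odot>\<^bsub>P\<^esub> a\<rbrace> = c \<odot>\<^bsub>P\<^esub> \<lbrace>x, a\<rbrace>"
    and bracket_self:
      "a \<in> carrier P \<Longrightarrow> \<lbrace>a, a\<rbrace> = \<zero>\<^bsub>P\<^esub>"
    and jacobi:
      "\<lbrakk>a \<in> carrier P; b \<in> carrier P; x \<in> carrier P\<rbrakk> \<Longrightarrow>
       \<lbrace>a, \<lbrace>b, x\<rbrace>\<rbrace> \<oplus>\<^bsub>P\<^esub> \<lbrace>b, \<lbrace>x, a\<rbrace>\<rbrace> \<oplus>\<^bsub>P\<^esub> \<lbrace>x, \<lbrace>a, b\<rbrace>\<rbrace> = \<zero>\<^bsub>P\<^esub>"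
    and leibniz:
      "\<lbrakk>a \<in> carrier P; x \<in> carrier P; y \<in> carrier P\<rbrakk> \<Longrightarrow>
       \<lbrace>a, x \<otimes>\<^bsub>P\<^esub> y\<rbrace> = (\<lbrace>a, x\<rbrace> \<otimes>\<^bsub>P\<^esub> y) \<oplus>\<^bsub>P\<^esub> (x \<otimes>\<^bsub>P\<^esub> \<lbrace>a, y\<rbrace>)"

text \<open>
  In the rule for \<open>\<beta> (ab)\<close> the order of the factors matters.  Both terms carry \<open>\<alpha>\<close> on the left
  (equivalently, both on the right).  The mixed form \<open>\<beta> (ab) = \<beta> a \<alpha> b + \<alpha> a \<beta> b\<close> would, upon
  exchanging \<open>a\<close> and \<open>b\<close>, force \<open>2 \<alpha> {a, b} = 0\<close>, so that \<open>\<alpha>\<close> could not be injective in general.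
\<close>
definition poisson_triple ::
  "('k::field, 'p, 'm) poisson_scheme \<Rightarrow> ('k, 'u, 'n) module_scheme \<Rightarrow>
   ('p \<Rightarrow> 'u) \<Rightarrow> ('p \<Rightarrow> 'u) \<Rightarrow> bool" where
  "poisson_triple P A \<alpha> \<beta> \<longleftrightarrow>
     assoc_algebra A \<and>
     \<alpha> \<in> alg_hom P A \<and>
     \<beta> \<in> carrier P \<rightarrow> carrier A \<and>
     (\<forall>a \<in> carrier P. \<forall>b \<in> carrier P. \<beta> (a \<oplus>\<^bsub>P\<^esub> b) = \<beta> a \<oplus>\<^bsub>A\<^esub> \<beta> b) \<and>
     (\<forall>c. \<forall>a \<in> carrier P. \<beta> (c \<odot>\<^bsub>P\<^esub> a) = c \<odot>\<^bsub>A\<^esub> \<beta> a) \<and>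
     (\<forall>a \<in> carrier P. \<forall>b \<in> carrier P. \<beta> \<lbrace>a, b\<rbrace>\<^bsub>P\<^esub> = commutator A (\<beta> a) (\<beta> b)) \<and>
     (\<forall>a \<in> carrier P. \<forall>b \<in> carrier P. commutator A (\<beta> a) (\<alpha> b) = \<alpha> \<lbrace>a, b\<rbrace>\<^bsub>P\<^esub>) \<and>
     (\<forall>a \<in> carrier P. \<forall>b \<in> carrier P.
        \<beta> (a \<otimes>\<^bsub>P\<^esub> b) = (\<alpha> b \<otimes>\<^bsub>A\<^esub> \<beta> a) \<oplus>\<^bsub>A\<^esub> (\<alpha> a \<otimes>\<^bsub>A\<^esub> \<beta> b))"

text \<open>Universality against all triples whose algebra is carried by the type \<open>'c\<close>.\<close>
definition universal_triple ::
  "'c itself \<Rightarrow> ('k::field, 'p, 'm) poisson_scheme \<Rightarrow> ('k, 'u, 'n) module_scheme \<Rightarrow>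
   ('p \<Rightarrow> 'u) \<Rightarrow> ('p \<Rightarrow> 'u) \<Rightarrow> bool" where
  "universal_triple T P U \<alpha> \<beta> \<longleftrightarrow>
     (\<forall>(A :: ('k, 'c) module) \<alpha>' \<beta>'. poisson_triple P A \<alpha>' \<beta>' \<longrightarrow>
        (\<exists>f \<in> alg_hom U A.
           (\<forall>a \<in> carrier P. f (\<alpha> a) = \<alpha>' a \<and> f (\<beta> a) = \<beta>' a) \<and>
           (\<forall>g \<in> alg_hom U A.
              (\<forall>a \<in> carrier P. g (\<alpha> a) = \<alpha>' a \<and> g (\<beta> a) = \<beta>' a) \<longrightarrow>
              (\<forall>u \<in> carrier U. g u = f u))))"

text \<open>
  HOL cannot quantify over all types inside a formula, so universality is required for test algebras
  carried by two types: that of \<open>U\<close>, and \<open>(('p + 'p) list \<Rightarrow> 'k) set\<close>, which carries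
  every quotient of the free algebra on two copies of \<open>P\<close> and hence a copy of every algebra generated
  by the images of some \<open>\<alpha>'\<close> and \<open>\<beta>'\<close>.  This loses nothing: by the lemmas
  \<open>poisson_enveloping_universal\<close> and \<open>poisson_enveloping_exists\<close> below, universality then holds for
  every type, and such a triple exists for every Poisson algebra.
\<close>
definition poisson_enveloping ::
  "('k::field, 'p, 'm) poisson_scheme \<Rightarrow> ('k, 'u) module \<Rightarrow>
   ('p \<Rightarrow> 'u) \<Rightarrow> ('p \<Rightarrow> 'u) \<Rightarrow> bool" where
  "poisson_enveloping P U \<alpha> \<beta> \<longleftrightarrow>
     poisson_triple P U \<alpha> \<beta> \<and>
     universal_triple TYPE('u) P U \<alpha> \<beta> \<and>
     universal_triple TYPE((('p + 'p) list \<Rightarrow> 'k) set) P U \<alpha> \<beta>"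

section \<open>The algebra \<open>P \<rtimes>\<^sub>p\<^sub>a\<^sub>d U(P)\<close> and the ideal \<open>I(P)\<close>\<close>

text \<open>\<open>U(P)\<close> as the tensor algebra of the vector space \<open>P\<close> modulo \<open>ab - ba - {a, b}\<close>.\<close>
definition lie_env_rels :: "('k::field, 'p, 'm) poisson_scheme \<Rightarrow> ('p list \<Rightarrow> 'k) set" where
  "lie_env_rels P =
     (let F = free_alg (carrier P) in
        lin_rels F P free_gen \<union>
        {commutator F (free_gen a) (free_gen b) \<ominus>\<^bsub>F\<^esub> free_gen \<lbrace>a, b\<rbrace>\<^bsub>P\<^esub>
          | a b. a \<in> carrier P \<and> b \<in> carrier P})"

definition lie_env ::
  "('k::field, 'p, 'm) poisson_scheme \<Rightarrow> ('k, ('p list \<Rightarrow> 'k) set) module" where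
  "lie_env P = presented_alg (carrier P) (lie_env_rels P)"

definition lie_env_gen ::
  "('k::field, 'p, 'm) poisson_scheme \<Rightarrow> 'p \<Rightarrow> ('p list \<Rightarrow> 'k) set" where
  "lie_env_gen P = presented_gen (carrier P) (lie_env_rels P)"

type_synonym ('k, 'p) smash_free = "('p + ('p list \<Rightarrow> 'k) set) list \<Rightarrow> 'k"

definition pad_smash_gens ::
  "('k::field, 'p, 'm) poisson_scheme \<Rightarrow> ('p + ('p list \<Rightarrow> 'k) set) set" where
  "pad_smash_gens P = Sum_Type.Plus (carrier P) (carrier (lie_env P))"

definition pad_smash_rels ::
  "('k::field, 'p, 'm) poisson_scheme \<Rightarrow> ('k, 'p) smash_free set" where
  "pad_smash_rels P =
     (let F = free_alg (pad_smash_gens P);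
          \<iota> = (\<lambda>a. free_gen (Inl a));
          \<kappa> = (\<lambda>u. free_gen (Inr u));
          \<delta> = (\<lambda>a. \<kappa> (lie_env_gen P a))
      in alg_rels F P \<iota> \<union> alg_rels F (lie_env P) \<kappa> \<union>
         {(\<delta> a \<otimes>\<^bsub>F\<^esub> \<iota> b) \<ominus>\<^bsub>F\<^esub> ((\<iota> b \<otimes>\<^bsub>F\<^esub> \<delta> a) \<oplus>\<^bsub>F\<^esub> \<iota> \<lbrace>a, b\<rbrace>\<^bsub>P\<^esub>)
           | a b. a \<in> carrier P \<and> b \<in> carrier P})"

definition pad_smash ::
  "('k::field, 'p, 'm) poisson_scheme \<Rightarrow> ('k, ('k, 'p) smash_free set) module" where
  "pad_smash P = presented_alg (pad_smash_gens P) (pad_smash_rels P)"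

definition smash_elt ::
  "('k::field, 'p, 'm) poisson_scheme \<Rightarrow> 'p \<Rightarrow> ('k, 'p) smash_free set" where
  "smash_elt P a = presented_gen (pad_smash_gens P) (pad_smash_rels P) (Inl a)"

definition smash_delta ::
  "('k::field, 'p, 'm) poisson_scheme \<Rightarrow> 'p \<Rightarrow> ('k, 'p) smash_free set" where
  "smash_delta P a =
     presented_gen (pad_smash_gens P) (pad_smash_rels P) (Inr (lie_env_gen P a))"

definition poisson_ideal ::
  "('k::field, 'p, 'm) poisson_scheme \<Rightarrow> ('k, 'p) smash_free set set" where
  "poisson_ideal P =
     (let B = pad_smash P in
        Idl\<^bsub>B\<^esub> {smash_delta P (a \<otimes>\<^bsub>P\<^esub> b)
               \<ominus>\<^bsub>B\<^esub> (smash_elt P a \<otimes>\<^bsub>B\<^esub> smash_delta P b)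
               \<ominus>\<^bsub>B\<^esub> (smash_elt P b \<otimes>\<^bsub>B\<^esub> smash_delta P a)
             | a b. a \<in> carrier P \<and> b \<in> carrier P})"

section \<open>Localized polynomial algebras\<close>

definition poly_alg :: "'i set \<Rightarrow> ('k::field, ('i \<Rightarrow>\<^sub>0 nat) \<Rightarrow>\<^sub>0 'k) module" where
  "poly_alg \<Lambda> =
     \<lparr>carrier = {p. \<forall>m \<in> Poly_Mapping.keys p. Poly_Mapping.keys m \<subseteq> \<Lambda>},
      monoid.mult = (*), monoid.one = 1, ring.zero = 0, ring.add = (+),
      module.smult = (\<lambda>c p. Poly_Mapping.single 0 c * p)\<rparr>"

definition poly_var :: "'i \<Rightarrow> ('i \<Rightarrow>\<^sub>0 nat) \<Rightarrow>\<^sub>0 'k::field" where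
  "poly_var i = Poly_Mapping.single (Poly_Mapping.single i 1) 1"

definition poly_pd ::
  "'i \<Rightarrow> (('i \<Rightarrow>\<^sub>0 nat) \<Rightarrow>\<^sub>0 'k::field) \<Rightarrow> (('i \<Rightarrow>\<^sub>0 nat) \<Rightarrow>\<^sub>0 'k)" where
  "poly_pd i p =
     (\<Sum>m \<in> Poly_Mapping.keys p.
        Poly_Mapping.single (m - Poly_Mapping.single i 1)
          (of_nat (Poly_Mapping.lookup m i) * Poly_Mapping.lookup p m))"

text \<open>
  Localization of a commutative algebra at a multiplicative subset, as equivalence classes of
  fractions.  No assumption on zero divisors is made, nor that \<open>0 \<notin> S\<close>.
\<close>
definition loc_rel ::
  "('k, 'a, 'm) module_scheme \<Rightarrow> 'a set \<Rightarrow> (('a \<times> 'a) \<times> ('a \<times> 'a)) set" where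
  "loc_rel A S =
     {((a, s), (b, t)). a \<in> carrier A \<and> b \<in> carrier A \<and> s \<in> S \<and> t \<in> S \<and>
        (\<exists>u \<in> S. u \<otimes>\<^bsub>A\<^esub> (t \<otimes>\<^bsub>A\<^esub> a) = u \<otimes>\<^bsub>A\<^esub> (s \<otimes>\<^bsub>A\<^esub> b))}"

definition frac ::
  "('k, 'a, 'm) module_scheme \<Rightarrow> 'a set \<Rightarrow> 'a \<Rightarrow> 'a \<Rightarrow> ('a \<times> 'a) set" where
  "frac A S a s = loc_rel A S `` {(a, s)}"

definition loc_alg ::
  "('k, 'a, 'm) module_scheme \<Rightarrow> 'a set \<Rightarrow> ('k, ('a \<times> 'a) set) module" where
  "loc_alg A S =
     \<lparr>carrier = {frac A S a s | a s. a \<in> carrier A \<and> s \<in> S},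
      monoid.mult = (\<lambda>C D. \<Union>(a, s)\<in>C. \<Union>(b, t)\<in>D. frac A S (a \<otimes>\<^bsub>A\<^esub> b) (s \<otimes>\<^bsub>A\<^esub> t)),
      monoid.one = frac A S \<one>\<^bsub>A\<^esub> \<one>\<^bsub>A\<^esub>,
      ring.zero = frac A S \<zero>\<^bsub>A\<^esub> \<one>\<^bsub>A\<^esub>,
      ring.add = (\<lambda>C D. \<Union>(a, s)\<in>C. \<Union>(b, t)\<in>D.
               frac A S ((t \<otimes>\<^bsub>A\<^esub> a) \<oplus>\<^bsub>A\<^esub> (s \<otimes>\<^bsub>A\<^esub> b)) (s \<otimes>\<^bsub>A\<^esub> t)),
      module.smult = (\<lambda>c C. \<Union>(a, s)\<in>C. frac A S (c \<odot>\<^bsub>A\<^esub> a) s)\<rparr>"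

type_synonym ('k, 'i) poly_frac =
  "((('i \<Rightarrow>\<^sub>0 nat) \<Rightarrow>\<^sub>0 'k) \<times> (('i \<Rightarrow>\<^sub>0 nat) \<Rightarrow>\<^sub>0 'k)) set"

abbreviation loc_poly ::
  "'i set \<Rightarrow> (('i \<Rightarrow>\<^sub>0 nat) \<Rightarrow>\<^sub>0 'k::field) set \<Rightarrow> ('k, ('k, 'i) poly_frac) module" where
  "loc_poly \<Lambda> S \<equiv> loc_alg (poly_alg \<Lambda>) S"

definition loc_var ::
  "'i set \<Rightarrow> (('i \<Rightarrow>\<^sub>0 nat) \<Rightarrow>\<^sub>0 'k::field) set \<Rightarrow> 'i \<Rightarrow> ('k, 'i) poly_frac" where
  "loc_var \<Lambda> S i = frac (poly_alg \<Lambda>) S (poly_var i) 1"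

text \<open>The partial derivatives extend to the localization by the quotient rule.\<close>
definition loc_pd ::
  "'i set \<Rightarrow> (('i \<Rightarrow>\<^sub>0 nat) \<Rightarrow>\<^sub>0 'k::field) set \<Rightarrow> 'i \<Rightarrow>
   ('k, 'i) poly_frac \<Rightarrow> ('k, 'i) poly_frac" where
  "loc_pd \<Lambda> S i C =
     (\<Union>(a, s)\<in>C. frac (poly_alg \<Lambda>) S (s * poly_pd i a - a * poly_pd i s) (s * s))"

text \<open>
  \<open>P = S\<^sup>-\<^sup>1K[x\<^sub>i]\<^sub>i\<^sub>\<in>\<^sub>\<Lambda> / (f\<^sub>s)\<^sub>s\<^sub>\<in>\<^sub>\<Gamma>\<close> with quotient map \<open>q\<close>.
\<close>
definition poisson_presentation ::
  "('k::field, 'p, 'm) poisson_scheme \<Rightarrow> 'i set \<Rightarrow> (('i \<Rightarrow>\<^sub>0 nat) \<Rightarrow>\<^sub>0 'k) set \<Rightarrow>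
   's set \<Rightarrow> ('s \<Rightarrow> ('k, 'i) poly_frac) \<Rightarrow> (('k, 'i) poly_frac \<Rightarrow> 'p) \<Rightarrow> bool" where
  "poisson_presentation P \<Lambda> S \<Gamma> f q \<longleftrightarrow>
     submonoid S (poly_alg \<Lambda> :: ('k, ('i \<Rightarrow>\<^sub>0 nat) \<Rightarrow>\<^sub>0 'k) module) \<and>
     f \<in> \<Gamma> \<rightarrow> carrier (loc_poly \<Lambda> S) \<and>
     q \<in> alg_hom (loc_poly \<Lambda> S) P \<and>
     q ` carrier (loc_poly \<Lambda> S) = carrier P \<and>
     a_kernel (loc_poly \<Lambda> S) P q = Idl\<^bsub>loc_poly \<Lambda> S\<^esub> (f ` \<Gamma>)"

text \<open>
  \<open>\<Sum>\<^sub>i\<^sub>\<in>\<^sub>\<Lambda> (\<partial>g/\<partial>x\<^sub>i) y\<^sub>i\<close> in a ring \<open>F\<close> receiving \<open>P\<close> by \<open>\<iota>\<close>; only finitely many of the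
  derivatives are nonzero, and the sum runs over those.
\<close>
definition pd_sum ::
  "('a, 'n) ring_scheme \<Rightarrow> ('p \<Rightarrow> 'a) \<Rightarrow> ('i \<Rightarrow> 'a) \<Rightarrow> 'i set \<Rightarrow>
   (('i \<Rightarrow>\<^sub>0 nat) \<Rightarrow>\<^sub>0 'k::field) set \<Rightarrow> (('k, 'i) poly_frac \<Rightarrow> 'p) \<Rightarrow>
   ('k, 'i) poly_frac \<Rightarrow> 'a" where
  "pd_sum F \<iota> y \<Lambda> S q g =
     (\<Oplus>\<^bsub>F\<^esub>i \<in> {i \<in> \<Lambda>. loc_pd \<Lambda> S i g \<noteq> \<zero>\<^bsub>loc_poly \<Lambda> S\<^esub>}.
        \<iota> (q (loc_pd \<Lambda> S i g)) \<otimes>\<^bsub>F\<^esub> y i)"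

section \<open>The presentations of the enveloping algebra\<close>

text \<open>
  \<open>r i j\<close> is the chosen representative of \<open>{x\<^sub>i, x\<^sub>j}\<close> in the localized polynomial algebra.
\<close>
definition delta_rels ::
  "('k::field, 'p, 'm) poisson_scheme \<Rightarrow> 'i set \<Rightarrow> (('i \<Rightarrow>\<^sub>0 nat) \<Rightarrow>\<^sub>0 'k) set \<Rightarrow>
   's set \<Rightarrow> ('s \<Rightarrow> ('k, 'i) poly_frac) \<Rightarrow> (('k, 'i) poly_frac \<Rightarrow> 'p) \<Rightarrow>
   ('i \<Rightarrow> 'i \<Rightarrow> ('k, 'i) poly_frac) \<Rightarrow> (('p + 'i) list \<Rightarrow> 'k) set" where
  "delta_rels P \<Lambda> S \<Gamma> f q r =
     (let F = free_alg (Sum_Type.Plus (carrier P) \<Lambda>);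
          \<iota> = (\<lambda>a. free_gen (Inl a));
          \<delta> = (\<lambda>i. free_gen (Inr i));
          x = (\<lambda>i. q (loc_var \<Lambda> S i))
      in alg_rels F P \<iota> \<union>
         {commutator F (\<delta> i) (\<delta> j) \<ominus>\<^bsub>F\<^esub> pd_sum F \<iota> \<delta> \<Lambda> S q (r i j)
           | i j. i \<in> \<Lambda> \<and> j \<in> \<Lambda> \<and> i \<noteq> j} \<union>
         {commutator F (\<delta> i) (\<iota> (x j)) \<ominus>\<^bsub>F\<^esub> \<iota> \<lbrace>x i, x j\<rbrace>\<^bsub>P\<^esub>
           | i j. i \<in> \<Lambda> \<and> j \<in> \<Lambda>} \<union>
         {pd_sum F \<iota> \<delta> \<Lambda> S q (f s) | s. s \<in> \<Gamma>})"

definition delta_P_rels ::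
  "('k::field, 'p, 'm) poisson_scheme \<Rightarrow> (('p + 'p) list \<Rightarrow> 'k) set" where
  "delta_P_rels P =
     (let F = free_alg (Sum_Type.Plus (carrier P) (carrier P));
          \<iota> = (\<lambda>a. free_gen (Inl a));
          \<delta> = (\<lambda>a. free_gen (Inr a))
      in alg_rels F P \<iota> \<union>
         {commutator F (\<delta> a) (\<delta> b) \<ominus>\<^bsub>F\<^esub> \<delta> \<lbrace>a, b\<rbrace>\<^bsub>P\<^esub>
           | a b. a \<in> carrier P \<and> b \<in> carrier P} \<union>
         {commutator F (\<delta> a) (\<iota> b) \<ominus>\<^bsub>F\<^esub> \<iota> \<lbrace>a, b\<rbrace>\<^bsub>P\<^esub>
           | a b. a \<in> carrier P \<and> b \<in> carrier P} \<union>
         {\<delta> (a \<otimes>\<^bsub>P\<^esub> b) \<ominus>\<^bsub>F\<^esub> ((\<iota> a \<otimes>\<^bsub>F\<^esub> \<delta> b) \<oplus>\<^bsub>F\<^esub> (\<iota> b \<otimes>\<^bsub>F\<^esub> \<delta> a))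
           | a b. a \<in> carrier P \<and> b \<in> carrier P} \<union>
         {\<delta> ((l \<odot>\<^bsub>P\<^esub> a) \<oplus>\<^bsub>P\<^esub> (m \<odot>\<^bsub>P\<^esub> b)) \<ominus>\<^bsub>F\<^esub> ((l \<odot>\<^bsub>F\<^esub> \<delta> a) \<oplus>\<^bsub>F\<^esub> (m \<odot>\<^bsub>F\<^esub> \<delta> b))
           | l m a b. a \<in> carrier P \<and> b \<in> carrier P} \<union>
         {\<delta> \<one>\<^bsub>P\<^esub>})"

section \<open>Differential operators\<close>

text \<open>Endomorphisms are made extensional, so that equality is equality on the carrier.\<close>
definition End_alg :: "('k, 'p, 'm) module_scheme \<Rightarrow> ('k, 'p \<Rightarrow> 'p) module" where
  "End_alg M =
     \<lparr>carrier = {h \<in> carrier M \<rightarrow>\<^sub>E carrier M.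
        (\<forall>x \<in> carrier M. \<forall>y \<in> carrier M. h (x \<oplus>\<^bsub>M\<^esub> y) = h x \<oplus>\<^bsub>M\<^esub> h y) \<and>
        (\<forall>c. \<forall>x \<in> carrier M. h (c \<odot>\<^bsub>M\<^esub> x) = c \<odot>\<^bsub>M\<^esub> h x)},
      monoid.mult = compose (carrier M),
      monoid.one = (\<lambda>x \<in> carrier M. x),
      ring.zero = (\<lambda>x \<in> carrier M. \<zero>\<^bsub>M\<^esub>),
      ring.add = (\<lambda>g h. \<lambda>x \<in> carrier M. g x \<oplus>\<^bsub>M\<^esub> h x),
      module.smult = (\<lambda>c h. \<lambda>x \<in> carrier M. c \<odot>\<^bsub>M\<^esub> h x)\<rparr>"

definition mult_op :: "('k, 'p, 'm) module_scheme \<Rightarrow> 'p \<Rightarrow> 'p \<Rightarrow> 'p" where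
  "mult_op P a = (\<lambda>x \<in> carrier P. a \<otimes>\<^bsub>P\<^esub> x)"

definition pad :: "('k, 'p, 'm) poisson_scheme \<Rightarrow> 'p \<Rightarrow> 'p \<Rightarrow> 'p" where
  "pad P a = (\<lambda>x \<in> carrier P. \<lbrace>a, x\<rbrace>\<^bsub>P\<^esub>)"

primrec diff_ops_of_order :: "('k, 'p, 'm) module_scheme \<Rightarrow> nat \<Rightarrow> ('p \<Rightarrow> 'p) set" where
  "diff_ops_of_order P 0 =
     {h \<in> carrier (End_alg P).
        \<forall>a \<in> carrier P. commutator (End_alg P) h (mult_op P a) = \<zero>\<^bsub>End_alg P\<^esub>}"
| "diff_ops_of_order P (Suc n) =
     {h \<in> carrier (End_alg P).
        \<forall>a \<in> carrier P. commutator (End_alg P) h (mult_op P a) \<in> diff_ops_of_order P n}"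

definition diff_op_alg :: "('k, 'p, 'm) module_scheme \<Rightarrow> ('k, 'p \<Rightarrow> 'p) module" where
  "diff_op_alg P = (End_alg P) \<lparr>carrier := (\<Union>n. diff_ops_of_order P n)\<rparr>"

definition poisson_diff_ops :: "('k, 'p, 'm) poisson_scheme \<Rightarrow> ('p \<Rightarrow> 'p) set" where
  "poisson_diff_ops P =
     generated_subalgebra (End_alg P) (mult_op P ` carrier P \<union> pad P ` carrier P)"

text \<open>\<open>\<pi>\<close> is a homomorphism \<open>U \<rightarrow> D(P)\<close> with \<open>a \<mapsto> a\<close> and \<open>\<delta>\<^sub>b \<mapsto> pad\<^sub>b\<close>.\<close>
definition canonical_rep ::
  "('k, 'p, 'm) poisson_scheme \<Rightarrow> ('k, 'u, 'n) module_scheme \<Rightarrow>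
   ('p \<Rightarrow> 'u) \<Rightarrow> ('p \<Rightarrow> 'u) \<Rightarrow> ('u \<Rightarrow> 'p \<Rightarrow> 'p) \<Rightarrow> bool" where
  "canonical_rep P U \<alpha> \<beta> \<pi> \<longleftrightarrow>
     \<pi> \<in> alg_hom U (diff_op_alg P) \<and>
     (\<forall>a \<in> carrier P. \<pi> (\<alpha> a) = mult_op P a) \<and>
     (\<forall>b \<in> carrier P. \<pi> (\<beta> b) = pad P b)"

section \<open>The Poisson module \<open>P\<close>\<close>

definition left_module ::
  "('u, 'm) ring_scheme \<Rightarrow> ('p, 'n) ring_scheme \<Rightarrow> ('u \<Rightarrow> 'p \<Rightarrow> 'p) \<Rightarrow> bool" where
  "left_module U M act \<longleftrightarrow>
     ring U \<and> abelian_group M \<and>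
     (\<forall>u \<in> carrier U. \<forall>x \<in> carrier M. act u x \<in> carrier M) \<and>
     (\<forall>u \<in> carrier U. \<forall>x \<in> carrier M. \<forall>y \<in> carrier M.
        act u (x \<oplus>\<^bsub>M\<^esub> y) = act u x \<oplus>\<^bsub>M\<^esub> act u y) \<and>
     (\<forall>u \<in> carrier U. \<forall>v \<in> carrier U. \<forall>x \<in> carrier M.
        act (u \<oplus>\<^bsub>U\<^esub> v) x = act u x \<oplus>\<^bsub>M\<^esub> act v x) \<and>
     (\<forall>u \<in> carrier U. \<forall>v \<in> carrier U. \<forall>x \<in> carrier M.
        act (u \<otimes>\<^bsub>U\<^esub> v) x = act u (act v x)) \<and>
     (\<forall>x \<in> carrier M. act \<one>\<^bsub>U\<^esub> x = x)"

text \<open>A Poisson \<open>P\<close>-module is a left \<open>U\<close>-module; this is the structure carried by \<open>P\<close> itself.\<close>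
definition natural_poisson_module ::
  "('k, 'p, 'm) poisson_scheme \<Rightarrow> ('k, 'u, 'n) module_scheme \<Rightarrow>
   ('p \<Rightarrow> 'u) \<Rightarrow> ('p \<Rightarrow> 'u) \<Rightarrow> ('u \<Rightarrow> 'p \<Rightarrow> 'p) \<Rightarrow> bool" where
  "natural_poisson_module P U \<alpha> \<beta> act \<longleftrightarrow>
     left_module U P act \<and>
     (\<forall>a \<in> carrier P. \<forall>b \<in> carrier P. act (\<alpha> a) b = a \<otimes>\<^bsub>P\<^esub> b) \<and>
     (\<forall>a \<in> carrier P. \<forall>b \<in> carrier P. act (\<beta> a) b = \<lbrace>a, b\<rbrace>\<^bsub>P\<^esub>)"

definition annihilator ::
  "('u, 'm) ring_scheme \<Rightarrow> ('p, 'n) ring_scheme \<Rightarrow> ('u \<Rightarrow> 'p \<Rightarrow> 'p) \<Rightarrow> 'p \<Rightarrow> 'u set" where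
  "annihilator U M act x = {u \<in> carrier U. act u x = \<zero>\<^bsub>M\<^esub>}"

definition left_ideal_sum :: "('u, 'm) ring_scheme \<Rightarrow> ('i \<Rightarrow> 'u) \<Rightarrow> 'i set \<Rightarrow> 'u set" where
  "left_ideal_sum U d \<Lambda> =
     {(\<Oplus>\<^bsub>U\<^esub>i \<in> J. u i \<otimes>\<^bsub>U\<^esub> d i) | J u. finite J \<and> J \<subseteq> \<Lambda> \<and> u \<in> J \<rightarrow> carrier U}"

text \<open>\<open>U\<close> as a left \<open>P\<close>-module via \<open>\<alpha>\<close>.\<close>
definition restricted_module ::
  "('k, 'u, 'n) module_scheme \<Rightarrow> ('p \<Rightarrow> 'u) \<Rightarrow> ('p, 'u) module" where
  "restricted_module U \<alpha> =
     \<lparr>carrier = carrier U, monoid.mult = monoid.mult U, monoid.one = monoid.one U, ring.zero = ring.zero U, ring.add = ring.add U,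
      module.smult = (\<lambda>a u. \<alpha> a \<otimes>\<^bsub>U\<^esub> u)\<rparr>"

definition direct_sum :: "('p, 'm) ring_scheme \<Rightarrow> ('p, 'v, 'n) module_scheme \<Rightarrow>
    'v set \<Rightarrow> 'v set \<Rightarrow> bool" where
  "direct_sum R M N N' \<longleftrightarrow>
     module R M \<and> submodule N R M \<and> submodule N' R M \<and>
     N \<inter> N' = {\<zero>\<^bsub>M\<^esub>} \<and> N <+>\<^bsub>M\<^esub> N' = carrier M"

section \<open>Existence and full universality of the enveloping algebra\<close>

abbreviation (input) KR :: "'k::field ring" where "KR \<equiv> ring_of_type_algebra"

lemma K_simps [simp]:
  "carrier (KR :: 'k::field ring) = UNIV"
  "monoid.mult (KR :: 'k::field ring) = (*)"
  "monoid.one (KR :: 'k::field ring) = 1"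
  "ring.zero (KR :: 'k::field ring) = 0"
  "ring.add (KR :: 'k::field ring) = (+)"
  by (auto simp: ring_of_type_algebra_def fun_eq_iff)

lemma free_alg_simps:
  "monoid.mult (free_alg G) = (\<lambda>p q w. \<Sum>i\<le>length w. p (take i w) * q (drop i w))"
  "monoid.one (free_alg G) = (\<lambda>w. if w = [] then 1 else 0)"
  "ring.zero (free_alg G) = (\<lambda>w. 0)"
  "ring.add (free_alg G) = (\<lambda>p q w. p w + q w)"
  "module.smult (free_alg G) = (\<lambda>c p w. c * p w)"
  by (auto simp: free_alg_def)

lemma free_alg_carrier:
  "p \<in> carrier (free_alg G) \<longleftrightarrow> finite {w. p w \<noteq> 0} \<and> (\<forall>w. p w \<noteq> 0 \<longrightarrow> set w \<subseteq> G)"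
  by (auto simp: free_alg_def)

lemma free_mult_closed:
  fixes p q :: "'x list \<Rightarrow> 'k::field"
  assumes "p \<in> carrier (free_alg G)" "q \<in> carrier (free_alg G)"
  shows "monoid.mult (free_alg G) p q \<in> carrier (free_alg G)"
proof -
  have *: "\<exists>u v. p u \<noteq> 0 \<and> q v \<noteq> 0 \<and> w = u @ v" if "(\<Sum>i\<le>length w. p (take i w) * q (drop i w)) \<noteq> 0" for w
  proof -
    from that obtain i where "p (take i w) * q (drop i w) \<noteq> 0"
      by (meson sum.not_neutral_contains_not_neutral)
    then show ?thesis by (metis append_take_drop_id mult_eq_0_iff)
  qed
  have "{w. (\<Sum>i\<le>length w. p (take i w) * q (drop i w)) \<noteq> 0}
     \<subseteq> (\<lambda>(u, v). u @ v) ` ({u. p u \<noteq> 0} \<times> {v. q v \<noteq> 0})"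
    using * by fast
  then have "finite {w. (\<Sum>i\<le>length w. p (take i w) * q (drop i w)) \<noteq> 0}"
    using assms by (auto simp: free_alg_carrier intro: finite_subset)
  moreover have "set w \<subseteq> G" if "(\<Sum>i\<le>length w. p (take i w) * q (drop i w)) \<noteq> 0" for w
    using *[OF that] assms unfolding free_alg_carrier by (metis le_sup_iff set_append)
  ultimately show ?thesis by (auto simp: free_alg_carrier free_alg_simps)
qed

lemma free_mult_assoc:
  fixes p q r :: "'x list \<Rightarrow> 'k::field"
  shows "monoid.mult (free_alg G) (monoid.mult (free_alg G) p q) r
       = monoid.mult (free_alg G) p (monoid.mult (free_alg G) q r)"
proof
  fix w :: "'x list"
  let ?n = "length w"
  define h where "h = (\<lambda>i j (k::nat). p (take i w) * q (take j (drop i w)) * r (drop (i + j) w))"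
  have "monoid.mult (free_alg G) (monoid.mult (free_alg G) p q) r w
     = (\<Sum>i=0..?n. \<Sum>j=0..i. h j (i - j) (?n - i))"
    by (auto simp: free_alg_simps h_def sum_distrib_right atMost_atLeast0 drop_take min_def intro!: sum.cong split: if_splits)
  also have "\<dots> = (\<Sum>j=0..?n. \<Sum>i=0..?n-j. h j i (?n - j - i))"
    by (rule fps_mult_assoc_lemma)
  also have "\<dots> = monoid.mult (free_alg G) p (monoid.mult (free_alg G) q r) w"
    by (auto simp: free_alg_simps h_def sum_distrib_left atMost_atLeast0 mult.assoc add.commute intro!: sum.cong)
  finally show "monoid.mult (free_alg G) (monoid.mult (free_alg G) p q) r w
    = monoid.mult (free_alg G) p (monoid.mult (free_alg G) q r) w" .
qed

lemma free_one_mult: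
  fixes p :: "'x list \<Rightarrow> 'k::field"
  shows "monoid.mult (free_alg G) (monoid.one (free_alg G)) p = p"
    and "monoid.mult (free_alg G) p (monoid.one (free_alg G)) = p"
proof -
  show "monoid.mult (free_alg G) (monoid.one (free_alg G)) p = p"
  proof
    fix w
    have "(\<Sum>i\<le>length w. (if take i w = [] then 1 else 0) * p (drop i w))
       = (\<Sum>i\<le>length w. if i = 0 then p w else 0)"
      by (rule sum.cong) auto
    then show "monoid.mult (free_alg G) (monoid.one (free_alg G)) p w = p w"
      by (simp add: free_alg_simps)
  qed
  show "monoid.mult (free_alg G) p (monoid.one (free_alg G)) = p"
  proof
    fix w
    have "(\<Sum>i\<le>length w. p (take i w) * (if drop i w = [] then 1 else 0))
       = (\<Sum>i\<le>length w. if i = length w then p w else 0)"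
      by (rule sum.cong) auto
    then show "monoid.mult (free_alg G) p (monoid.one (free_alg G)) w = p w"
      by (simp add: free_alg_simps)
  qed
qed

lemma free_add_closed:
  fixes p q :: "'x list \<Rightarrow> 'k::field"
  assumes "p \<in> carrier (free_alg G)" "q \<in> carrier (free_alg G)"
  shows "ring.add (free_alg G) p q \<in> carrier (free_alg G)"
proof -
  have "{w. p w + q w \<noteq> 0} \<subseteq> {w. p w \<noteq> 0} \<union> {w. q w \<noteq> 0}" by auto
  then have "finite {w. p w + q w \<noteq> 0}"
    using assms unfolding free_alg_carrier by (meson finite_UnI finite_subset)
  then show ?thesis using assms by (auto simp: free_alg_carrier free_alg_simps) (metis add_0 subset_iff)
qed

lemma free_smult_closed:
  fixes p :: "'x list \<Rightarrow> 'k::field"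
  assumes "p \<in> carrier (free_alg G)"
  shows "module.smult (free_alg G) c p \<in> carrier (free_alg G)"
proof -
  have "{w. c * p w \<noteq> 0} \<subseteq> {w. p w \<noteq> 0}" by auto
  then show ?thesis using assms by (auto simp: free_alg_carrier free_alg_simps intro: finite_subset)
qed

lemma free_ring: "ring (free_alg G :: ('k::field, 'x list \<Rightarrow> 'k) module)" (is "ring ?F")
proof (rule ringI)
  show "abelian_group ?F"
  proof (rule abelian_groupI)
    fix p assume p: "p \<in> carrier ?F"
    have "ring.add ?F (module.smult ?F (-1) p) p = ring.zero ?F"
      by (auto simp: free_alg_simps)
    then show "\<exists>q\<in>carrier ?F. ring.add ?F q p = ring.zero ?F"
      using free_smult_closed[OF p] by blast
  qed (auto simp: free_add_closed, auto simp: free_alg_simps free_alg_carrier)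
  show "monoid ?F"
    by (rule monoidI)
      (auto simp: free_mult_closed free_mult_assoc free_one_mult, auto simp: free_alg_simps free_alg_carrier)
qed (auto simp: free_alg_simps sum.distrib[symmetric] algebra_simps)

lemma free_assoc: "assoc_algebra (free_alg G :: ('k::field, 'x list \<Rightarrow> 'k) module)" (is "assoc_algebra ?F")
proof -
  interpret ring ?F by (rule free_ring)
  have "module KR ?F"
    by (rule moduleI)
      (auto simp: free_smult_closed is_abelian_group cring_from_type_algebra, auto simp: free_alg_simps algebra_simps)
  then show ?thesis
    by (auto intro!: assoc_algebra.intro free_ring assoc_algebra_axioms.intro)
      (auto simp: free_alg_simps sum_distrib_left algebra_simps)
qed

lemma free_gen_closed: "x \<in> G \<Longrightarrow> free_gen x \<in> carrier (free_alg G)"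
  by (auto simp: free_alg_carrier free_gen_def)

definition fmon :: "'k::field \<Rightarrow> 'x list \<Rightarrow> 'x list \<Rightarrow> 'k" where
  "fmon c u = (\<lambda>w. if w = u then c else 0)"

lemma fmon_closed: "set u \<subseteq> G \<Longrightarrow> fmon c u \<in> carrier (free_alg G)"
  by (auto simp: free_alg_carrier fmon_def)

lemma fmon_mult:
  "monoid.mult (free_alg G) (fmon c u) (fmon d v) = fmon (c * d) (u @ v)"
proof
  fix w
  have "(\<Sum>i\<le>length w. fmon c u (take i w) * fmon d v (drop i w))
      = (\<Sum>i\<le>length w. if i = length u then (if w = u @ v then c * d else 0) else 0)"
  proof (rule sum.cong)
    fix i assume "i \<in> {..length w}"
    then have *: "(take i w = u \<and> drop i w = v) \<longleftrightarrow> (i = length u \<and> w = u @ v)" by auto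
    then show "fmon c u (take i w) * fmon d v (drop i w)
      = (if i = length u then (if w = u @ v then c * d else 0) else 0)"
    proof -
      have "fmon c u (take i w) * fmon d v (drop i w)
        = (if take i w = u \<and> drop i w = v then c * d else 0)" by (simp add: fmon_def)
      also have "\<dots> = (if i = length u \<and> w = u @ v then c * d else 0)" using * by presburger
      finally show ?thesis by simp
    qed
  qed simp
  then show "monoid.mult (free_alg G) (fmon c u) (fmon d v) w = fmon (c * d) (u @ v) w"
    by (auto simp: free_alg_simps fmon_def)
qed

lemma free_induct [consumes 1, case_names zero add]:
  fixes p :: "'x list \<Rightarrow> 'k::field"
  assumes "p \<in> carrier (free_alg G)"
    and "Q (ring.zero (free_alg G))"
    and "\<And>c u q. \<lbrakk>set u \<subseteq> G; q \<in> carrier (free_alg G); Q q\<rbrakk> \<Longrightarrow> Q (ring.add (free_alg G) (fmon c u) q)"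
  shows "Q p"
proof -
  have "\<forall>p. {w. p w \<noteq> 0} = W \<longrightarrow> W \<subseteq> lists G \<longrightarrow> Q p" if "finite W" for W
    using that
  proof (induction W)
    case empty
    have "Q p" if "{w. p w \<noteq> 0} = {}" for p
    proof -
      have "p = ring.zero (free_alg G)" using that by (auto simp: free_alg_simps)
      then show ?thesis using assms(2) by simp
    qed
    then show ?case by blast
  next
    case (insert u W)
    show ?case
    proof (intro allI impI)
      fix p :: "'x list \<Rightarrow> 'k"
      assume p: "{w. p w \<noteq> 0} = insert u W" "insert u W \<subseteq> lists G"
      define q where "q = p(u := 0)"
      have q: "{w. q w \<noteq> 0} = W" using p insert.hyps by (auto simp: q_def)
      then have "Q q" using insert.IH p by blast
      moreover have "q \<in> carrier (free_alg G)"
      proof -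
        have "set w \<subseteq> G" if "q w \<noteq> 0" for w
        proof -
          have "w \<in> W" using q that by blast
          then show ?thesis using p(2) by (auto simp: lists_eq_set)
        qed
        then show ?thesis unfolding free_alg_carrier using q insert.hyps(1) by simp
      qed
      moreover have "p = ring.add (free_alg G) (fmon (p u) u) q"
        by (auto simp: free_alg_simps q_def fmon_def)
      moreover have "set u \<subseteq> G" using p(2) by (auto simp: lists_eq_set)
      ultimately show "Q p" using assms(3)[of u q "p u"] by simp
    qed
  qed
  moreover have "finite {w. p w \<noteq> 0}" "{w. p w \<noteq> 0} \<subseteq> lists G"
    using assms(1) by (auto simp: free_alg_carrier)
  ultimately show ?thesis by blast
qed

context assoc_algebra
begin

lemma smult_closed' [simp, intro]: "x \<in> carrier A \<Longrightarrow> c \<odot> x \<in> carrier A"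
  using smult_closed by simp

lemma smult_simps:
  "x \<in> carrier A \<Longrightarrow> (c + d) \<odot> x = (c \<odot> x) \<oplus> (d \<odot> x)"
  "\<lbrakk>x \<in> carrier A; y \<in> carrier A\<rbrakk> \<Longrightarrow> c \<odot> (x \<oplus> y) = (c \<odot> x) \<oplus> (c \<odot> y)"
  "x \<in> carrier A \<Longrightarrow> (c * d) \<odot> x = c \<odot> (d \<odot> x)"
  "x \<in> carrier A \<Longrightarrow> 1 \<odot> x = x"
  "x \<in> carrier A \<Longrightarrow> 0 \<odot> x = \<zero>"
  "c \<odot> \<zero> = \<zero>"
  using smult_l_distr[of c d x] smult_r_distr[of c x y] smult_assoc1[of c d x] smult_one[of x]
    smult_l_null[of x] smult_r_null[of c] by simp_all

lemma smult_commute: "x \<in> carrier A \<Longrightarrow> d \<odot> (c \<odot> x) = c \<odot> (d \<odot> x)"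
  by (metis mult.commute smult_simps(3))

definition word_val :: "('x \<Rightarrow> 'a) \<Rightarrow> 'x list \<Rightarrow> 'a" where
  "word_val g w = foldr (\<lambda>x y. g x \<otimes> y) w \<one>"

lemma word_val_closed: "g \<in> G \<rightarrow> carrier A \<Longrightarrow> set w \<subseteq> G \<Longrightarrow> word_val g w \<in> carrier A"
  by (induction w) (auto simp: word_val_def)

lemma word_val_append:
  "g \<in> G \<rightarrow> carrier A \<Longrightarrow> set u \<subseteq> G \<Longrightarrow> set v \<subseteq> G \<Longrightarrow>
   word_val g (u @ v) = word_val g u \<otimes> word_val g v"
proof (induction u)
  case Nil
  then show ?case using word_val_closed[of g G v] by (simp add: word_val_def)
next
  case (Cons x u)
  then show ?case using word_val_closed[of g G u] word_val_closed[of g G v]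
    by (simp add: word_val_def m_assoc Pi_iff)
qed

definition ev :: "('x \<Rightarrow> 'a) \<Rightarrow> ('x list \<Rightarrow> 'k) \<Rightarrow> 'a" where
  "ev g p = (\<Oplus>w \<in> {w. p w \<noteq> 0}. p w \<odot> word_val g w)"

context
  fixes g :: "'x \<Rightarrow> 'a" and G
  assumes g: "g \<in> G \<rightarrow> carrier A"
begin

lemma ev_superset:
  assumes "finite W" "W \<subseteq> lists G" "{w. p w \<noteq> 0} \<subseteq> W"
  shows "ev g p = (\<Oplus>w \<in> W. p w \<odot> word_val g w)"
  unfolding ev_def
proof (rule add.finprod_mono_neutral_cong_left)
  show "finite W" "{w. p w \<noteq> 0} \<subseteq> W" by fact+
  show "(\<lambda>w. p w \<odot> word_val g w) \<in> W \<rightarrow> carrier A"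
  proof
    fix w assume "w \<in> W"
    then have "set w \<subseteq> G" using assms(2) by (auto simp: lists_eq_set)
    then show "p w \<odot> word_val g w \<in> carrier A" using word_val_closed[OF g] by simp
  qed
  show "p w \<odot> word_val g w = \<zero>" if "w \<in> W - {w. p w \<noteq> 0}" for w
  proof -
    have "set w \<subseteq> G" "p w = 0" using that assms(2) by (auto simp: lists_eq_set)
    then show ?thesis using word_val_closed[OF g, of w] by (simp add: smult_simps(5))
  qed
qed simp

lemma ev_closed: "p \<in> carrier (free_alg G) \<Longrightarrow> ev g p \<in> carrier A"
  unfolding ev_def free_alg_carrier
  by (rule finsum_closed) (simp add: Pi_iff word_val_closed[OF g])

lemma ev_add:
  assumes "p \<in> carrier (free_alg G)" "q \<in> carrier (free_alg G)"
  shows "ev g (ring.add (free_alg G) p q) = ev g p \<oplus> ev g q"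
proof -
  let ?W = "{w. p w \<noteq> 0} \<union> {w. q w \<noteq> 0}"
  have W: "finite ?W" "?W \<subseteq> lists G" using assms by (auto simp: free_alg_carrier)
  have wv: "word_val g w \<in> carrier A" if "w \<in> ?W" for w
  proof -
    have "set w \<subseteq> G" using that W(2) by (auto simp: lists_eq_set)
    then show ?thesis by (rule word_val_closed[OF g])
  qed
  have sub: "{w. ring.add (free_alg G) p q w \<noteq> 0} \<subseteq> ?W" by (auto simp: free_alg_simps)
  have "ev g (ring.add (free_alg G) p q) = (\<Oplus>w \<in> ?W. (p w + q w) \<odot> word_val g w)"
    using ev_superset[OF W sub] by (simp add: free_alg_simps)
  also have "\<dots> = (\<Oplus>w \<in> ?W. (p w \<odot> word_val g w) \<oplus> (q w \<odot> word_val g w))"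
    by (rule add.finprod_cong') (simp_all add: Pi_iff wv smult_simps(1) del: Un_iff mem_Collect_eq)
  also have "\<dots> = (\<Oplus>w \<in> ?W. p w \<odot> word_val g w) \<oplus> (\<Oplus>w \<in> ?W. q w \<odot> word_val g w)"
    by (rule finsum_addf) (simp_all add: Pi_iff wv del: Un_iff mem_Collect_eq)
  also have "\<dots> = ev g p \<oplus> ev g q"
    using ev_superset[OF W, of p] ev_superset[OF W, of q] by simp
  finally show ?thesis .
qed

lemma ev_zero: "ev g (ring.zero (free_alg G)) = \<zero>"
  by (simp add: ev_def free_alg_simps)

lemma ev_fmon: "set u \<subseteq> G \<Longrightarrow> ev g (fmon c u) = c \<odot> word_val g u"
proof -
  assume u: "set u \<subseteq> G"
  have "{w. fmon c u w \<noteq> 0} \<subseteq> {u}" by (auto simp: fmon_def)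
  then have "ev g (fmon c u) = (\<Oplus>w \<in> {u}. fmon c u w \<odot> word_val g w)"
    using u by (intro ev_superset) (auto simp: lists_eq_set)
  then show ?thesis using word_val_closed[OF g u] by (simp add: fmon_def)
qed

lemma ev_gen: "x \<in> G \<Longrightarrow> ev g (free_gen x) = g x"
  using ev_fmon[of "[x]" 1] g by (auto simp: fmon_def[abs_def] free_gen_def[abs_def] word_val_def Pi_iff smult_simps)

lemma ev_one: "ev g (monoid.one (free_alg G)) = \<one>"
  using ev_fmon[of "[]" 1] by (simp add: fmon_def[abs_def] free_alg_simps word_val_def smult_simps)

lemma ev_mult:
  assumes p: "p \<in> carrier (free_alg G)" and q: "q \<in> carrier (free_alg G)"
  shows "ev g (monoid.mult (free_alg G) p q) = ev g p \<otimes> ev g q"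
proof -
  interpret F: assoc_algebra "free_alg G :: ('k, 'x list \<Rightarrow> 'k) module" by (rule free_assoc)
  have 1: "ev g (monoid.mult (free_alg G) (fmon c u) q) = ev g (fmon c u) \<otimes> ev g q"
    if u: "set u \<subseteq> G" and q: "q \<in> carrier (free_alg G)" for c u q
    using q
  proof (induction q rule: free_induct)
    case zero
    then show ?case using u by (simp add: ev_zero ev_closed fmon_closed)
  next
    case (add d v q)
    have "ev g (monoid.mult (free_alg G) (fmon c u) (fmon d v)) = ev g (fmon c u) \<otimes> ev g (fmon d v)"
      using u add(1) word_val_closed[OF g]
      by (simp add: fmon_mult ev_fmon word_val_append[OF g] smult_mult_left smult_mult_right smult_simps smult_commute)
    moreover have "monoid.mult (free_alg G) (fmon c u) (ring.add (free_alg G) (fmon d v) q)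
      = ring.add (free_alg G) (monoid.mult (free_alg G) (fmon c u) (fmon d v)) (monoid.mult (free_alg G) (fmon c u) q)"
      using F.r_distr[of "fmon d v" q "fmon c u"] u add(1,2) by (simp only: fmon_closed)
    ultimately show ?case using u add
      by (simp only: ev_add fmon_closed free_mult_closed ev_closed r_distr)
  qed
  show ?thesis using p
  proof (induction p rule: free_induct)
    case zero
    then show ?case using q by (simp add: ev_zero ev_closed)
  next
    case (add d v p)
    have "monoid.mult (free_alg G) (ring.add (free_alg G) (fmon d v) p) q
      = ring.add (free_alg G) (monoid.mult (free_alg G) (fmon d v) q) (monoid.mult (free_alg G) p q)"
      using F.l_distr[of "fmon d v" p q] q add(1,2) by (simp only: fmon_closed)
    then show ?case using q add 1[OF add(1) q]
      by (simp only: ev_add fmon_closed free_mult_closed ev_closed l_distr)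
  qed
qed

lemma ev_smult:
  assumes p: "p \<in> carrier (free_alg G)"
  shows "ev g (module.smult (free_alg G) c p) = c \<odot> ev g p"
proof -
  have "module.smult (free_alg G) c p = monoid.mult (free_alg G) (fmon c []) p"
  proof -
    interpret F: assoc_algebra "free_alg G :: ('k, 'x list \<Rightarrow> 'k) module" by (rule free_assoc)
    have "fmon c [] = module.smult (free_alg G) c (monoid.one (free_alg G))"
      by (auto simp: fmon_def free_alg_simps)
    then show ?thesis using p by (simp add: F.smult_mult_left)
  qed
  then show ?thesis using p
    by (simp add: ev_mult fmon_closed ev_fmon word_val_def smult_mult_left ev_closed)
qed

lemma ev_hom: "ev g \<in> alg_hom (free_alg G) A"
  by (auto simp: alg_hom_def ring_hom_def ev_closed ev_mult ev_add ev_one ev_smult)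

end

end


lemma alg_hom_iff:
  "h \<in> alg_hom A B \<longleftrightarrow>
     (\<forall>x \<in> carrier A. h x \<in> carrier B) \<and>
     (\<forall>x \<in> carrier A. \<forall>y \<in> carrier A. h (x \<otimes>\<^bsub>A\<^esub> y) = h x \<otimes>\<^bsub>B\<^esub> h y) \<and>
     (\<forall>x \<in> carrier A. \<forall>y \<in> carrier A. h (x \<oplus>\<^bsub>A\<^esub> y) = h x \<oplus>\<^bsub>B\<^esub> h y) \<and>
     h \<one>\<^bsub>A\<^esub> = \<one>\<^bsub>B\<^esub> \<and>
     (\<forall>c. \<forall>x \<in> carrier A. h (c \<odot>\<^bsub>A\<^esub> x) = c \<odot>\<^bsub>B\<^esub> h x)"
  by (auto simp: alg_hom_def ring_hom_def Pi_iff)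

lemma alg_hom_comp: "f \<in> alg_hom A B \<Longrightarrow> g \<in> alg_hom B C \<Longrightarrow> (\<lambda>x. g (f x)) \<in> alg_hom A C"
  by (auto simp: alg_hom_iff)

lemma alg_hom_id: "(\<lambda>x. x) \<in> alg_hom A A"
  by (auto simp: alg_hom_iff)

lemma alg_hom_minus:
  assumes "ring A" "ring B" "h \<in> alg_hom A B" "x \<in> carrier A" "y \<in> carrier A"
  shows "h (x \<ominus>\<^bsub>A\<^esub> y) = h x \<ominus>\<^bsub>B\<^esub> h y"
proof -
  interpret ring_hom_ring A B h
    using assms(1-3) by (auto intro!: ring_hom_ringI2 simp: alg_hom_def)
  show ?thesis using assms(4,5) by (simp add: a_minus_def)
qed

lemma alg_homD:
  assumes "h \<in> alg_hom A B"
  shows "x \<in> carrier A \<Longrightarrow> h x \<in> carrier B"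
    and "\<lbrakk>x \<in> carrier A; y \<in> carrier A\<rbrakk> \<Longrightarrow> h (x \<otimes>\<^bsub>A\<^esub> y) = h x \<otimes>\<^bsub>B\<^esub> h y"
    and "\<lbrakk>x \<in> carrier A; y \<in> carrier A\<rbrakk> \<Longrightarrow> h (x \<oplus>\<^bsub>A\<^esub> y) = h x \<oplus>\<^bsub>B\<^esub> h y"
    and "h \<one>\<^bsub>A\<^esub> = \<one>\<^bsub>B\<^esub>"
    and "x \<in> carrier A \<Longrightarrow> h (c \<odot>\<^bsub>A\<^esub> x) = c \<odot>\<^bsub>B\<^esub> h x"
  using assms by (auto simp: alg_hom_iff)

lemma alg_hom_eq_on_free:
  assumes h: "h \<in> alg_hom (free_alg G) A" "h' \<in> alg_hom (free_alg G) A" and A: "ring A"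
    and eq: "\<And>x. x \<in> G \<Longrightarrow> h (free_gen x) = h' (free_gen x)"
    and p: "p \<in> carrier (free_alg G :: ('k::field, 'x list \<Rightarrow> 'k) module)"
  shows "h p = h' p"
proof -
  let ?F = "free_alg G :: ('k, 'x list \<Rightarrow> 'k) module"
  interpret F: assoc_algebra ?F by (rule free_assoc)
  have hz: "g (ring.zero ?F) = ring.zero A" if "g \<in> alg_hom ?F A" for g
  proof -
    interpret ring_hom_ring ?F A g
      using that A F.ring_axioms by (auto intro!: ring_hom_ringI2 simp: alg_hom_def)
    show ?thesis by simp
  qed
  have mon: "h (fmon c u) = h' (fmon c u)" if "set u \<subseteq> G" for c u
    using that
  proof (induction u arbitrary: c)
    case Nil
    have "fmon c [] = module.smult ?F c (monoid.one ?F)"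
      by (auto simp: fmon_def free_alg_simps)
    then show ?case
      by (simp only: alg_homD(4)[OF h(1)] alg_homD(4)[OF h(2)] alg_homD(5)[OF h(1) F.one_closed] alg_homD(5)[OF h(2) F.one_closed])
  next
    case (Cons x u)
    have "free_gen x = (fmon 1 [x] :: 'x list \<Rightarrow> 'k)" by (auto simp: fmon_def free_gen_def)
    then have "fmon c (x # u) = monoid.mult ?F (free_gen x) (fmon c u)"
      by (simp add: fmon_mult)
    moreover have "free_gen x \<in> carrier ?F" "fmon c u \<in> carrier ?F"
      using Cons.prems by (auto intro: free_gen_closed fmon_closed)
    moreover have "h (free_gen x) = h' (free_gen x)" "h (fmon c u) = h' (fmon c u)"
      using Cons eq by auto
    ultimately show ?case by (simp only: alg_homD(2)[OF h(1)] alg_homD(2)[OF h(2)])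
  qed
  show ?thesis using p
  proof (induction p rule: free_induct)
    case zero show ?case by (simp only: hz[OF h(1)] hz[OF h(2)])
  next
    case (add c u q)
    then have "fmon c u \<in> carrier ?F" by (auto intro: fmon_closed)
    then show ?case
      by (simp only: alg_homD(3)[OF h(1)] alg_homD(3)[OF h(2)] add mon[OF add(1)])
  qed
qed

context assoc_algebra
begin

lemma
  assumes I: "ideal I A"
  shows alg_quot_assoc: "assoc_algebra (alg_quot A I)"
    and alg_quot_proj: "(\<lambda>x. I +> x) \<in> alg_hom A (alg_quot A I)"
    and alg_quot_carrier: "carrier (alg_quot A I) = (\<lambda>x. I +> x) ` carrier A"
proof -
  interpret I: ideal I A by fact
  let ?Q = "alg_quot A I"
  show car: "carrier ?Q = (\<lambda>x. I +> x) ` carrier A"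
    by (auto simp: alg_quot_def FactRing_def A_RCOSETS_def')
  have mul: "(I +> x) \<otimes>\<^bsub>?Q\<^esub> (I +> y) = I +> (x \<otimes> y)" if "x \<in> carrier A" "y \<in> carrier A" for x y
    using I.rcoset_mult_add[OF that] by (simp add: alg_quot_def FactRing_def)
  have ad: "(I +> x) \<oplus>\<^bsub>?Q\<^esub> (I +> y) = I +> (x \<oplus> y)" if "x \<in> carrier A" "y \<in> carrier A" for x y
    using I.a_rcos_sum[OF that] by (simp add: alg_quot_def FactRing_def)
  have sm: "c \<odot>\<^bsub>?Q\<^esub> (I +> x) = I +> (c \<odot> x)" if x: "x \<in> carrier A" for c x
  proof -
    have "I +> (c \<odot> y) = I +> (c \<odot> x)" if y: "y \<in> I +> x" for y
    proof -
      obtain z where z: "z \<in> I" "y = z \<oplus> x" using y by (auto simp: a_r_coset_def r_coset_def)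
      have zc: "z \<in> carrier A" using z I.a_Hcarr by blast
      have "c \<odot> z = (c \<odot> \<one>) \<otimes> z" using zc by (simp add: smult_mult_left)
      then have cz: "c \<odot> z \<in> I" using I.I_l_closed[OF z(1), of "c \<odot> \<one>"] by simp
      have "c \<odot> y = (c \<odot> z) \<oplus> (c \<odot> x)" unfolding z(2) using zc x by (rule smult_simps(2))
      then have "c \<odot> y \<in> I +> (c \<odot> x)" using cz by (auto simp: a_r_coset_def r_coset_def)
      then show ?thesis using I.a_repr_independence'[OF _ smult_closed'[OF x]] by simp
    qed
    moreover have "x \<in> I +> x" using x by (rule I.a_rcos_self)
    ultimately have "(\<Union>y\<in>I +> x. I +> (c \<odot> y)) = I +> (c \<odot> x)" by blast
    then show ?thesis by (simp add: alg_quot_def)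
  qed
  have on: "\<one>\<^bsub>?Q\<^esub> = I +> \<one>" by (simp add: alg_quot_def FactRing_def)
  show proj: "(\<lambda>x. I +> x) \<in> alg_hom A ?Q"
    unfolding alg_hom_iff by (simp add: car mul ad sm on)
  have ze: "\<zero>\<^bsub>?Q\<^esub> = I +> \<zero>"
    using I.a_rcos_const[OF I.zero_closed] by (simp add: alg_quot_def FactRing_def)
  have ringQ: "ring ?Q"
  proof (rule ringI)
    show "abelian_group ?Q"
    proof (rule abelian_groupI)
      fix C assume "C \<in> carrier ?Q"
      then obtain x where x: "x \<in> carrier A" "C = I +> x" by (auto simp: car)
      have "(I +> (\<ominus> x)) \<oplus>\<^bsub>?Q\<^esub> C = \<zero>\<^bsub>?Q\<^esub>" using x by (simp add: ad ze l_neg)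
      moreover have "I +> (\<ominus> x) \<in> carrier ?Q" using x by (simp add: car)
      ultimately show "\<exists>D\<in>carrier ?Q. D \<oplus>\<^bsub>?Q\<^esub> C = \<zero>\<^bsub>?Q\<^esub>" by blast
    qed (auto simp: car ad ze a_ac)
    show "monoid ?Q"
      by (rule monoidI) (auto simp: car mul on m_assoc)
  qed (auto simp: car mul ad l_distr r_distr)
  then interpret Q: ring ?Q .
  have "module KR ?Q"
    by (rule moduleI)
      (auto simp: Q.is_abelian_group cring_from_type_algebra car sm ad smult_simps(1-4))
  moreover have "assoc_algebra_axioms ?Q"
    by (rule assoc_algebra_axioms.intro)
      (auto simp: car sm mul smult_mult_left smult_mult_right)
  ultimately show "assoc_algebra ?Q"
    using ringQ by (intro assoc_algebra.intro)
qed

lemma alg_quot_hom: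
  assumes I: "ideal I A" and B: "ring B" and h: "h \<in> alg_hom A B"
    and ker: "\<And>x. x \<in> I \<Longrightarrow> h x = \<zero>\<^bsub>B\<^esub>"
  shows "\<exists>f \<in> alg_hom (alg_quot A I) B. \<forall>x \<in> carrier A. f (I +> x) = h x"
proof -
  interpret I: ideal I A by fact
  interpret B: ring B by fact
  interpret P: assoc_algebra "alg_quot A I" by (rule alg_quot_assoc[OF I])
  define f where "f = (\<lambda>C. h (SOME x. x \<in> C))"
  have f: "f (I +> x) = h x" if x: "x \<in> carrier A" for x
  proof -
    have "(SOME y. y \<in> I +> x) \<in> I +> x" using I.a_rcos_self[OF x] by (rule someI)
    then obtain z where z: "z \<in> I" "(SOME y. y \<in> I +> x) = z \<oplus> x"
      by (auto simp: a_r_coset_def r_coset_def)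
    have zc: "z \<in> carrier A" by (rule I.a_Hcarr[OF z(1)])
    have "f (I +> x) = h (z \<oplus> x)" unfolding f_def z(2) ..
    also have "\<dots> = h z \<oplus>\<^bsub>B\<^esub> h x" by (rule alg_homD(3)[OF h zc x])
    also have "\<dots> = h x" using ker[OF z(1)] alg_homD(1)[OF h x] by simp
    finally show ?thesis .
  qed
  let ?Q = "alg_quot A I"
  have pm: "(I +> x) \<otimes>\<^bsub>?Q\<^esub> (I +> y) = I +> (x \<otimes> y)" "(I +> x) \<oplus>\<^bsub>?Q\<^esub> (I +> y) = I +> (x \<oplus> y)"
    if "x \<in> carrier A" "y \<in> carrier A" for x y
    using alg_homD(2,3)[OF alg_quot_proj[OF I] that] by simp_all
  have ps: "c \<odot>\<^bsub>?Q\<^esub> (I +> x) = I +> (c \<odot> x)" if "x \<in> carrier A" for c x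
    using alg_homD(5)[OF alg_quot_proj[OF I] that] by simp
  have po: "\<one>\<^bsub>?Q\<^esub> = I +> \<one>" using alg_homD(4)[OF alg_quot_proj[OF I]] by simp
  have "f \<in> alg_hom (alg_quot A I) B"
    unfolding alg_hom_iff alg_quot_carrier[OF I] ball_simps
    by (simp add: f pm ps po alg_homD[OF h])
  then show ?thesis using f by blast
qed

end

lemma
  fixes R :: "('x list \<Rightarrow> 'k::field) set"
  assumes R: "R \<subseteq> carrier (free_alg G)"
  shows presented_assoc: "assoc_algebra (presented_alg G R)"
    and presented_proj: "(\<lambda>p. (Idl\<^bsub>free_alg G\<^esub> R) +>\<^bsub>free_alg G\<^esub> p) \<in> alg_hom (free_alg G) (presented_alg G R)"
    and presented_rel: "p \<in> R \<Longrightarrow> (Idl\<^bsub>free_alg G\<^esub> R) +>\<^bsub>free_alg G\<^esub> p = \<zero>\<^bsub>presented_alg G R\<^esub>"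
    and presented_unique: "\<lbrakk>ring A; f \<in> alg_hom (presented_alg G R) A; f' \<in> alg_hom (presented_alg G R) A;
       \<And>x. x \<in> G \<Longrightarrow> f (presented_gen G R x) = f' (presented_gen G R x);
       u \<in> carrier (presented_alg G R)\<rbrakk> \<Longrightarrow> f u = f' u"
    and presented_universal: "\<lbrakk>assoc_algebra A; h \<in> alg_hom (free_alg G) A; \<And>p. p \<in> R \<Longrightarrow> h p = \<zero>\<^bsub>A\<^esub>\<rbrakk> \<Longrightarrow>
       \<exists>f \<in> alg_hom (presented_alg G R) A. \<forall>x \<in> G. f (presented_gen G R x) = h (free_gen x)"
proof -
  let ?F = "free_alg G :: ('k, 'x list \<Rightarrow> 'k) module"
  interpret F: assoc_algebra ?F by (rule free_assoc)
  let ?I = "Idl\<^bsub>?F\<^esub> R"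
  have I: "ideal ?I ?F" by (rule F.genideal_ideal[OF R])
  show "assoc_algebra (presented_alg G R)"
    unfolding presented_alg_def by (rule F.alg_quot_assoc[OF I])
  show pr: "(\<lambda>p. ?I +>\<^bsub>?F\<^esub> p) \<in> alg_hom ?F (presented_alg G R)"
    unfolding presented_alg_def by (rule F.alg_quot_proj[OF I])
  show "?I +>\<^bsub>?F\<^esub> p = \<zero>\<^bsub>presented_alg G R\<^esub>" if "p \<in> R"
  proof -
    interpret ideal ?I ?F by (rule I)
    have "p \<in> ?I" using F.genideal_self[OF R] that by blast
    then have "?I +>\<^bsub>?F\<^esub> p = ?I" by (rule a_rcos_const)
    then show ?thesis by (simp add: presented_alg_def alg_quot_def FactRing_def)
  qed
  show "f u = f' u" if A: "ring A" and ff: "f \<in> alg_hom (presented_alg G R) A" "f' \<in> alg_hom (presented_alg G R) A"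
       and eq: "\<And>x. x \<in> G \<Longrightarrow> f (presented_gen G R x) = f' (presented_gen G R x)"
       and u: "u \<in> carrier (presented_alg G R)" for A :: "('k, 'a, 'm) module_scheme" and f f' u
  proof -
    obtain p where p: "p \<in> carrier ?F" "u = ?I +>\<^bsub>?F\<^esub> p"
      using u unfolding presented_alg_def F.alg_quot_carrier[OF I] by blast
    show ?thesis unfolding p(2)
      by (rule alg_hom_eq_on_free[OF alg_hom_comp[OF pr ff(1)] alg_hom_comp[OF pr ff(2)] A _ p(1)])
        (rule eq[unfolded presented_gen_def])
  qed
  show "\<exists>f \<in> alg_hom (presented_alg G R) A. \<forall>x \<in> G. f (presented_gen G R x) = h (free_gen x)"
    if A: "assoc_algebra A" and h: "h \<in> alg_hom ?F A" and R0: "\<And>p. p \<in> R \<Longrightarrow> h p = \<zero>\<^bsub>A\<^esub>"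
    for A :: "('k, 'a, 'm) module_scheme" and h
  proof -
    interpret A: assoc_algebra A by (rule A)
    interpret H: ring_hom_ring ?F A h
      using h A.ring_axioms F.ring_axioms by (auto intro!: ring_hom_ringI2 simp: alg_hom_def)
    have "R \<subseteq> a_kernel ?F A h" unfolding a_kernel_def' using R R0 by blast
    then have "?I \<subseteq> a_kernel ?F A h"
      by (rule F.genideal_minimal[OF H.kernel_is_ideal])
    then have "\<And>x. x \<in> ?I \<Longrightarrow> h x = \<zero>\<^bsub>A\<^esub>" unfolding a_kernel_def' by blast
    from F.alg_quot_hom[OF I A.ring_axioms h this]
    obtain f where f: "f \<in> alg_hom (presented_alg G R) A"
      "\<And>x. x \<in> carrier ?F \<Longrightarrow> f (?I +>\<^bsub>?F\<^esub> x) = h x"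
      unfolding presented_alg_def by blast
    have "f (presented_gen G R x) = h (free_gen x)" if "x \<in> G" for x
      unfolding presented_gen_def by (rule f(2)[OF free_gen_closed[OF that]])
    with f(1) show ?thesis by blast
  qed
qed


definition env_model ::
  "('k::field, 'p, 'm) poisson_scheme \<Rightarrow> ('k, (('p + 'p) list \<Rightarrow> 'k) set) module" where
  "env_model P = presented_alg (Sum_Type.Plus (carrier P) (carrier P)) (delta_P_rels P)"

definition env_model_gen ::
  "('k::field, 'p, 'm) poisson_scheme \<Rightarrow> 'p + 'p \<Rightarrow> (('p + 'p) list \<Rightarrow> 'k) set" where
  "env_model_gen P = presented_gen (Sum_Type.Plus (carrier P) (carrier P)) (delta_P_rels P)"

context
  fixes P :: "('k::field, 'p, 'm) poisson_scheme"
  assumes P: "poisson_algebra P"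
begin

interpretation P: poisson_algebra P by (rule P)

lemma P_closed:
  "\<lbrakk>a \<in> carrier P; b \<in> carrier P\<rbrakk> \<Longrightarrow> a \<oplus>\<^bsub>P\<^esub> b \<in> carrier P"
  "\<lbrakk>a \<in> carrier P; b \<in> carrier P\<rbrakk> \<Longrightarrow> a \<otimes>\<^bsub>P\<^esub> b \<in> carrier P"
  "\<lbrakk>a \<in> carrier P; b \<in> carrier P\<rbrakk> \<Longrightarrow> \<lbrace>a, b\<rbrace>\<^bsub>P\<^esub> \<in> carrier P"
  "a \<in> carrier P \<Longrightarrow> c \<odot>\<^bsub>P\<^esub> a \<in> carrier P"
  "\<one>\<^bsub>P\<^esub> \<in> carrier P"
  using P.smult_closed[of c a] by (auto simp: P.bracket_closed)

abbreviation (input) "EG \<equiv> Sum_Type.Plus (carrier P) (carrier P)"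
abbreviation (input) "EF \<equiv> free_alg EG :: ('k, ('p + 'p) list \<Rightarrow> 'k) module"

interpretation F: assoc_algebra EF by (rule free_assoc)

lemma EF_gens [simp]:
  "a \<in> carrier P \<Longrightarrow> free_gen (Inl a) \<in> carrier EF"
  "a \<in> carrier P \<Longrightarrow> free_gen (Inr a) \<in> carrier EF"
  by (auto intro: free_gen_closed)

lemma EF_closed:
  "\<lbrakk>p \<in> carrier EF; q \<in> carrier EF\<rbrakk> \<Longrightarrow> p \<ominus>\<^bsub>EF\<^esub> q \<in> carrier EF"
  "\<lbrakk>p \<in> carrier EF; q \<in> carrier EF\<rbrakk> \<Longrightarrow> commutator EF p q \<in> carrier EF"
  by (auto simp: commutator_def)

lemma delta_P_rels_closed: "delta_P_rels P \<subseteq> carrier EF"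
  unfolding delta_P_rels_def alg_rels_def lin_rels_def Let_def
  by (auto intro!: EF_closed F.a_closed F.m_closed F.smult_closed' EF_gens P_closed F.one_closed)

lemma delta_P_rels_mem:
  fixes \<iota> \<delta> :: "'p \<Rightarrow> ('p + 'p) list \<Rightarrow> 'k"
  defines "\<iota> \<equiv> \<lambda>a. free_gen (Inl a)" and "\<delta> \<equiv> \<lambda>a. free_gen (Inr a)"
  assumes a: "a \<in> carrier P" and b: "b \<in> carrier P"
  shows "\<iota> (a \<oplus>\<^bsub>P\<^esub> b) \<ominus>\<^bsub>EF\<^esub> (\<iota> a \<oplus>\<^bsub>EF\<^esub> \<iota> b) \<in> delta_P_rels P"
    and "\<iota> (c \<odot>\<^bsub>P\<^esub> a) \<ominus>\<^bsub>EF\<^esub> (c \<odot>\<^bsub>EF\<^esub> \<iota> a) \<in> delta_P_rels P"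
    and "\<iota> (a \<otimes>\<^bsub>P\<^esub> b) \<ominus>\<^bsub>EF\<^esub> (\<iota> a \<otimes>\<^bsub>EF\<^esub> \<iota> b) \<in> delta_P_rels P"
    and "\<iota> \<one>\<^bsub>P\<^esub> \<ominus>\<^bsub>EF\<^esub> \<one>\<^bsub>EF\<^esub> \<in> delta_P_rels P"
    and "commutator EF (\<delta> a) (\<delta> b) \<ominus>\<^bsub>EF\<^esub> \<delta> \<lbrace>a, b\<rbrace>\<^bsub>P\<^esub> \<in> delta_P_rels P"
    and "commutator EF (\<delta> a) (\<iota> b) \<ominus>\<^bsub>EF\<^esub> \<iota> \<lbrace>a, b\<rbrace>\<^bsub>P\<^esub> \<in> delta_P_rels P"
    and "\<delta> (a \<otimes>\<^bsub>P\<^esub> b) \<ominus>\<^bsub>EF\<^esub> ((\<iota> a \<otimes>\<^bsub>EF\<^esub> \<delta> b) \<oplus>\<^bsub>EF\<^esub> (\<iota> b \<otimes>\<^bsub>EF\<^esub> \<delta> a)) \<in> delta_P_rels P"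
    and "\<delta> ((l \<odot>\<^bsub>P\<^esub> a) \<oplus>\<^bsub>P\<^esub> (m \<odot>\<^bsub>P\<^esub> b)) \<ominus>\<^bsub>EF\<^esub> ((l \<odot>\<^bsub>EF\<^esub> \<delta> a) \<oplus>\<^bsub>EF\<^esub> (m \<odot>\<^bsub>EF\<^esub> \<delta> b))
      \<in> delta_P_rels P"
  unfolding delta_P_rels_def alg_rels_def lin_rels_def Let_def \<iota>_def \<delta>_def using a b by blast+

lemma env_model_triple:
  "poisson_triple P (env_model P) (\<lambda>a. env_model_gen P (Inl a)) (\<lambda>a. env_model_gen P (Inr a))"
proof -
  let ?V = "env_model P" and ?R = "delta_P_rels P"
  let ?\<phi> = "\<lambda>p. (Idl\<^bsub>EF\<^esub> ?R) +>\<^bsub>EF\<^esub> p"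
  let ?\<iota> = "\<lambda>a. free_gen (Inl a) :: ('p + 'p) list \<Rightarrow> 'k" and ?\<delta> = "\<lambda>a. free_gen (Inr a) :: ('p + 'p) list \<Rightarrow> 'k"
  have V: "assoc_algebra ?V" unfolding env_model_def by (rule presented_assoc[OF delta_P_rels_closed])
  interpret V: assoc_algebra ?V by (rule V)
  have \<phi>: "?\<phi> \<in> alg_hom EF ?V"
    unfolding env_model_def by (rule presented_proj[OF delta_P_rels_closed])
  have gen: "env_model_gen P x = ?\<phi> (free_gen x)" for x
    by (simp add: env_model_gen_def presented_gen_def)
  note \<phi>c = alg_homD(1)[OF \<phi>] note \<phi>m = alg_homD(2)[OF \<phi>] note \<phi>a = alg_homD(3)[OF \<phi>]
  note \<phi>1 = alg_homD(4)[OF \<phi>] note \<phi>s = alg_homD(5)[OF \<phi>]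
  note \<phi>d = alg_hom_minus[OF F.ring_axioms V.ring_axioms \<phi>]
  have \<phi>k: "?\<phi> (commutator EF p q) = commutator ?V (?\<phi> p) (?\<phi> q)"
    if "p \<in> carrier EF" "q \<in> carrier EF" for p q
    using that by (simp add: commutator_def \<phi>d \<phi>m)
  have eq: "?\<phi> p = ?\<phi> q" if "p \<in> carrier EF" "q \<in> carrier EF" "p \<ominus>\<^bsub>EF\<^esub> q \<in> ?R" for p q
  proof -
    have "?\<phi> p \<ominus>\<^bsub>?V\<^esub> ?\<phi> q = \<zero>\<^bsub>?V\<^esub>"
      using presented_rel[OF delta_P_rels_closed that(3)] \<phi>d[OF that(1,2)] by (simp add: env_model_def)
    then show ?thesis using \<phi>c that(1,2) by (simp add: V.r_right_minus_eq)
  qed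
  note mem = delta_P_rels_mem
  show ?thesis
    unfolding poisson_triple_def alg_hom_iff gen
  proof (intro conjI ballI allI)
    fix a b c assume a: "a \<in> carrier P" and b: "b \<in> carrier P"
    note [simp] = a b P_closed(1)[OF a b] P_closed(2)[OF a b] P_closed(3)[OF a b] P_closed(4)[OF a] P_closed(4)[OF b] P_closed(5)
    note cl = EF_closed \<phi>c
    show "?\<phi> (?\<iota> (a \<otimes>\<^bsub>P\<^esub> b)) = ?\<phi> (?\<iota> a) \<otimes>\<^bsub>?V\<^esub> ?\<phi> (?\<iota> b)"
      using eq[OF _ _ mem(3)[OF a b]] by (simp add: \<phi>m)
    show "?\<phi> (?\<iota> (a \<oplus>\<^bsub>P\<^esub> b)) = ?\<phi> (?\<iota> a) \<oplus>\<^bsub>?V\<^esub> ?\<phi> (?\<iota> b)"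
      using eq[OF _ _ mem(1)[OF a b]] by (simp add: \<phi>a)
    have lin: "?\<phi> (?\<delta> ((l \<odot>\<^bsub>P\<^esub> x) \<oplus>\<^bsub>P\<^esub> (m \<odot>\<^bsub>P\<^esub> y))) = (l \<odot>\<^bsub>?V\<^esub> ?\<phi> (?\<delta> x)) \<oplus>\<^bsub>?V\<^esub> (m \<odot>\<^bsub>?V\<^esub> ?\<phi> (?\<delta> y))"
      if x: "x \<in> carrier P" and y: "y \<in> carrier P" for l m x y
      using eq[OF _ _ mem(8)[OF x y, of l m]] x y by (simp add: \<phi>a \<phi>s P_closed)
    show "?\<phi> (?\<delta> (a \<oplus>\<^bsub>P\<^esub> b)) = ?\<phi> (?\<delta> a) \<oplus>\<^bsub>?V\<^esub> ?\<phi> (?\<delta> b)"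
      using lin[OF a b, of 1 1] P.smult_one[OF a] P.smult_one[OF b] by (simp add: V.smult_simps(4) \<phi>c)
    show "?\<phi> (?\<delta> \<lbrace>a, b\<rbrace>\<^bsub>P\<^esub>) = commutator ?V (?\<phi> (?\<delta> a)) (?\<phi> (?\<delta> b))"
      using eq[OF _ _ mem(5)[OF a b]] by (simp add: \<phi>k EF_closed)
    show "commutator ?V (?\<phi> (?\<delta> a)) (?\<phi> (?\<iota> b)) = ?\<phi> (?\<iota> \<lbrace>a, b\<rbrace>\<^bsub>P\<^esub>)"
      using eq[OF _ _ mem(6)[OF a b]] by (simp add: \<phi>k EF_closed)
    show "?\<phi> (?\<delta> (a \<otimes>\<^bsub>P\<^esub> b))
        = (?\<phi> (?\<iota> b) \<otimes>\<^bsub>?V\<^esub> ?\<phi> (?\<delta> a)) \<oplus>\<^bsub>?V\<^esub> (?\<phi> (?\<iota> a) \<otimes>\<^bsub>?V\<^esub> ?\<phi> (?\<delta> b))"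
      using eq[OF _ _ mem(7)[OF a b]] by (simp add: \<phi>a \<phi>m V.a_comm \<phi>c)
  next
    fix c a assume a: "a \<in> carrier P"
    note [simp] = a P_closed(4)[OF a]
    show "?\<phi> (?\<iota> (c \<odot>\<^bsub>P\<^esub> a)) = c \<odot>\<^bsub>?V\<^esub> ?\<phi> (?\<iota> a)"
      using eq[OF _ _ mem(2)[OF a a]] by (simp add: \<phi>s)
    have "(c \<odot>\<^bsub>P\<^esub> a) \<oplus>\<^bsub>P\<^esub> (0 \<odot>\<^bsub>P\<^esub> a) = c \<odot>\<^bsub>P\<^esub> a"
      using P.smult_l_null[OF a] by simp
    then show "?\<phi> (?\<delta> (c \<odot>\<^bsub>P\<^esub> a)) = c \<odot>\<^bsub>?V\<^esub> ?\<phi> (?\<delta> a)"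
      using eq[OF _ _ mem(8)[OF a a, of c 0]] by (simp add: \<phi>s \<phi>a \<phi>c V.smult_simps(5))
  next
    show "?\<phi> (?\<iota> \<one>\<^bsub>P\<^esub>) = \<one>\<^bsub>?V\<^esub>"
      using eq[OF _ _ mem(4)[OF P_closed(5) P_closed(5)]] P_closed(5) by (simp add: \<phi>1)
  qed (use V \<phi>c in auto)
qed

lemma env_model_universal:
  "universal_triple TYPE('c) P (env_model P) (\<lambda>a. env_model_gen P (Inl a)) (\<lambda>a. env_model_gen P (Inr a))"
  unfolding universal_triple_def
proof (intro allI impI)
  fix A :: "('k, 'c) module" and \<alpha>' \<beta>'
  assume T: "poisson_triple P A \<alpha>' \<beta>'"
  interpret A: assoc_algebra A using T by (simp add: poisson_triple_def)
  let ?g = "case_sum \<alpha>' \<beta>'"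
  have \<alpha>: "\<alpha>' \<in> alg_hom P A" using T by (simp add: poisson_triple_def)
  have \<beta>c: "\<beta>' a \<in> carrier A" if "a \<in> carrier P" for a
    using T that by (auto simp: poisson_triple_def)
  have \<beta>: "\<beta>' (a \<oplus>\<^bsub>P\<^esub> b) = \<beta>' a \<oplus>\<^bsub>A\<^esub> \<beta>' b" "\<beta>' (c \<odot>\<^bsub>P\<^esub> a) = c \<odot>\<^bsub>A\<^esub> \<beta>' a"
    "\<beta>' \<lbrace>a, b\<rbrace>\<^bsub>P\<^esub> = commutator A (\<beta>' a) (\<beta>' b)" "commutator A (\<beta>' a) (\<alpha>' b) = \<alpha>' \<lbrace>a, b\<rbrace>\<^bsub>P\<^esub>"
    "\<beta>' (a \<otimes>\<^bsub>P\<^esub> b) = (\<alpha>' b \<otimes>\<^bsub>A\<^esub> \<beta>' a) \<oplus>\<^bsub>A\<^esub> (\<alpha>' a \<otimes>\<^bsub>A\<^esub> \<beta>' b)"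
    if "a \<in> carrier P" "b \<in> carrier P" for a b c
    using T that unfolding poisson_triple_def by blast+
  note \<alpha>c = alg_homD(1)[OF \<alpha>]
  have g: "?g \<in> EG \<rightarrow> carrier A" by (auto simp: \<alpha>c \<beta>c)
  define h where "h = A.ev ?g"
  have h: "h \<in> alg_hom EF A" unfolding h_def by (rule A.ev_hom[OF g])
  have hgen: "h (free_gen (Inl a)) = \<alpha>' a" "h (free_gen (Inr a)) = \<beta>' a" if "a \<in> carrier P" for a
    using that A.ev_gen[OF g, of "Inl a"] A.ev_gen[OF g, of "Inr a"] by (auto simp: h_def)
  note hm = alg_homD(2)[OF h] note ha = alg_homD(3)[OF h]
  note h1 = alg_homD(4)[OF h] note hs = alg_homD(5)[OF h]
  note hd = alg_hom_minus[OF F.ring_axioms A.ring_axioms h]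
  have hk: "h (commutator EF p q) = commutator A (h p) (h q)"
    if "p \<in> carrier EF" "q \<in> carrier EF" for p q
    using that by (simp add: commutator_def hd hm)
  have kill: "h (p \<ominus>\<^bsub>EF\<^esub> q) = \<zero>\<^bsub>A\<^esub>" if "p \<in> carrier EF" "q \<in> carrier EF" "h p = h q" for p q
    using that alg_homD(1)[OF h] by (simp add: hd A.r_right_minus_eq)
  have \<beta>1: "\<beta>' \<one>\<^bsub>P\<^esub> = \<zero>\<^bsub>A\<^esub>"
  proof -
    have e: "\<alpha>' \<one>\<^bsub>P\<^esub> = \<one>\<^bsub>A\<^esub>" by (rule alg_homD(4)[OF \<alpha>])
    have "\<beta>' \<one>\<^bsub>P\<^esub> = \<beta>' \<one>\<^bsub>P\<^esub> \<oplus>\<^bsub>A\<^esub> \<beta>' \<one>\<^bsub>P\<^esub>"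
      using \<beta>(5)[OF P_closed(5) P_closed(5)] \<beta>c[OF P_closed(5)] P.one_closed P.l_one[of "\<one>\<^bsub>P\<^esub>"]
      unfolding e by simp
    then show ?thesis using \<beta>c[OF P_closed(5)] by (metis A.add.l_cancel_one)
  qed
  note cl = EF_closed P_closed
  have R0: "h p = \<zero>\<^bsub>A\<^esub>" if "p \<in> delta_P_rels P" for p
    using that unfolding delta_P_rels_def alg_rels_def lin_rels_def Let_def
    apply (elim UnE CollectE exE conjE; simp only: singleton_iff)
           apply (rule kill; simp add: cl hgen ha alg_homD(3)[OF \<alpha>])
          apply (rule kill; simp add: cl hgen hs alg_homD(5)[OF \<alpha>])
         apply (rule kill; simp add: cl hgen hm alg_homD(2)[OF \<alpha>])
        apply (rule kill; simp add: cl hgen h1 alg_homD(4)[OF \<alpha>])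
       apply (rule kill; simp add: cl hgen hk \<beta>(3))
      apply (rule kill; simp add: cl hgen hk \<beta>(4))
     apply (rule kill; simp add: cl hgen hm ha \<beta>(5) \<alpha>c \<beta>c A.a_comm)
    apply (rule kill; simp add: cl hgen hs ha \<beta>(1,2))
    apply (simp add: hgen P_closed \<beta>1)
    done
  obtain f where f: "f \<in> alg_hom (env_model P) A" "\<forall>x\<in>EG. f (env_model_gen P x) = h (free_gen x)"
    using presented_universal[OF delta_P_rels_closed A.assoc_algebra_axioms h R0]
    unfolding env_model_def env_model_gen_def by blast
  show "\<exists>f\<in>alg_hom (env_model P) A.
       (\<forall>a\<in>carrier P. f (env_model_gen P (Inl a)) = \<alpha>' a \<and> f (env_model_gen P (Inr a)) = \<beta>' a) \<and>
       (\<forall>g\<in>alg_hom (env_model P) A.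
          (\<forall>a\<in>carrier P. g (env_model_gen P (Inl a)) = \<alpha>' a \<and> g (env_model_gen P (Inr a)) = \<beta>' a) \<longrightarrow>
          (\<forall>u\<in>carrier (env_model P). g u = f u))"
  proof (intro bexI[OF _ f(1)] conjI ballI impI)
    show fi: "f (env_model_gen P (Inl a)) = \<alpha>' a" "f (env_model_gen P (Inr a)) = \<beta>' a" if "a \<in> carrier P" for a
      using f(2)[rule_format, of "Inl a"] f(2)[rule_format, of "Inr a"] hgen[OF that] that by (simp_all add: InlI InrI)
    fix g u assume g: "g \<in> alg_hom (env_model P) A"
      "\<forall>a\<in>carrier P. g (env_model_gen P (Inl a)) = \<alpha>' a \<and> g (env_model_gen P (Inr a)) = \<beta>' a"
      and u: "u \<in> carrier (env_model P)"
    show "g u = f u"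
    proof (rule presented_unique[OF delta_P_rels_closed A.ring_axioms])
      show "g \<in> alg_hom (presented_alg EG (delta_P_rels P)) A" "f \<in> alg_hom (presented_alg EG (delta_P_rels P)) A"
        "u \<in> carrier (presented_alg EG (delta_P_rels P))"
        using g(1) f(1) u by (simp_all add: env_model_def)
      show "g (presented_gen EG (delta_P_rels P) x) = f (presented_gen EG (delta_P_rels P) x)" if "x \<in> EG" for x
        using that g(2) fi unfolding env_model_gen_def by auto
    qed
  qed
qed

lemma universal_triple_map:
  fixes U :: "('k, 'u) module" and A :: "('k, 'c) module"
  assumes "universal_triple TYPE('c) P U \<alpha> \<beta>" "poisson_triple P A \<alpha>' \<beta>'"
  shows "\<exists>f \<in> alg_hom U A. \<forall>a \<in> carrier P. f (\<alpha> a) = \<alpha>' a \<and> f (\<beta> a) = \<beta>' a"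
  using assms(1)[unfolded universal_triple_def, rule_format, OF assms(2)] by blast

lemma universal_triple_unique:
  fixes U :: "('k, 'u) module" and A :: "('k, 'c) module"
  assumes "universal_triple TYPE('c) P U \<alpha> \<beta>" "poisson_triple P A \<alpha>' \<beta>'"
    and "g \<in> alg_hom U A" "\<forall>a \<in> carrier P. g (\<alpha> a) = \<alpha>' a \<and> g (\<beta> a) = \<beta>' a"
    and "g' \<in> alg_hom U A" "\<forall>a \<in> carrier P. g' (\<alpha> a) = \<alpha>' a \<and> g' (\<beta> a) = \<beta>' a"
    and "u \<in> carrier U"
  shows "g u = g' u"
proof -
  from assms(1)[unfolded universal_triple_def, rule_format, OF assms(2)]
  obtain f where
    f: "\<forall>g\<in>alg_hom U A. (\<forall>a\<in>carrier P. g (\<alpha> a) = \<alpha>' a \<and> g (\<beta> a) = \<beta>' a) \<longrightarrow>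
       (\<forall>u\<in>carrier U. g u = f u)" by (elim bexE conjE)
  have "g u = f u" by (rule f[THEN bspec, OF assms(3), THEN mp, OF assms(4), THEN bspec, OF assms(7)])
  moreover have "g' u = f u" by (rule f[THEN bspec, OF assms(5), THEN mp, OF assms(6), THEN bspec, OF assms(7)])
  ultimately show ?thesis by simp
qed

theorem poisson_enveloping_exists:
  "\<exists>(U :: ('k, (('p + 'p) list \<Rightarrow> 'k) set) module) \<alpha> \<beta>. poisson_enveloping P U \<alpha> \<beta>"
  unfolding poisson_enveloping_def
  by (intro exI conjI, rule env_model_triple, rule env_model_universal, rule env_model_universal)

theorem poisson_enveloping_universal:
  fixes U :: "('k, 'u) module"
  assumes U: "poisson_enveloping P U \<alpha> \<beta>"
  shows "universal_triple TYPE('c) P U \<alpha> \<beta>"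
proof -
  let ?V = "env_model P"
  let ?a = "\<lambda>a. env_model_gen P (Inl a)" and ?b = "\<lambda>a. env_model_gen P (Inr a)"
  have UT: "poisson_triple P U \<alpha> \<beta>" and UU: "universal_triple TYPE('u) P U \<alpha> \<beta>"
    and UV: "universal_triple TYPE((('p + 'p) list \<Rightarrow> 'k) set) P U \<alpha> \<beta>"
    using U by (auto simp: poisson_enveloping_def)
  obtain i where i: "i \<in> alg_hom U ?V" "\<forall>a \<in> carrier P. i (\<alpha> a) = ?a a \<and> i (\<beta> a) = ?b a"
    using universal_triple_map[OF UV env_model_triple] by (elim bexE)
  obtain j where j: "j \<in> alg_hom ?V U" "\<forall>a \<in> carrier P. j (?a a) = \<alpha> a \<and> j (?b a) = \<beta> a"
    using universal_triple_map[OF env_model_universal UT] by (elim bexE)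
  have ji: "j (i u) = u" if u: "u \<in> carrier U" for u
    by (rule universal_triple_unique[OF UU UT, of "\<lambda>u. j (i u)" "\<lambda>u. u", OF alg_hom_comp[OF i(1) j(1)] _ alg_hom_id _ u])
      (use i(2) j(2) in simp_all)
  show ?thesis unfolding universal_triple_def
  proof (intro allI impI)
    fix A :: "('k, 'c) module" and \<alpha>' \<beta>'
    assume T: "poisson_triple P A \<alpha>' \<beta>'"
    obtain h where h: "h \<in> alg_hom ?V A" "\<forall>a \<in> carrier P. h (?a a) = \<alpha>' a \<and> h (?b a) = \<beta>' a"
      using universal_triple_map[OF env_model_universal T] by (elim bexE)
    show "\<exists>f\<in>alg_hom U A.
       (\<forall>a\<in>carrier P. f (\<alpha> a) = \<alpha>' a \<and> f (\<beta> a) = \<beta>' a) \<and>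
       (\<forall>g\<in>alg_hom U A. (\<forall>a\<in>carrier P. g (\<alpha> a) = \<alpha>' a \<and> g (\<beta> a) = \<beta>' a) \<longrightarrow>
          (\<forall>u\<in>carrier U. g u = f u))"
    proof (intro bexI[of _ "\<lambda>u. h (i u)"] conjI ballI impI)
      show "(\<lambda>u. h (i u)) \<in> alg_hom U A" by (rule alg_hom_comp[OF i(1) h(1)])
      show "h (i (\<alpha> a)) = \<alpha>' a" "h (i (\<beta> a)) = \<beta>' a" if "a \<in> carrier P" for a
        using that by (simp_all add: i(2) h(2))
      fix g u assume g: "g \<in> alg_hom U A" "\<forall>a\<in>carrier P. g (\<alpha> a) = \<alpha>' a \<and> g (\<beta> a) = \<beta>' a"
        and u: "u \<in> carrier U"
      have "g (j (i u)) = h (i u)"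
        by (rule universal_triple_unique[OF env_model_universal T, of "\<lambda>v. g (j v)" h,
              OF alg_hom_comp[OF j(1) g(1)] _ h alg_homD(1)[OF i(1) u]])
          (use g(2) j(2) in simp)
      then show "g u = h (i u)" by (simp add: ji u)
    qed
  qed
qed

end

end

theory Submission
  imports Defs
begin

text \<open>
  All the presentations of \<open>U\<close> are obtained in the same way: an algebra \<open>V\<close> given by generators and
  relations carries a Poisson triple, which yields a map \<open>U \<rightarrow> V\<close> by universality; the relations hold in
  \<open>U\<close>, which yields a map \<open>V \<rightarrow> U\<close>; both composites fix generators.  The substantial case is the
  presentation by coordinates \<open>x\<^sub>i\<close>.  There \<open>\<beta>' (q g) = \<Sum> (\<partial>g/\<partial>x\<^sub>i) \<delta>\<^sub>i\<close> defines \<open>\<beta>'\<close>, the relations (c) making it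
  independent of \<open>g\<close>, and every further identity compares two derivations of \<open>S\<^sup>-\<^sup>1K[x\<^sub>i]\<close>, which are equal
  as soon as they agree on the \<open>x\<^sub>i\<close>.

  Universality also gives the representation \<open>\<pi>\<close> on \<open>P\<close>, and evaluation at \<open>1 \<in> P\<close> splits \<open>\<alpha>\<close>.  Since
  \<open>\<alpha> P + \<Sum> U \<delta>\<^sub>i\<close> contains \<open>1\<close> and is stable under left multiplication by \<open>\<alpha> P\<close> and \<open>\<beta> P\<close>, it is all of \<open>U\<close>,
  whence the annihilator of \<open>1\<close> is \<open>\<Sum> U \<delta>\<^sub>i\<close>.
\<close>

section \<open>Subalgebras and Poisson triples\<close>

text \<open>Three obstacles shape the proof. First, \<open>U\<close> is known only by its universal
  property, so the fact that \<alpha> and \<beta> generate it has to be extracted from universality: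
  a triple landing in a subalgebra gives a map into that subalgebra, and uniqueness identifies it
  with the original map. Second, the relations speak of the x_i alone, while S^-1 K[x_i] also
  contains inverses of the elements of S. An induction on the localization covers these; its last
  case passes from h g and h to g for an invertible h, and a derivation along a homomorphism
  \<theta> survives this step because \<theta> h is invertible too. Third, the commutator of
  \<beta>' a and \<beta>' b is not a derivation in either argument: values of \<alpha> and \<beta>'
  do not commute, and cross terms appear. They are the same on both sides of the identity to be
  proved, so uniqueness is shown for product rules whose first summand is arbitrary and whose second
  is \<theta> g times D h.\<close>

context assoc_algebra
begin

text \<open>Negation becomes a scalar multiple, so closure under scalars yields closure under
  negation, and linear maps can be handled without a separate rule for differences.\<close>

lemma smult_neg_one: "x \<in> carrier A \<Longrightarrow> (-1) \<odot> x = \<ominus> x"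
  using smult_simps(1)[of x "-1" 1]
  by (intro minus_equality[symmetric]) (simp_all add: smult_simps(4,5))

lemma subalgebra_ofI:
  assumes "B \<subseteq> carrier A" "\<one> \<in> B"
    and "\<And>x y. \<lbrakk>x \<in> B; y \<in> B\<rbrakk> \<Longrightarrow> x \<oplus> y \<in> B"
    and "\<And>x y. \<lbrakk>x \<in> B; y \<in> B\<rbrakk> \<Longrightarrow> x \<otimes> y \<in> B"
    and "\<And>c x. x \<in> B \<Longrightarrow> c \<odot> x \<in> B"
  shows "subalgebra_of B A"
proof -
  have "\<ominus> x \<in> B" if x: "x \<in> B" for x
    using assms(5)[OF x, of "-1"] smult_neg_one x assms(1) by auto
  then show ?thesis
    unfolding subalgebra_of_def using assms by (auto intro!: subringI)
qed

lemma subalgebra_ofD: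
  assumes "subalgebra_of B A"
  shows "B \<subseteq> carrier A" "\<one> \<in> B" "\<zero> \<in> B"
    and "\<lbrakk>x \<in> B; y \<in> B\<rbrakk> \<Longrightarrow> x \<oplus> y \<in> B"
    and "\<lbrakk>x \<in> B; y \<in> B\<rbrakk> \<Longrightarrow> x \<otimes> y \<in> B"
    and "x \<in> B \<Longrightarrow> c \<odot> x \<in> B"
  using assms subringE[of B A] unfolding subalgebra_of_def by auto

lemma subalgebra_assoc:
  assumes B: "subalgebra_of B A"
  shows "assoc_algebra (A\<lparr>carrier := B\<rparr>)"
proof -
  note D = subalgebra_ofD[OF B]
  have c: "x \<in> carrier A" if "x \<in> B" for x using D(1) that by blast
  interpret B: ring "A\<lparr>carrier := B\<rparr>"
    using B by (auto simp: subalgebra_of_def intro: subring_is_ring)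
  show ?thesis
    by (intro assoc_algebra.intro assoc_algebra_axioms.intro moduleI B.ring_axioms)
      (auto simp: c D(6) B.is_abelian_group cring_from_type_algebra smult_simps smult_mult_left smult_mult_right)
qed

end

lemma alg_hom_restrict:
  "\<lbrakk>h \<in> alg_hom U (A\<lparr>carrier := B\<rparr>); B \<subseteq> carrier A\<rbrakk> \<Longrightarrow> h \<in> alg_hom U A"
  by (auto simp: alg_hom_iff)

text \<open>The form without subtraction is easier to transport: a homomorphism, a quotient or a
  restriction of the carrier then only has to respect sums and products. The rules for Poisson
  triples below are stated this way.\<close>

lemma commutator_eq_iff:
  assumes "ring A" "x \<in> carrier A" "y \<in> carrier A" "z \<in> carrier A"
  shows "commutator A x y = z \<longleftrightarrow> x \<otimes>\<^bsub>A\<^esub> y = z \<oplus>\<^bsub>A\<^esub> (y \<otimes>\<^bsub>A\<^esub> x)"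
proof -
  interpret ring A by fact
  show ?thesis unfolding commutator_def using assms(2-4)
    by (metis add.inv_solve_right m_closed minus_eq)
qed

lemma commutator_closed:
  "\<lbrakk>ring A; x \<in> carrier A; y \<in> carrier A\<rbrakk> \<Longrightarrow> commutator A x y \<in> carrier A"
  by (simp add: commutator_def ring.ring_simprules)

lemma poisson_tripleI:
  fixes P :: "('k::field, 'p, 'm) poisson_scheme"
  assumes "poisson_algebra P" "assoc_algebra A" "\<alpha> \<in> alg_hom P A"
    and "\<And>a. a \<in> carrier P \<Longrightarrow> \<beta> a \<in> carrier A"
    and "\<And>a b. \<lbrakk>a \<in> carrier P; b \<in> carrier P\<rbrakk> \<Longrightarrow> \<beta> (a \<oplus>\<^bsub>P\<^esub> b) = \<beta> a \<oplus>\<^bsub>A\<^esub> \<beta> b"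
    and "\<And>c a. a \<in> carrier P \<Longrightarrow> \<beta> (c \<odot>\<^bsub>P\<^esub> a) = c \<odot>\<^bsub>A\<^esub> \<beta> a"
    and "\<And>a b. \<lbrakk>a \<in> carrier P; b \<in> carrier P\<rbrakk> \<Longrightarrow>
           \<beta> a \<otimes>\<^bsub>A\<^esub> \<beta> b = \<beta> \<lbrace>a, b\<rbrace>\<^bsub>P\<^esub> \<oplus>\<^bsub>A\<^esub> (\<beta> b \<otimes>\<^bsub>A\<^esub> \<beta> a)"
    and "\<And>a b. \<lbrakk>a \<in> carrier P; b \<in> carrier P\<rbrakk> \<Longrightarrow>
           \<beta> a \<otimes>\<^bsub>A\<^esub> \<alpha> b = \<alpha> \<lbrace>a, b\<rbrace>\<^bsub>P\<^esub> \<oplus>\<^bsub>A\<^esub> (\<alpha> b \<otimes>\<^bsub>A\<^esub> \<beta> a)"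
    and "\<And>a b. \<lbrakk>a \<in> carrier P; b \<in> carrier P\<rbrakk> \<Longrightarrow>
           \<beta> (a \<otimes>\<^bsub>P\<^esub> b) = (\<alpha> b \<otimes>\<^bsub>A\<^esub> \<beta> a) \<oplus>\<^bsub>A\<^esub> (\<alpha> a \<otimes>\<^bsub>A\<^esub> \<beta> b)"
  shows "poisson_triple P A \<alpha> \<beta>"
proof -
  interpret P: poisson_algebra P by fact
  interpret A: assoc_algebra A by fact
  show ?thesis
    unfolding poisson_triple_def
  proof (intro conjI ballI allI Pi_I)
    fix a b assume ab: "a \<in> carrier P" "b \<in> carrier P"
    note cl = alg_homD(1)[OF assms(3)] assms(4) P.bracket_closed
    show "\<beta> \<lbrace>a, b\<rbrace>\<^bsub>P\<^esub> = commutator A (\<beta> a) (\<beta> b)"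
      by (rule commutator_eq_iff[THEN iffD2, symmetric]) (use ab in \<open>auto simp: cl A.ring_axioms intro: assms(7)\<close>)
    show "commutator A (\<beta> a) (\<alpha> b) = \<alpha> \<lbrace>a, b\<rbrace>\<^bsub>P\<^esub>"
      by (rule commutator_eq_iff[THEN iffD2]) (simp_all add: ab cl assms(8) A.ring_axioms)
  qed (simp_all add: assms(2-6,9))
qed

lemma poisson_tripleD:
  fixes P :: "('k::field, 'p, 'm) poisson_scheme"
  assumes P: "poisson_algebra P" and T: "poisson_triple P A \<alpha> \<beta>"
  shows "assoc_algebra A" "\<alpha> \<in> alg_hom P A"
    and "a \<in> carrier P \<Longrightarrow> \<alpha> a \<in> carrier A"
    and "a \<in> carrier P \<Longrightarrow> \<beta> a \<in> carrier A"
    and "\<lbrakk>a \<in> carrier P; b \<in> carrier P\<rbrakk> \<Longrightarrow> \<beta> (a \<oplus>\<^bsub>P\<^esub> b) = \<beta> a \<oplus>\<^bsub>A\<^esub> \<beta> b"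
    and "a \<in> carrier P \<Longrightarrow> \<beta> (c \<odot>\<^bsub>P\<^esub> a) = c \<odot>\<^bsub>A\<^esub> \<beta> a"
    and "\<lbrakk>a \<in> carrier P; b \<in> carrier P\<rbrakk> \<Longrightarrow>
           \<beta> a \<otimes>\<^bsub>A\<^esub> \<beta> b = \<beta> \<lbrace>a, b\<rbrace>\<^bsub>P\<^esub> \<oplus>\<^bsub>A\<^esub> (\<beta> b \<otimes>\<^bsub>A\<^esub> \<beta> a)"
    and "\<lbrakk>a \<in> carrier P; b \<in> carrier P\<rbrakk> \<Longrightarrow>
           \<beta> a \<otimes>\<^bsub>A\<^esub> \<alpha> b = \<alpha> \<lbrace>a, b\<rbrace>\<^bsub>P\<^esub> \<oplus>\<^bsub>A\<^esub> (\<alpha> b \<otimes>\<^bsub>A\<^esub> \<beta> a)"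
    and "\<lbrakk>a \<in> carrier P; b \<in> carrier P\<rbrakk> \<Longrightarrow>
           \<beta> (a \<otimes>\<^bsub>P\<^esub> b) = (\<alpha> b \<otimes>\<^bsub>A\<^esub> \<beta> a) \<oplus>\<^bsub>A\<^esub> (\<alpha> a \<otimes>\<^bsub>A\<^esub> \<beta> b)"
proof -
  interpret P: poisson_algebra P by fact
  show "assoc_algebra A" and a: "\<alpha> \<in> alg_hom P A" using T by (auto simp: poisson_triple_def)
  then interpret A: assoc_algebra A by simp
  have \<beta>: "\<And>a. a \<in> carrier P \<Longrightarrow> \<beta> a \<in> carrier A" using T by (auto simp: poisson_triple_def)
  note cl = alg_homD(1)[OF a] \<beta> P.bracket_closed
  have k: "\<beta> \<lbrace>a, b\<rbrace>\<^bsub>P\<^esub> = commutator A (\<beta> a) (\<beta> b)" "commutator A (\<beta> a) (\<alpha> b) = \<alpha> \<lbrace>a, b\<rbrace>\<^bsub>P\<^esub>"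
    if "a \<in> carrier P" "b \<in> carrier P" for a b
    using T that unfolding poisson_triple_def by blast+
  show "\<beta> a \<otimes>\<^bsub>A\<^esub> \<beta> b = \<beta> \<lbrace>a, b\<rbrace>\<^bsub>P\<^esub> \<oplus>\<^bsub>A\<^esub> (\<beta> b \<otimes>\<^bsub>A\<^esub> \<beta> a)"
    if "a \<in> carrier P" "b \<in> carrier P"
    by (rule commutator_eq_iff[THEN iffD1, OF A.ring_axioms _ _ _ k(1)[OF that, symmetric]])
      (simp_all add: that cl)
  show "\<beta> a \<otimes>\<^bsub>A\<^esub> \<alpha> b = \<alpha> \<lbrace>a, b\<rbrace>\<^bsub>P\<^esub> \<oplus>\<^bsub>A\<^esub> (\<alpha> b \<otimes>\<^bsub>A\<^esub> \<beta> a)"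
    if "a \<in> carrier P" "b \<in> carrier P"
    by (rule commutator_eq_iff[THEN iffD1]) (simp_all add: that cl k(2) A.ring_axioms)
qed (use T in \<open>auto simp: poisson_triple_def alg_homD(1)\<close>)

text \<open>Shrinking the carrier leaves all operations unchanged, so every identity is inherited
  and only closure has to be supplied.\<close>

lemma poisson_triple_restrict:
  fixes P :: "('k::field, 'p, 'm) poisson_scheme"
  assumes P: "poisson_algebra P" and T: "poisson_triple P A \<alpha> \<beta>" and B: "subalgebra_of B A"
    and "\<alpha> ` carrier P \<subseteq> B" "\<beta> ` carrier P \<subseteq> B"
  shows "poisson_triple P (A\<lparr>carrier := B\<rparr>) \<alpha> \<beta>"
proof -
  note D = poisson_tripleD[OF P T]
  show ?thesis
    by (rule poisson_tripleI[OF P assoc_algebra.subalgebra_assoc[OF D(1) B]])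
      (use assms(4,5) D(2-6,9) in \<open>auto simp: alg_hom_iff image_subset_iff intro: D(7,8)\<close>)
qed

lemma poisson_triple_hom:
  fixes P :: "('k::field, 'p, 'm) poisson_scheme"
  assumes P: "poisson_algebra P" and T: "poisson_triple P A \<alpha> \<beta>" and B: "assoc_algebra B"
    and f: "f \<in> alg_hom A B"
  shows "poisson_triple P B (\<lambda>a. f (\<alpha> a)) (\<lambda>a. f (\<beta> a))"
proof -
  note D = poisson_tripleD[OF P T]
  interpret A: assoc_algebra A by (rule D)
  interpret P: poisson_algebra P by (rule P)
  show ?thesis
    by (rule poisson_tripleI[OF P B alg_hom_comp[OF D(2) f]])
      (simp_all add: D(3-6,9) alg_homD[OF f],
       simp_all add: D(3,4,8) D(7)[symmetric] P.bracket_closed flip: alg_homD(2,3)[OF f])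
qed

lemma alg_isoI:
  assumes "f \<in> alg_hom A B" "g \<in> alg_hom B A"
    and "\<And>x. x \<in> carrier A \<Longrightarrow> g (f x) = x" "\<And>y. y \<in> carrier B \<Longrightarrow> f (g y) = y"
  shows "f \<in> alg_iso A B"
proof -
  have "bij_betw f (carrier A) (carrier B)"
    by (rule bij_betwI[of f _ _ g]) (use assms in \<open>auto simp: alg_homD(1)\<close>)
  then show ?thesis using assms(1) by (simp add: alg_iso_def)
qed

section \<open>Consequences of the universal property\<close>

locale enveloping = poisson_algebra P
  for P :: "('k::field, 'p) poisson" (structure) +
  fixes U :: "('k, 'u) module" and \<alpha> \<beta> :: "'p \<Rightarrow> 'u"
  assumes enveloping: "poisson_enveloping P U \<alpha> \<beta>"
begin

lemma triple: "poisson_triple P U \<alpha> \<beta>"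
  using enveloping by (simp add: poisson_enveloping_def)

lemmas U_triple = poisson_tripleD[OF poisson_algebra_axioms triple]

sublocale U: assoc_algebra U by (rule U_triple(1))

lemmas \<alpha>_hom = alg_homD[OF U_triple(2)]

text \<open>The definition tests universality on two carrier types only;
  \<open>poisson_enveloping_universal\<close> extends it to the type of any test algebra, which
  matters because the presented algebras below all live on different types.\<close>

lemma ex_hom:
  fixes A :: "('k, 'c) module"
  assumes "poisson_triple P A \<alpha>' \<beta>'"
  obtains f where "f \<in> alg_hom U A"
    "\<And>a. a \<in> carrier P \<Longrightarrow> f (\<alpha> a) = \<alpha>' a" "\<And>a. a \<in> carrier P \<Longrightarrow> f (\<beta> a) = \<beta>' a"
  using universal_triple_map[OF poisson_algebra_axioms poisson_enveloping_universal[OF poisson_algebra_axioms enveloping] assms]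
  by blast

text \<open>No triple on \<open>A\<close> is given in advance: \<open>g\<close> pushes the triple of
  \<open>U\<close> forward to \<open>A\<close>, and both maps then solve the same universal
  problem.\<close>

lemma hom_unique:
  fixes A :: "('k, 'c) module"
  assumes A: "assoc_algebra A" and f: "f \<in> alg_hom U A" and g: "g \<in> alg_hom U A"
    and "\<And>a. a \<in> carrier P \<Longrightarrow> f (\<alpha> a) = g (\<alpha> a)" "\<And>a. a \<in> carrier P \<Longrightarrow> f (\<beta> a) = g (\<beta> a)"
    and u: "u \<in> carrier U"
  shows "f u = g u"
  by (rule universal_triple_unique[OF poisson_algebra_axioms poisson_enveloping_universal[OF poisson_algebra_axioms enveloping]
        poisson_triple_hom[OF poisson_algebra_axioms triple A g] f _ g _ u])
    (use assms in auto)

text \<open>Replaces an appeal to generators. The pushed-forward triple restricts to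
  \<open>B\<close>, universality gives a map into \<open>B\<close>, and by uniqueness in
  \<open>A\<close> this map is \<open>f\<close>.\<close>

lemma hom_image_subset:
  fixes A :: "('k, 'c) module"
  assumes A: "assoc_algebra A" and f: "f \<in> alg_hom U A" and B: "subalgebra_of B A"
    and \<alpha>: "\<And>a. a \<in> carrier P \<Longrightarrow> f (\<alpha> a) \<in> B" and \<beta>: "\<And>a. a \<in> carrier P \<Longrightarrow> f (\<beta> a) \<in> B"
  shows "f ` carrier U \<subseteq> B"
proof -
  have "poisson_triple P (A\<lparr>carrier := B\<rparr>) (\<lambda>a. f (\<alpha> a)) (\<lambda>a. f (\<beta> a))"
    by (rule poisson_triple_restrict[OF poisson_algebra_axioms
          poisson_triple_hom[OF poisson_algebra_axioms triple A f] B]) (use \<alpha> \<beta> in auto)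
  then obtain g where g: "g \<in> alg_hom U (A\<lparr>carrier := B\<rparr>)"
    "\<And>a. a \<in> carrier P \<Longrightarrow> g (\<alpha> a) = f (\<alpha> a)" "\<And>a. a \<in> carrier P \<Longrightarrow> g (\<beta> a) = f (\<beta> a)"
    by (rule ex_hom) blast
  have "g \<in> alg_hom U A"
    by (rule alg_hom_restrict[OF g(1)]) (rule assoc_algebra.subalgebra_ofD(1)[OF A B])
  then have "f u = g u" if "u \<in> carrier U" for u
    using hom_unique[OF A f _ _ _ that] g(2,3) by simp
  then show ?thesis using alg_homD(1)[OF g(1)] by auto
qed

text \<open>\<open>U\<close> is generated by the two images: \<open>hom_image_subset\<close> applied
  to the identity.\<close>

lemma subalgebra_eq_carrier:
  assumes "subalgebra_of B U" "\<alpha> ` carrier P \<subseteq> B" "\<beta> ` carrier P \<subseteq> B"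
  shows "B = carrier U"
  using hom_image_subset[OF U.assoc_algebra_axioms alg_hom_id assms(1)] assms(2,3)
    U.subalgebra_ofD(1)[OF assms(1)] by auto

text \<open>The elements multiplying \<open>W\<close> into itself form a subalgebra.\<close>
lemma carrier_subset_if_stable:
  assumes W: "W \<subseteq> carrier U" "\<one>\<^bsub>U\<^esub> \<in> W"
    and add: "\<And>x y. \<lbrakk>x \<in> W; y \<in> W\<rbrakk> \<Longrightarrow> x \<oplus>\<^bsub>U\<^esub> y \<in> W"
    and \<alpha>: "\<And>a w. \<lbrakk>a \<in> carrier P; w \<in> W\<rbrakk> \<Longrightarrow> \<alpha> a \<otimes>\<^bsub>U\<^esub> w \<in> W"
    and \<beta>: "\<And>a w. \<lbrakk>a \<in> carrier P; w \<in> W\<rbrakk> \<Longrightarrow> \<beta> a \<otimes>\<^bsub>U\<^esub> w \<in> W"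
  shows "carrier U \<subseteq> W"
proof -
  let ?B = "{u \<in> carrier U. \<forall>w \<in> W. u \<otimes>\<^bsub>U\<^esub> w \<in> W}"
  have Wc: "w \<in> carrier U" if "w \<in> W" for w using that W(1) by blast
  \<comment> \<open>Stability under scalars comes from stability under \<alpha>, since c acts as
    left multiplication by \<alpha> of c times the unit.\<close>
  have sm: "c \<odot>\<^bsub>U\<^esub> w \<in> W" if "w \<in> W" for c w
  proof -
    have "\<alpha> (c \<odot> \<one>) \<otimes>\<^bsub>U\<^esub> w = c \<odot>\<^bsub>U\<^esub> w"
      using Wc[OF that] by (simp add: \<alpha>_hom(4,5) U.smult_mult_left)
    then show ?thesis using \<alpha>[OF smult_closed that, of c \<one>] by simp
  qed
  have "subalgebra_of ?B U"
    by (rule U.subalgebra_ofI)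
      (auto simp: Wc U.l_distr U.m_assoc U.smult_mult_left add sm)
  then have "?B = carrier U"
    by (rule subalgebra_eq_carrier) (auto simp: U_triple(3,4) \<alpha> \<beta>)
  then have "u \<otimes>\<^bsub>U\<^esub> \<one>\<^bsub>U\<^esub> \<in> W" if "u \<in> carrier U" for u using that W(2) by blast
  then show ?thesis by auto
qed

end

section \<open>Differential operators\<close>

lemma (in ring) commutator_add_left:
  "\<lbrakk>x \<in> carrier R; y \<in> carrier R; z \<in> carrier R\<rbrakk> \<Longrightarrow>
   commutator R (x \<oplus> y) z = commutator R x z \<oplus> commutator R y z"
  by (simp add: commutator_def l_distr r_distr minus_eq minus_add a_ac)

lemma (in ring) commutator_mult_left:
  assumes "x \<in> carrier R" "y \<in> carrier R" "z \<in> carrier R"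
  shows "commutator R (x \<otimes> y) z = (x \<otimes> commutator R y z) \<oplus> (commutator R x z \<otimes> y)"
proof -
  \<comment> \<open>The four-term expansion contains x z y with both signs; this is their
    cancellation, in the bracketing that the simplifier reaches.\<close>
  have "\<ominus> (x \<otimes> (z \<otimes> y)) \<oplus> ((x \<otimes> (z \<otimes> y)) \<oplus> (\<ominus> (z \<otimes> (x \<otimes> y)))) = \<ominus> (z \<otimes> (x \<otimes> y))"
    using assms by (simp add: r_neg1)
  then show ?thesis using assms
    by (simp add: commutator_def l_distr r_distr minus_eq m_assoc l_minus r_minus a_assoc)
qed

lemma (in assoc_algebra) commutator_smult_left:
  assumes "x \<in> carrier A" "y \<in> carrier A"
  shows "commutator A (c \<odot> x) y = c \<odot> commutator A x y"
proof -
  have "c \<odot> (x \<otimes> y) = c \<odot> (commutator A x y \<oplus> (y \<otimes> x))"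
    using commutator_eq_iff[OF ring_axioms assms commutator_closed[OF ring_axioms assms]] by simp
  then have "(c \<odot> x) \<otimes> y = c \<odot> commutator A x y \<oplus> y \<otimes> (c \<odot> x)"
    using assms by (simp add: smult_mult_left smult_mult_right smult_simps(2) commutator_closed ring_axioms)
  then show ?thesis
    using assms by (subst commutator_eq_iff) (auto simp: commutator_closed ring_axioms)
qed

lemma End_alg_simps:
  "monoid.mult (End_alg M) = compose (carrier M)"
  "monoid.one (End_alg M) = (\<lambda>x \<in> carrier M. x)"
  "ring.zero (End_alg M) = (\<lambda>x \<in> carrier M. \<zero>\<^bsub>M\<^esub>)"
  "ring.add (End_alg M) = (\<lambda>g h. \<lambda>x \<in> carrier M. g x \<oplus>\<^bsub>M\<^esub> h x)"
  "module.smult (End_alg M) = (\<lambda>c h. \<lambda>x \<in> carrier M. c \<odot>\<^bsub>M\<^esub> h x)"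
  by (simp_all add: End_alg_def)

lemma End_algI:
  assumes "h \<in> extensional (carrier M)" "\<And>x. x \<in> carrier M \<Longrightarrow> h x \<in> carrier M"
    and "\<And>x y. \<lbrakk>x \<in> carrier M; y \<in> carrier M\<rbrakk> \<Longrightarrow> h (x \<oplus>\<^bsub>M\<^esub> y) = h x \<oplus>\<^bsub>M\<^esub> h y"
    and "\<And>c x. x \<in> carrier M \<Longrightarrow> h (c \<odot>\<^bsub>M\<^esub> x) = c \<odot>\<^bsub>M\<^esub> h x"
  shows "h \<in> carrier (End_alg M)"
  using assms by (auto simp: End_alg_def PiE_def)

lemma End_algD:
  assumes "h \<in> carrier (End_alg M)"
  shows "h \<in> extensional (carrier M)"
    and "x \<in> carrier M \<Longrightarrow> h x \<in> carrier M"
    and "\<lbrakk>x \<in> carrier M; y \<in> carrier M\<rbrakk> \<Longrightarrow> h (x \<oplus>\<^bsub>M\<^esub> y) = h x \<oplus>\<^bsub>M\<^esub> h y"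
    and "x \<in> carrier M \<Longrightarrow> h (c \<odot>\<^bsub>M\<^esub> x) = c \<odot>\<^bsub>M\<^esub> h x"
  using assms by (auto simp: End_alg_def PiE_def Pi_iff)

lemma End_alg_eqI:
  assumes "h \<in> carrier (End_alg M)" "k \<in> carrier (End_alg M)"
    and "\<And>x. x \<in> carrier M \<Longrightarrow> h x = k x"
  shows "h = k"
  by (rule extensionalityI[OF End_algD(1)[OF assms(1)] End_algD(1)[OF assms(2)] assms(3)])

section \<open>The endomorphism algebra of \<open>P\<close> and its Poisson triple\<close>

context poisson_algebra
begin

lemma smult_carrier [simp]: "x \<in> carrier P \<Longrightarrow> c \<odot> x \<in> carrier P"
  using smult_closed by simp

lemma K_smult:
  "x \<in> carrier P \<Longrightarrow> (c + d) \<odot> x = (c \<odot> x) \<oplus>\<^bsub>P\<^esub> (d \<odot> x)"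
  "\<lbrakk>x \<in> carrier P; y \<in> carrier P\<rbrakk> \<Longrightarrow> c \<odot> (x \<oplus>\<^bsub>P\<^esub> y) = (c \<odot> x) \<oplus>\<^bsub>P\<^esub> (c \<odot> y)"
  "x \<in> carrier P \<Longrightarrow> (c * d) \<odot> x = c \<odot> (d \<odot> x)"
  "x \<in> carrier P \<Longrightarrow> 1 \<odot> x = x"
  "\<lbrakk>x \<in> carrier P; y \<in> carrier P\<rbrakk> \<Longrightarrow> (c \<odot> x) \<otimes>\<^bsub>P\<^esub> y = c \<odot> (x \<otimes>\<^bsub>P\<^esub> y)"
  "\<lbrakk>x \<in> carrier P; y \<in> carrier P\<rbrakk> \<Longrightarrow> x \<otimes>\<^bsub>P\<^esub> (c \<odot> y) = c \<odot> (x \<otimes>\<^bsub>P\<^esub> y)"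
  using smult_l_distr[of c d x] smult_r_distr[of c x y] smult_assoc1[of c d x] smult_one[of x]
    smult_assoc2[of c x y] smult_assoc2[of c y x] by (simp_all add: m_comm)

lemma assoc_algebra_P: "assoc_algebra P"
  by (intro assoc_algebra.intro assoc_algebra_axioms.intro module ring_axioms) (simp_all add: K_smult)

abbreviation "E \<equiv> End_alg P"

lemma End_closed:
  "\<lbrakk>h \<in> carrier E; k \<in> carrier E\<rbrakk> \<Longrightarrow> h \<otimes>\<^bsub>E\<^esub> k \<in> carrier E"
  "\<lbrakk>h \<in> carrier E; k \<in> carrier E\<rbrakk> \<Longrightarrow> h \<oplus>\<^bsub>E\<^esub> k \<in> carrier E"
  "h \<in> carrier E \<Longrightarrow> c \<odot>\<^bsub>E\<^esub> h \<in> carrier E"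
  "\<one>\<^bsub>E\<^esub> \<in> carrier E" "\<zero>\<^bsub>E\<^esub> \<in> carrier E"
proof -
  interpret A: assoc_algebra P by (rule assoc_algebra_P)
  show "\<lbrakk>h \<in> carrier E; k \<in> carrier E\<rbrakk> \<Longrightarrow> h \<otimes>\<^bsub>E\<^esub> k \<in> carrier E"
    "\<lbrakk>h \<in> carrier E; k \<in> carrier E\<rbrakk> \<Longrightarrow> h \<oplus>\<^bsub>E\<^esub> k \<in> carrier E"
    "h \<in> carrier E \<Longrightarrow> c \<odot>\<^bsub>E\<^esub> h \<in> carrier E"
    "\<one>\<^bsub>E\<^esub> \<in> carrier E" "\<zero>\<^bsub>E\<^esub> \<in> carrier E"
    by (rule End_algI; simp add: End_alg_simps compose_eq End_algD(2-4) K_smult A.smult_simps(6) A.smult_commute M.a_ac;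
        simp add: compose_def)+
qed

lemma End_assoc_algebra: "assoc_algebra E"
proof -
  have "ring E"
  proof (rule ringI)
    show "abelian_group E"
    proof (rule abelian_groupI)
      fix h assume h: "h \<in> carrier E"
      have "(-1) \<odot>\<^bsub>E\<^esub> h \<oplus>\<^bsub>E\<^esub> h = \<zero>\<^bsub>E\<^esub>"
      proof (rule End_alg_eqI)
        fix x assume x: "x \<in> carrier P"
        then have "(-1) \<odot> h x \<oplus>\<^bsub>P\<^esub> h x = \<zero>\<^bsub>P\<^esub>"
          using K_smult(1)[of "h x" "-1" 1] End_algD(2)[OF h] smult_l_null[of "h x"] by (simp add: K_smult(4))
        then show "((-1) \<odot>\<^bsub>E\<^esub> h \<oplus>\<^bsub>E\<^esub> h) x = \<zero>\<^bsub>E\<^esub> x" using x by (simp add: End_alg_simps)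
      qed (simp_all add: h End_closed)
      then show "\<exists>k\<in>carrier E. k \<oplus>\<^bsub>E\<^esub> h = \<zero>\<^bsub>E\<^esub>" using End_closed(3)[OF h] by blast
    qed (auto intro!: End_alg_eqI[of _ P] simp: End_closed, auto simp: End_alg_simps End_algD(2) M.a_ac)
    show "monoid E"
      by (rule monoidI)
        (auto intro!: End_alg_eqI[of _ P] simp: End_closed, auto simp: End_alg_simps End_algD(2) compose_eq)
  qed (auto intro!: End_alg_eqI[of _ P] simp: End_closed, auto simp: End_alg_simps End_algD(2,3) compose_eq)
  then interpret E: ring E .
  have "module KR E"
    by (rule moduleI)
      (auto intro!: End_alg_eqI[of _ P] simp: End_closed E.is_abelian_group cring_from_type_algebra,
        auto simp: End_alg_simps End_algD(2) K_smult)
  then show ?thesis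
    by (intro assoc_algebra.intro assoc_algebra_axioms.intro E.ring_axioms)
      (auto intro!: End_alg_eqI[of _ P] simp: End_closed, auto simp: End_alg_simps End_algD(2,4) compose_eq)
qed

sublocale E: assoc_algebra E by (rule End_assoc_algebra)

lemma mult_op_closed: "a \<in> carrier P \<Longrightarrow> mult_op P a \<in> carrier E"
  by (rule End_algI) (auto simp: mult_op_def r_distr K_smult)

lemma pad_closed: "a \<in> carrier P \<Longrightarrow> pad P a \<in> carrier E"
  by (rule End_algI) (auto simp: pad_def bracket_closed bracket_add_right bracket_smult_right)

text \<open>Polarization of the alternating law at a + b, valid in every characteristic.\<close>

lemma bracket_antisym:
  assumes "a \<in> carrier P" "b \<in> carrier P"
  shows "\<lbrace>b, a\<rbrace> = \<ominus>\<^bsub>P\<^esub> \<lbrace>a, b\<rbrace>"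
proof -
  have "\<lbrace>a \<oplus>\<^bsub>P\<^esub> b, a \<oplus>\<^bsub>P\<^esub> b\<rbrace> = \<lbrace>a, b\<rbrace> \<oplus>\<^bsub>P\<^esub> \<lbrace>b, a\<rbrace>"
    using assms by (simp add: bracket_add_left bracket_add_right bracket_self[of a] bracket_self[of b] bracket_closed M.a_comm)
  then show ?thesis using assms
    by (metis M.a_closed M.a_comm M.minus_equality bracket_closed bracket_self)
qed

lemma bracket_one:
  "a \<in> carrier P \<Longrightarrow> \<lbrace>a, \<one>\<^bsub>P\<^esub>\<rbrace> = \<zero>\<^bsub>P\<^esub>"
  "a \<in> carrier P \<Longrightarrow> \<lbrace>\<one>\<^bsub>P\<^esub>, a\<rbrace> = \<zero>\<^bsub>P\<^esub>"
proof -
  assume a: "a \<in> carrier P"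
  have "\<lbrace>a, \<one>\<^bsub>P\<^esub>\<rbrace> = \<lbrace>a, \<one>\<^bsub>P\<^esub>\<rbrace> \<oplus>\<^bsub>P\<^esub> \<lbrace>a, \<one>\<^bsub>P\<^esub>\<rbrace>"
    using leibniz[of a "\<one>\<^bsub>P\<^esub>" "\<one>\<^bsub>P\<^esub>"] a by (simp add: bracket_closed)
  then show 1: "\<lbrace>a, \<one>\<^bsub>P\<^esub>\<rbrace> = \<zero>\<^bsub>P\<^esub>" using a by (metis M.add.l_cancel_one bracket_closed one_closed)
  show "\<lbrace>\<one>\<^bsub>P\<^esub>, a\<rbrace> = \<zero>\<^bsub>P\<^esub>" using bracket_antisym[OF a one_closed] by (simp add: 1)
qed

lemma leibniz_left:
  assumes "a \<in> carrier P" "b \<in> carrier P" "c \<in> carrier P"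
  shows "\<lbrace>a \<otimes>\<^bsub>P\<^esub> b, c\<rbrace> = (a \<otimes>\<^bsub>P\<^esub> \<lbrace>b, c\<rbrace>) \<oplus>\<^bsub>P\<^esub> (b \<otimes>\<^bsub>P\<^esub> \<lbrace>a, c\<rbrace>)"
proof -
  have "\<lbrace>a \<otimes>\<^bsub>P\<^esub> b, c\<rbrace> = \<ominus>\<^bsub>P\<^esub> ((\<lbrace>c, a\<rbrace> \<otimes>\<^bsub>P\<^esub> b) \<oplus>\<^bsub>P\<^esub> (a \<otimes>\<^bsub>P\<^esub> \<lbrace>c, b\<rbrace>))"
    using assms by (simp add: bracket_antisym[of c "a \<otimes>\<^bsub>P\<^esub> b"] leibniz)
  also have "\<dots> = (a \<otimes>\<^bsub>P\<^esub> (\<ominus>\<^bsub>P\<^esub> \<lbrace>c, b\<rbrace>)) \<oplus>\<^bsub>P\<^esub> (b \<otimes>\<^bsub>P\<^esub> (\<ominus>\<^bsub>P\<^esub> \<lbrace>c, a\<rbrace>))"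
    using assms by (simp add: bracket_closed M.minus_add r_minus m_comm[of _ b] M.a_comm)
  finally show ?thesis
    using assms by (simp add: bracket_antisym[of c a] bracket_antisym[of c b])
qed

text \<open>The Jacobi identity rearranged to say that \<open>pad\<close> is a Lie
  homomorphism.\<close>

lemma jacobi_pad:
  assumes "a \<in> carrier P" "b \<in> carrier P" "x \<in> carrier P"
  shows "\<lbrace>a, \<lbrace>b, x\<rbrace>\<rbrace> = \<lbrace>\<lbrace>a, b\<rbrace>, x\<rbrace> \<oplus>\<^bsub>P\<^esub> \<lbrace>b, \<lbrace>a, x\<rbrace>\<rbrace>"
proof -
  note cl = assms bracket_closed
  have neg: "\<lbrace>b, \<ominus>\<^bsub>P\<^esub> y\<rbrace> = \<ominus>\<^bsub>P\<^esub> \<lbrace>b, y\<rbrace>" if y: "y \<in> carrier P" for y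
  proof -
    have "\<lbrace>b, \<zero>\<^bsub>P\<^esub>\<rbrace> = \<zero>\<^bsub>P\<^esub>"
      using bracket_add_right[OF M.zero_closed M.zero_closed cl(2)] cl by simp
    then have "\<lbrace>b, \<ominus>\<^bsub>P\<^esub> y\<rbrace> \<oplus>\<^bsub>P\<^esub> \<lbrace>b, y\<rbrace> = \<zero>\<^bsub>P\<^esub>"
      using bracket_add_right[of "\<ominus>\<^bsub>P\<^esub> y" y b] y cl by (simp add: M.l_neg)
    then show ?thesis using y cl by (simp add: M.minus_equality)
  qed
  have "\<lbrace>a, \<lbrace>b, x\<rbrace>\<rbrace> \<oplus>\<^bsub>P\<^esub> (\<ominus>\<^bsub>P\<^esub> \<lbrace>b, \<lbrace>a, x\<rbrace>\<rbrace>) \<oplus>\<^bsub>P\<^esub> (\<ominus>\<^bsub>P\<^esub> \<lbrace>\<lbrace>a, b\<rbrace>, x\<rbrace>) = \<zero>\<^bsub>P\<^esub>"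
    using jacobi[OF assms] bracket_antisym[of a x] bracket_antisym[of "\<lbrace>a, b\<rbrace>" x] cl by (simp add: neg)
  then have "\<lbrace>a, \<lbrace>b, x\<rbrace>\<rbrace> \<oplus>\<^bsub>P\<^esub> (\<ominus>\<^bsub>P\<^esub> (\<lbrace>\<lbrace>a, b\<rbrace>, x\<rbrace> \<oplus>\<^bsub>P\<^esub> \<lbrace>b, \<lbrace>a, x\<rbrace>\<rbrace>)) = \<zero>\<^bsub>P\<^esub>"
    using cl by (simp add: M.minus_add M.a_ac)
  then show ?thesis using cl by (simp add: r_right_minus_eq flip: M.minus_eq)
qed

text \<open>Each law of a Poisson algebra supplies one law of the triple: Jacobi the Lie condition,
  the Leibniz rule in the second argument the commutator with multiplications, and the Leibniz rule
  in the first argument the product rule for \<open>pad\<close>.\<close>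

lemma End_triple: "poisson_triple P E (mult_op P) (pad P)"
proof (rule poisson_tripleI[OF poisson_algebra_axioms End_assoc_algebra])
  show "mult_op P \<in> alg_hom P E"
    unfolding alg_hom_iff
    by (auto intro!: End_alg_eqI[of _ P] simp: mult_op_closed End_closed,
        auto simp: End_alg_simps mult_op_def compose_eq m_assoc l_distr K_smult)
next
  fix a b assume ab: "a \<in> carrier P" "b \<in> carrier P"
  show "pad P a \<otimes>\<^bsub>E\<^esub> pad P b = pad P \<lbrace>a, b\<rbrace> \<oplus>\<^bsub>E\<^esub> (pad P b \<otimes>\<^bsub>E\<^esub> pad P a)"
    by (rule End_alg_eqI[of _ P])
      (simp_all add: ab pad_closed End_closed bracket_closed,
       simp add: ab End_alg_simps pad_def compose_eq bracket_closed jacobi_pad[of a b])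
qed (auto intro!: End_alg_eqI[of _ P] simp: pad_closed mult_op_closed End_closed bracket_closed,
      auto simp: End_alg_simps mult_op_def pad_def compose_eq bracket_closed bracket_add_left bracket_smult_left
        leibniz leibniz_left M.a_comm)

section \<open>The order filtration on differential operators\<close>

lemma diff_ops_closed: "h \<in> diff_ops_of_order P n \<Longrightarrow> h \<in> carrier E"
  by (cases n) auto

lemma zero_diff_ops: "\<zero>\<^bsub>E\<^esub> \<in> diff_ops_of_order P n"
proof -
  have "commutator E \<zero>\<^bsub>E\<^esub> (mult_op P a) = \<zero>\<^bsub>E\<^esub>" if "a \<in> carrier P" for a
    using that by (simp add: commutator_def mult_op_closed E.minus_eq)
  then show ?thesis by (induction n) auto
qed

lemma diff_ops_mono: "m \<le> n \<Longrightarrow> diff_ops_of_order P m \<subseteq> diff_ops_of_order P n"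
proof (rule lift_Suc_mono_le)
  show "diff_ops_of_order P n \<subseteq> diff_ops_of_order P (Suc n)" for n
    using zero_diff_ops[of 0] by (induction n) auto
qed

lemma diff_ops_add:
  "\<lbrakk>h \<in> diff_ops_of_order P n; k \<in> diff_ops_of_order P n\<rbrakk> \<Longrightarrow> h \<oplus>\<^bsub>E\<^esub> k \<in> diff_ops_of_order P n"
  by (induction n arbitrary: h k) (auto simp: E.commutator_add_left mult_op_closed)

lemma diff_ops_smult:
  "h \<in> diff_ops_of_order P n \<Longrightarrow> c \<odot>\<^bsub>E\<^esub> h \<in> diff_ops_of_order P n"
  by (induction n arbitrary: h) (auto simp: E.commutator_smult_left mult_op_closed E.smult_simps(6))

text \<open>Taking the commutator with a multiplication is a derivation, so it splits the product
  into two summands, each with one order lowered by one. A factor of order 0 has zero commutator,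
  which makes its summand vanish. Hence the induction on the total order.\<close>

lemma diff_ops_mult:
  "\<lbrakk>h \<in> diff_ops_of_order P m; k \<in> diff_ops_of_order P n\<rbrakk> \<Longrightarrow> h \<otimes>\<^bsub>E\<^esub> k \<in> diff_ops_of_order P (m + n)"
proof (induction "m + n" arbitrary: m n h k rule: less_induct)
  case less
  note hk = diff_ops_closed[OF less.prems(1)] diff_ops_closed[OF less.prems(2)]
  have c: "commutator E (h \<otimes>\<^bsub>E\<^esub> k) (mult_op P a)
      = (h \<otimes>\<^bsub>E\<^esub> commutator E k (mult_op P a)) \<oplus>\<^bsub>E\<^esub> (commutator E h (mult_op P a) \<otimes>\<^bsub>E\<^esub> k)"
    if "a \<in> carrier P" for a
    using hk that by (simp add: E.commutator_mult_left mult_op_closed)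
  have l: "h \<otimes>\<^bsub>E\<^esub> commutator E k (mult_op P a) \<in> diff_ops_of_order P (m + n')"
    if "a \<in> carrier P" "n = Suc n'" for a n'
    using less that by auto
  have l0: "h \<otimes>\<^bsub>E\<^esub> commutator E k (mult_op P a) = \<zero>\<^bsub>E\<^esub>" if "a \<in> carrier P" "n = 0" for a
    using less.prems that hk by auto
  have r: "commutator E h (mult_op P a) \<otimes>\<^bsub>E\<^esub> k \<in> diff_ops_of_order P (m' + n)"
    if "a \<in> carrier P" "m = Suc m'" for a m'
    using less that by auto
  have r0: "commutator E h (mult_op P a) \<otimes>\<^bsub>E\<^esub> k = \<zero>\<^bsub>E\<^esub>" if "a \<in> carrier P" "m = 0" for a
    using less.prems that hk by auto
  show ?case
  proof (cases "m + n")
    case 0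
    then show ?thesis using hk by (simp add: c l0 r0)
  next
    case (Suc N)
    have "h \<otimes>\<^bsub>E\<^esub> commutator E k (mult_op P a) \<in> diff_ops_of_order P N" if "a \<in> carrier P" for a
      using that l[OF that] l0[OF that] Suc zero_diff_ops[of N] by (cases n) auto
    moreover have "commutator E h (mult_op P a) \<otimes>\<^bsub>E\<^esub> k \<in> diff_ops_of_order P N" if "a \<in> carrier P" for a
      using that r[OF that] r0[OF that] Suc zero_diff_ops[of N] by (cases m) auto
    ultimately show ?thesis using hk Suc by (simp add: c diff_ops_add)
  qed
qed

lemma mult_op_diff_op: "a \<in> carrier P \<Longrightarrow> mult_op P a \<in> diff_ops_of_order P 0"
proof -
  assume a: "a \<in> carrier P"
  have "commutator E (mult_op P a) (mult_op P b) = \<zero>\<^bsub>E\<^esub>" if b: "b \<in> carrier P" for b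
  proof -
    have "mult_op P a \<otimes>\<^bsub>E\<^esub> mult_op P b = mult_op P b \<otimes>\<^bsub>E\<^esub> mult_op P a"
      by (rule End_alg_eqI[of _ P])
        (simp_all add: a b mult_op_closed End_closed, simp add: a b End_alg_simps mult_op_def compose_eq m_ac)
    then show ?thesis using a b
      by (simp add: commutator_eq_iff E.ring_axioms mult_op_closed)
  qed
  then show ?thesis using a by (simp add: mult_op_closed)
qed

text \<open>By the Leibniz rule the commutator with a multiplication is again a multiplication,
  hence of order 0; this is one of the laws in \<open>End_triple\<close>.\<close>

lemma pad_diff_op:
  assumes "b \<in> carrier P"
  shows "pad P b \<in> diff_ops_of_order P 1"
  using End_triple assms mult_op_diff_op
  by (auto simp: poisson_triple_def pad_closed bracket_closed)

lemma diff_ops_subalgebra: "subalgebra_of (\<Union>n. diff_ops_of_order P n) E"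
proof (rule E.subalgebra_ofI)
  fix h k assume "h \<in> (\<Union>n. diff_ops_of_order P n)" "k \<in> (\<Union>n. diff_ops_of_order P n)"
  then obtain m n where hk: "h \<in> diff_ops_of_order P m" "k \<in> diff_ops_of_order P n" by blast
  then have "h \<in> diff_ops_of_order P (m + n)" "k \<in> diff_ops_of_order P (m + n)"
    using diff_ops_mono[of m "m + n"] diff_ops_mono[of n "m + n"] by auto
  then show "h \<oplus>\<^bsub>E\<^esub> k \<in> (\<Union>n. diff_ops_of_order P n)" using diff_ops_add by blast
  show "h \<otimes>\<^bsub>E\<^esub> k \<in> (\<Union>n. diff_ops_of_order P n)" using diff_ops_mult[OF hk] by blast
next
  have "\<one>\<^bsub>E\<^esub> = mult_op P \<one>\<^bsub>P\<^esub>" by (auto simp: mult_op_def End_alg_simps)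
  then show "\<one>\<^bsub>E\<^esub> \<in> (\<Union>n. diff_ops_of_order P n)" using mult_op_diff_op[OF one_closed] by (simp only: UN_iff) blast
qed (auto intro: diff_ops_closed diff_ops_smult simp del: diff_ops_of_order.simps)

lemma diff_op_triple: "poisson_triple P (diff_op_alg P) (mult_op P) (pad P)"
  unfolding diff_op_alg_def
  by (rule poisson_triple_restrict[OF poisson_algebra_axioms End_triple diff_ops_subalgebra])
    (use mult_op_diff_op pad_diff_op in blast)+

end

section \<open>The canonical representation and the Poisson module\<close>

lemma natural_poisson_moduleD:
  assumes "natural_poisson_module P U \<alpha> \<beta> act"
  shows "\<lbrakk>u \<in> carrier U; x \<in> carrier P\<rbrakk> \<Longrightarrow> act u x \<in> carrier P"
    and "\<lbrakk>u \<in> carrier U; x \<in> carrier P; y \<in> carrier P\<rbrakk> \<Longrightarrow> act u (x \<oplus>\<^bsub>P\<^esub> y) = act u x \<oplus>\<^bsub>P\<^esub> act u y"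
    and "\<lbrakk>u \<in> carrier U; v \<in> carrier U; x \<in> carrier P\<rbrakk> \<Longrightarrow> act (u \<oplus>\<^bsub>U\<^esub> v) x = act u x \<oplus>\<^bsub>P\<^esub> act v x"
    and "\<lbrakk>u \<in> carrier U; v \<in> carrier U; x \<in> carrier P\<rbrakk> \<Longrightarrow> act (u \<otimes>\<^bsub>U\<^esub> v) x = act u (act v x)"
    and "x \<in> carrier P \<Longrightarrow> act \<one>\<^bsub>U\<^esub> x = x"
    and "\<lbrakk>a \<in> carrier P; x \<in> carrier P\<rbrakk> \<Longrightarrow> act (\<alpha> a) x = a \<otimes>\<^bsub>P\<^esub> x"
    and "\<lbrakk>a \<in> carrier P; x \<in> carrier P\<rbrakk> \<Longrightarrow> act (\<beta> a) x = \<lbrace>a, x\<rbrace>\<^bsub>P\<^esub>"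
  using assms unfolding natural_poisson_module_def left_module_def by blast+

context enveloping
begin

text \<open>Homomorphisms are compared in all of \<open>E\<close>, so that uniqueness also applies
  to maps not yet known to take values in differential operators, such as the one defined by an
  arbitrary action.\<close>

lemma canonical_repD:
  assumes "canonical_rep P U \<alpha> \<beta> \<pi>"
  shows "\<pi> \<in> alg_hom U E"
    and "a \<in> carrier P \<Longrightarrow> \<pi> (\<alpha> a) = mult_op P a" "a \<in> carrier P \<Longrightarrow> \<pi> (\<beta> a) = pad P a"
proof -
  show "\<pi> \<in> alg_hom U E"
    by (rule alg_hom_restrict[OF _ E.subalgebra_ofD(1)[OF diff_ops_subalgebra]])
      (use assms in \<open>simp add: canonical_rep_def diff_op_alg_def\<close>)
qed (use assms in \<open>auto simp: canonical_rep_def\<close>)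

lemma canonical_rep_exists: "\<exists>\<pi>. canonical_rep P U \<alpha> \<beta> \<pi>"
  by (rule ex_hom[OF diff_op_triple]) (auto simp: canonical_rep_def)

lemma End_hom_unique:
  assumes \<pi>: "canonical_rep P U \<alpha> \<beta> \<pi>" and h: "h \<in> alg_hom U E"
    and "\<And>a. a \<in> carrier P \<Longrightarrow> h (\<alpha> a) = mult_op P a" "\<And>a. a \<in> carrier P \<Longrightarrow> h (\<beta> a) = pad P a"
    and u: "u \<in> carrier U"
  shows "h u = \<pi> u"
  by (rule hom_unique[OF End_assoc_algebra h canonical_repD(1)[OF \<pi>] _ _ u])
    (simp_all add: assms canonical_repD[OF \<pi>])

lemma canonical_rep_unique:
  assumes "canonical_rep P U \<alpha> \<beta> \<pi>" "canonical_rep P U \<alpha> \<beta> \<pi>'" "u \<in> carrier U"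
  shows "\<pi> u = \<pi>' u"
  by (rule End_hom_unique[OF assms(2) canonical_repD(1)[OF assms(1)] _ _ assms(3)])
    (simp_all add: canonical_repD[OF assms(1)])

text \<open>The image is itself a subalgebra containing the generating operators, hence contains the
  generated one; conversely \<open>hom_image_subset\<close> places it inside every subalgebra that
  contains them.\<close>

lemma canonical_rep_image:
  assumes \<pi>: "canonical_rep P U \<alpha> \<beta> \<pi>"
  shows "\<pi> ` carrier U = poisson_diff_ops P"
proof
  note D = canonical_repD[OF \<pi>] and h = alg_homD[OF canonical_repD(1)[OF \<pi>]]
  show "\<pi> ` carrier U \<subseteq> poisson_diff_ops P"
    unfolding poisson_diff_ops_def generated_subalgebra_def
    by (intro Inter_greatest hom_image_subset[OF End_assoc_algebra D(1)]) (auto simp: D)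
  have "subalgebra_of (\<pi> ` carrier U) E"
  proof (rule E.subalgebra_ofI)
    show "\<one>\<^bsub>E\<^esub> \<in> \<pi> ` carrier U" using h(4) by (metis U.one_closed imageI)
  qed (auto simp: h(1) simp flip: h(2,3,5))
  moreover have "mult_op P ` carrier P \<union> pad P ` carrier P \<subseteq> \<pi> ` carrier U"
    using D(2,3) U_triple(3,4) by (auto simp flip: D(2,3))
  ultimately show "poisson_diff_ops P \<subseteq> \<pi> ` carrier U"
    unfolding poisson_diff_ops_def generated_subalgebra_def by blast
qed

lemma natural_module_exists: "\<exists>act. natural_poisson_module P U \<alpha> \<beta> act"
proof -
  obtain \<pi> where \<pi>: "canonical_rep P U \<alpha> \<beta> \<pi>" using canonical_rep_exists by blast
  note D = canonical_repD[OF \<pi>] and h = alg_homD[OF canonical_repD(1)[OF \<pi>]]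
  have "natural_poisson_module P U \<alpha> \<beta> \<pi>"
    unfolding natural_poisson_module_def left_module_def
    by (simp add: U.ring_axioms M.abelian_group_axioms h(2-4) D(2,3) End_algD[OF h(1)];
        simp add: End_alg_simps compose_eq mult_op_def pad_def)
  then show ?thesis by blast
qed

text \<open>
  A module over the ring \<open>U\<close> carries no a priori compatibility with the scalars of \<open>K\<close>; linearity
  of the action comes from the centrality of \<open>c \<one>\<close> in \<open>U\<close>.
\<close>
lemma natural_module_eq_rep:
  assumes act: "natural_poisson_module P U \<alpha> \<beta> act" and \<pi>: "canonical_rep P U \<alpha> \<beta> \<pi>"
    and u: "u \<in> carrier U" and p: "p \<in> carrier P"
  shows "act u p = \<pi> u p"
proof -
  note A = natural_poisson_moduleD[OF act]
  \<comment> \<open>Elements of \<open>E\<close> are extensional, so the action is cut down to the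
    carrier before it can be compared with \<pi>.\<close>
  define h where "h u = (\<lambda>x \<in> carrier P. act u x)" for u
  have scal: "\<alpha> (c \<odot> \<one>\<^bsub>P\<^esub>) = c \<odot>\<^bsub>U\<^esub> \<one>\<^bsub>U\<^esub>" for c
    by (simp add: \<alpha>_hom(4,5))
  have act_scal: "act (c \<odot>\<^bsub>U\<^esub> \<one>\<^bsub>U\<^esub>) x = c \<odot> x" if "x \<in> carrier P" for c x
    using A(6)[of "c \<odot> \<one>\<^bsub>P\<^esub>" x] that by (simp add: scal K_smult)
  have l: "act (c \<odot>\<^bsub>U\<^esub> v) x = c \<odot> act v x" if "v \<in> carrier U" "x \<in> carrier P" for c v x
    using A(4)[of "c \<odot>\<^bsub>U\<^esub> \<one>\<^bsub>U\<^esub>" v x] that by (simp add: U.smult_mult_left act_scal A(1))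
  have r: "act v (c \<odot> x) = c \<odot> act v x" if "v \<in> carrier U" "x \<in> carrier P" for c v x
    using A(4)[of v "c \<odot>\<^bsub>U\<^esub> \<one>\<^bsub>U\<^esub>" x] that by (simp add: U.smult_mult_right act_scal del: U.smult_closed') (simp add: l)
  have hE: "h v \<in> carrier E" if "v \<in> carrier U" for v
    by (rule End_algI) (use that in \<open>auto simp: h_def A(1,2) r\<close>)
  have "h \<in> alg_hom U E"
    unfolding alg_hom_iff
    by (auto intro!: End_alg_eqI[of _ P] simp: hE End_closed,
        auto simp: h_def End_alg_simps compose_eq A l)
  then have "h u = \<pi> u"
    by (rule End_hom_unique[OF \<pi> _ _ _ u])
      (auto simp: h_def mult_op_def pad_def fun_eq_iff A(6,7))
  then show ?thesis using p by (simp add: h_def fun_eq_iff) (metis restrict_apply')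
qed

lemma \<alpha>_inj: "inj_on \<alpha> (carrier P)"
proof -
  obtain act where "natural_poisson_module P U \<alpha> \<beta> act" using natural_module_exists by blast
  note A = natural_poisson_moduleD[OF this]
  show ?thesis by (rule inj_onI) (metis A(6) one_closed r_one)
qed

lemma \<alpha>_zero: "\<alpha> \<zero>\<^bsub>P\<^esub> = \<zero>\<^bsub>U\<^esub>"
  using \<alpha>_hom(3)[of "\<zero>\<^bsub>P\<^esub>" "\<zero>\<^bsub>P\<^esub>"] U_triple(3)[of "\<zero>\<^bsub>P\<^esub>"] by (simp add: U.add.l_cancel_one)

lemma annihilator_direct_sum:
  assumes act: "natural_poisson_module P U \<alpha> \<beta> act"
  shows "direct_sum P (restricted_module U \<alpha>) (\<alpha> ` carrier P) (annihilator U P act \<one>\<^bsub>P\<^esub>)"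
proof -
  note A = natural_poisson_moduleD[OF act]
  let ?M = "restricted_module U \<alpha>" and ?N = "annihilator U P act \<one>\<^bsub>P\<^esub>"
  have Ms: "carrier ?M = carrier U" "\<zero>\<^bsub>?M\<^esub> = \<zero>\<^bsub>U\<^esub>" "ring.add ?M = ring.add U"
    "module.smult ?M = (\<lambda>a u. \<alpha> a \<otimes>\<^bsub>U\<^esub> u)"
    by (simp_all add: restricted_module_def)
  note \<alpha>c = U_triple(3)
  have "abelian_group ?M"
  proof (rule abelian_groupI)
    show "\<exists>y\<in>carrier ?M. y \<oplus>\<^bsub>?M\<^esub> x = \<zero>\<^bsub>?M\<^esub>" if "x \<in> carrier ?M" for x
      using that by (auto simp: Ms intro!: bexI[of _ "\<ominus>\<^bsub>U\<^esub> x"] U.l_neg)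
  qed (auto simp: Ms U.a_ac)
  then have modM: "module P ?M"
    by (intro moduleI M_cring) (auto simp: Ms \<alpha>c \<alpha>_hom U.l_distr U.r_distr U.m_assoc)
  then interpret M': module P ?M .
  have neg: "\<ominus>\<^bsub>?M\<^esub> x = \<ominus>\<^bsub>U\<^esub> x" if "x \<in> carrier U" for x
    using that by (intro M'.minus_equality) (auto simp: Ms U.l_neg)
  have act0: "act \<zero>\<^bsub>U\<^esub> x = \<zero>\<^bsub>P\<^esub>" if "x \<in> carrier P" for x
    using A(3)[of "\<zero>\<^bsub>U\<^esub>" "\<zero>\<^bsub>U\<^esub>" x] A(1)[of "\<zero>\<^bsub>U\<^esub>" x] that by (simp add: M.add.l_cancel_one)
  have actneg: "act (\<ominus>\<^bsub>U\<^esub> u) x = \<ominus>\<^bsub>P\<^esub> act u x" if "u \<in> carrier U" "x \<in> carrier P" for u x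
    using A(3)[of "\<ominus>\<^bsub>U\<^esub> u" u x] A(1) that
    by (intro M.minus_equality[symmetric]) (auto simp: U.l_neg act0)
  have \<alpha>neg: "\<ominus>\<^bsub>U\<^esub> \<alpha> a = \<alpha> (\<ominus>\<^bsub>P\<^esub> a)" if "a \<in> carrier P" for a
    using \<alpha>_hom(3)[of "\<ominus>\<^bsub>P\<^esub> a" a] \<alpha>c that
    by (intro U.minus_equality) (auto simp: M.l_neg \<alpha>_zero)
  show ?thesis
    unfolding direct_sum_def
  proof (intro conjI modM)
    show "submodule (\<alpha> ` carrier P) P ?M"
    proof (rule M'.submoduleI)
      show "\<zero>\<^bsub>?M\<^esub> \<in> \<alpha> ` carrier P" using \<alpha>_zero by (metis Ms(2) M.zero_closed imageI)
    qed (auto simp: Ms neg \<alpha>c \<alpha>neg simp flip: \<alpha>_hom(2,3))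
    show "submodule ?N P ?M"
      by (rule M'.submoduleI)
        (auto simp: Ms annihilator_def neg act0 actneg A \<alpha>c)
    have "\<alpha> ` carrier P \<inter> ?N \<subseteq> {\<zero>\<^bsub>U\<^esub>}"
      using \<alpha>_zero by (auto simp: annihilator_def A(6))
    moreover have "\<zero>\<^bsub>U\<^esub> \<in> \<alpha> ` carrier P \<inter> ?N"
      using \<alpha>_zero by (auto simp: annihilator_def act0 image_iff intro!: bexI[of _ "\<zero>\<^bsub>P\<^esub>"])
    ultimately show "\<alpha> ` carrier P \<inter> ?N = {\<zero>\<^bsub>?M\<^esub>}" by (auto simp: Ms)
    show "\<alpha> ` carrier P <+>\<^bsub>?M\<^esub> ?N = carrier ?M"
    proof
      show "\<alpha> ` carrier P <+>\<^bsub>?M\<^esub> ?N \<subseteq> carrier ?M"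
        by (auto simp: set_add_def' Ms annihilator_def \<alpha>c)
      show "carrier ?M \<subseteq> \<alpha> ` carrier P <+>\<^bsub>?M\<^esub> ?N"
      proof
        fix u assume "u \<in> carrier ?M"
        then have u: "u \<in> carrier U" by (simp add: Ms)
        let ?a = "act u \<one>\<^bsub>P\<^esub>"
        have a: "?a \<in> carrier P" using u A(1) by simp
        \<comment> \<open>The map taking u to \<alpha> (u . 1) is the projection onto the first
          summand; its complement kills 1 because \<alpha> (u . 1) also sends 1 to u . 1.\<close>
        let ?v = "\<ominus>\<^bsub>U\<^esub> \<alpha> ?a \<oplus>\<^bsub>U\<^esub> u"
        have "act ?v \<one>\<^bsub>P\<^esub> = \<zero>\<^bsub>P\<^esub>"
          using u a by (simp add: A(3,6) actneg \<alpha>c M.l_neg)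
        then have "?v \<in> ?N" using u a \<alpha>c by (simp add: annihilator_def)
        moreover have "u = \<alpha> ?a \<oplus>\<^bsub>U\<^esub> ?v" using u a \<alpha>c by (simp add: U.r_neg2)
        ultimately show "u \<in> \<alpha> ` carrier P <+>\<^bsub>?M\<^esub> ?N"
          unfolding set_add_def' using a by (auto simp: Ms)
      qed
    qed
  qed
qed

end

section \<open>Presentations by all Hamiltonian derivations\<close>

context enveloping
begin

text \<open>The common end of all the presentation proofs. The hypothesis \<open>id\<close>
  expresses that \<open>A\<close> is generated by the two images, in the form of rigidity of its
  endomorphisms, which is what the uniqueness part of a presentation delivers.\<close>

lemma iso_of_triple:
  fixes A :: "('k, 'c) module"
  assumes T: "poisson_triple P A \<alpha>' \<beta>'" and g: "g \<in> alg_hom A U"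
    and "\<And>a. a \<in> carrier P \<Longrightarrow> g (\<alpha>' a) = \<alpha> a" "\<And>a. a \<in> carrier P \<Longrightarrow> g (\<beta>' a) = \<beta> a"
    and id: "\<And>h x. \<lbrakk>h \<in> alg_hom A A; \<And>a. a \<in> carrier P \<Longrightarrow> h (\<alpha>' a) = \<alpha>' a;
      \<And>a. a \<in> carrier P \<Longrightarrow> h (\<beta>' a) = \<beta>' a; x \<in> carrier A\<rbrakk> \<Longrightarrow> h x = x"
  shows "g \<in> alg_iso A U"
    and "\<exists>f \<in> alg_iso U A. \<forall>a \<in> carrier P. f (\<alpha> a) = \<alpha>' a \<and> f (\<beta> a) = \<beta>' a"
proof -
  obtain f where f: "f \<in> alg_hom U A"
    "\<And>a. a \<in> carrier P \<Longrightarrow> f (\<alpha> a) = \<alpha>' a" "\<And>a. a \<in> carrier P \<Longrightarrow> f (\<beta> a) = \<beta>' a"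
    by (rule ex_hom[OF T]) blast
  have gf: "g (f u) = u" if "u \<in> carrier U" for u
    by (rule hom_unique[OF U.assoc_algebra_axioms alg_hom_comp[OF f(1) g] alg_hom_id _ _ that])
      (simp_all add: f assms)
  have fg: "f (g x) = x" if "x \<in> carrier A" for x
    by (rule id[OF alg_hom_comp[OF g f(1)] _ _ that]) (simp_all add: f assms)
  show "g \<in> alg_iso A U" by (rule alg_isoI[OF g f(1) fg gf])
  show "\<exists>f \<in> alg_iso U A. \<forall>a \<in> carrier P. f (\<alpha> a) = \<alpha>' a \<and> f (\<beta> a) = \<beta>' a"
    using alg_isoI[OF f(1) g gf fg] f(2,3) by blast
qed

text \<open>This presentation is the model \<open>env_model\<close> by which enveloping algebras
  were shown to exist, so two universal objects are being compared.\<close>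

lemma delta_P_presentation:
  "\<exists>\<psi> \<in> alg_iso (presented_alg (Sum_Type.Plus (carrier P) (carrier P)) (delta_P_rels P)) U.
     \<forall>a \<in> carrier P.
       \<psi> (presented_gen (Sum_Type.Plus (carrier P) (carrier P)) (delta_P_rels P) (Inl a)) = \<alpha> a \<and>
       \<psi> (presented_gen (Sum_Type.Plus (carrier P) (carrier P)) (delta_P_rels P) (Inr a)) = \<beta> a"
proof -
  have T: "poisson_triple P (env_model P) (\<lambda>a. env_model_gen P (Inl a)) (\<lambda>a. env_model_gen P (Inr a))"
    by (rule env_model_triple[OF poisson_algebra_axioms])
  obtain g where g: "g \<in> alg_hom (env_model P) U"
    "\<forall>a\<in>carrier P. g (env_model_gen P (Inl a)) = \<alpha> a \<and> g (env_model_gen P (Inr a)) = \<beta> a"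
    using universal_triple_map[OF poisson_algebra_axioms env_model_universal[OF poisson_algebra_axioms] triple]
    by blast
  have "g \<in> alg_iso (env_model P) U"
  proof (rule iso_of_triple(1)[OF T g(1)])
    fix h x
    assume h: "h \<in> alg_hom (env_model P) (env_model P)" and x: "x \<in> carrier (env_model P)"
      and "\<And>a. a \<in> carrier P \<Longrightarrow> h (env_model_gen P (Inl a)) = env_model_gen P (Inl a)"
        "\<And>a. a \<in> carrier P \<Longrightarrow> h (env_model_gen P (Inr a)) = env_model_gen P (Inr a)"
    then show "h x = x"
      by (intro universal_triple_unique[OF poisson_algebra_axioms env_model_universal[OF poisson_algebra_axioms]
          T h _ alg_hom_id _ x]) simp_all
  qed (simp_all add: g(2))
  then show ?thesis using g(2) by (auto simp: env_model_def env_model_gen_def)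
qed

end

section \<open>Relations and quotients\<close>

context assoc_algebra
begin

lemma genideal_proj_zero:
  assumes R: "R \<subseteq> carrier A" and x: "x \<in> R"
  shows "Idl\<^bsub>A\<^esub> R +> x = \<zero>\<^bsub>alg_quot A (Idl\<^bsub>A\<^esub> R)\<^esub>"
proof -
  interpret ideal "Idl\<^bsub>A\<^esub> R" A by (rule genideal_ideal[OF R])
  have "x \<in> Idl\<^bsub>A\<^esub> R" using genideal_self[OF R] x by blast
  then have "Idl\<^bsub>A\<^esub> R +> x = Idl\<^bsub>A\<^esub> R" by (rule a_rcos_const)
  then show ?thesis by (simp add: alg_quot_def FactRing_def)
qed

text \<open>The analogue of \<open>presented_universal\<close> for quotients of an arbitrary
  algebra: the ideal \<open>poisson_ideal P\<close> lives in an algebra that is already a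
  quotient.\<close>

lemma genideal_quot_hom:
  assumes R: "R \<subseteq> carrier A" and B: "ring B" and h: "h \<in> alg_hom A B"
    and R0: "\<And>x. x \<in> R \<Longrightarrow> h x = \<zero>\<^bsub>B\<^esub>"
  obtains f where "f \<in> alg_hom (alg_quot A (Idl\<^bsub>A\<^esub> R)) B"
    "\<And>x. x \<in> carrier A \<Longrightarrow> f (Idl\<^bsub>A\<^esub> R +> x) = h x"
proof -
  interpret B: ring B by (rule B)
  interpret H: ring_hom_ring A B h
    using h B ring_axioms by (auto intro!: ring_hom_ringI2 simp: alg_hom_def)
  have "R \<subseteq> a_kernel A B h" unfolding a_kernel_def' using R R0 by blast
  then have "Idl\<^bsub>A\<^esub> R \<subseteq> a_kernel A B h"
    by (rule genideal_minimal[OF H.kernel_is_ideal])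
  then have "\<And>x. x \<in> Idl\<^bsub>A\<^esub> R \<Longrightarrow> h x = \<zero>\<^bsub>B\<^esub>" unfolding a_kernel_def' by blast
  from alg_quot_hom[OF genideal_ideal[OF R] B h this] that show ?thesis by blast
qed

lemma lin_rels_closed:
  assumes "module KR M" "\<And>a. a \<in> carrier M \<Longrightarrow> \<iota> a \<in> carrier A"
  shows "lin_rels A M \<iota> \<subseteq> carrier A"
proof -
  interpret M: module KR M by fact
  have "c \<odot>\<^bsub>M\<^esub> a \<in> carrier M" if "a \<in> carrier M" for c a using that M.smult_closed by simp
  then show ?thesis using assms(2) unfolding lin_rels_def by (auto simp: minus_eq)
qed

lemma alg_rels_closed:
  assumes "assoc_algebra B" "\<And>a. a \<in> carrier B \<Longrightarrow> \<iota> a \<in> carrier A"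
  shows "alg_rels A B \<iota> \<subseteq> carrier A"
proof -
  interpret B: assoc_algebra B by fact
  show ?thesis using lin_rels_closed[OF B.module_axioms assms(2)] assms(2)
    unfolding alg_rels_def by (auto simp: minus_eq)
qed

lemma hom_diff_zero:
  assumes "ring B" "h \<in> alg_hom A B" "x \<in> carrier A" "y \<in> carrier A" "h x = h y"
  shows "h (x \<ominus> y) = \<zero>\<^bsub>B\<^esub>"
proof -
  interpret B: ring B by fact
  show ?thesis using assms
    by (simp add: alg_hom_minus[OF ring_axioms] alg_homD(1)[OF assms(2)] B.r_right_minus_eq)
qed

lemma lin_rels_zero:
  assumes B: "ring B" and h: "h \<in> alg_hom A B" and M: "module KR M"
    and \<iota>: "\<And>a. a \<in> carrier M \<Longrightarrow> \<iota> a \<in> carrier A"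
    and "\<And>a b. \<lbrakk>a \<in> carrier M; b \<in> carrier M\<rbrakk> \<Longrightarrow> h (\<iota> (a \<oplus>\<^bsub>M\<^esub> b)) = h (\<iota> a) \<oplus>\<^bsub>B\<^esub> h (\<iota> b)"
    and "\<And>c a. a \<in> carrier M \<Longrightarrow> h (\<iota> (c \<odot>\<^bsub>M\<^esub> a)) = c \<odot>\<^bsub>B\<^esub> h (\<iota> a)"
    and p: "p \<in> lin_rels A M \<iota>"
  shows "h p = \<zero>\<^bsub>B\<^esub>"
proof -
  interpret M: module KR M by fact
  have "c \<odot>\<^bsub>M\<^esub> a \<in> carrier M" if "a \<in> carrier M" for c a using that M.smult_closed by simp
  then show ?thesis using p unfolding lin_rels_def
    by (auto intro!: hom_diff_zero[OF B h] simp: \<iota> assms(5,6) alg_homD(3,5)[OF h])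
qed

lemma alg_rels_zero:
  assumes B: "ring B" and h: "h \<in> alg_hom A B" and C: "assoc_algebra C"
    and \<iota>: "\<And>a. a \<in> carrier C \<Longrightarrow> \<iota> a \<in> carrier A"
    and g: "g \<in> alg_hom C B" "\<And>a. a \<in> carrier C \<Longrightarrow> h (\<iota> a) = g a"
    and p: "p \<in> alg_rels A C \<iota>"
  shows "h p = \<zero>\<^bsub>B\<^esub>"
proof -
  interpret C: assoc_algebra C by fact
  have "h p = \<zero>\<^bsub>B\<^esub>" if "p \<in> lin_rels A C \<iota>"
    by (rule lin_rels_zero[OF B h C.module_axioms \<iota> _ _ that]) (simp_all add: g alg_homD(3,5)[OF g(1)])
  then show ?thesis using p unfolding alg_rels_def
    by (auto intro!: hom_diff_zero[OF B h] simp: \<iota> g(2) alg_homD(2,4)[OF h] alg_homD(2,4)[OF g(1)])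
qed

end

lemma presented_eqI:
  fixes R :: "('x list \<Rightarrow> 'k::field) set"
  assumes R: "R \<subseteq> carrier (free_alg G)"
    and pq: "p \<in> carrier (free_alg G)" "q \<in> carrier (free_alg G)" "p \<ominus>\<^bsub>free_alg G\<^esub> q \<in> R"
  shows "Idl\<^bsub>free_alg G\<^esub> R +>\<^bsub>free_alg G\<^esub> p = Idl\<^bsub>free_alg G\<^esub> R +>\<^bsub>free_alg G\<^esub> q"
proof -
  interpret V: assoc_algebra "presented_alg G R" by (rule presented_assoc[OF R])
  interpret F: assoc_algebra "free_alg G :: ('k, 'x list \<Rightarrow> 'k) module" by (rule free_assoc)
  note pr = presented_proj[OF R]
  show ?thesis
    using presented_rel[OF R pq(3)] alg_hom_minus[OF F.ring_axioms V.ring_axioms pr pq(1,2)]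
      alg_homD(1)[OF pr pq(1)] alg_homD(1)[OF pr pq(2)] by (simp add: V.r_right_minus_eq)
qed

text \<open>This is the purpose of \<open>alg_rels\<close>: imposing them makes a mere map on
  generators a homomorphism. It is used for \<open>P\<close> and for \<open>lie_env P\<close>
  alike.\<close>

lemma presented_alg_rels_hom:
  fixes R :: "('x list \<Rightarrow> 'k::field) set"
  assumes R: "R \<subseteq> carrier (free_alg G)" and A: "assoc_algebra A"
    and \<iota>: "\<And>a. a \<in> carrier A \<Longrightarrow> \<iota> a \<in> carrier (free_alg G)"
    and sub: "alg_rels (free_alg G) A \<iota> \<subseteq> R"
  shows "(\<lambda>a. Idl\<^bsub>free_alg G\<^esub> R +>\<^bsub>free_alg G\<^esub> \<iota> a) \<in> alg_hom A (presented_alg G R)"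
proof -
  interpret A: assoc_algebra A by (rule A)
  interpret F: assoc_algebra "free_alg G :: ('k, 'x list \<Rightarrow> 'k) module" by (rule free_assoc)
  note pr = alg_homD[OF presented_proj[OF R]]
  let ?\<phi> = "\<lambda>p. Idl\<^bsub>free_alg G\<^esub> R +>\<^bsub>free_alg G\<^esub> p"
  show ?thesis
    unfolding alg_hom_iff
  proof (intro conjI ballI allI)
    fix a b assume ab: "a \<in> carrier A" "b \<in> carrier A"
    have "\<iota> (a \<otimes>\<^bsub>A\<^esub> b) \<ominus>\<^bsub>free_alg G\<^esub> (\<iota> a \<otimes>\<^bsub>free_alg G\<^esub> \<iota> b) \<in> R"
      "\<iota> (a \<oplus>\<^bsub>A\<^esub> b) \<ominus>\<^bsub>free_alg G\<^esub> (\<iota> a \<oplus>\<^bsub>free_alg G\<^esub> \<iota> b) \<in> R"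
      using sub ab unfolding alg_rels_def lin_rels_def by blast+
    from this[THEN presented_eqI[OF R, rotated -1]] ab \<iota>
    show "?\<phi> (\<iota> (a \<otimes>\<^bsub>A\<^esub> b)) =
        ?\<phi> (\<iota> a) \<otimes>\<^bsub>presented_alg G R\<^esub> ?\<phi> (\<iota> b)"
      "?\<phi> (\<iota> (a \<oplus>\<^bsub>A\<^esub> b)) =
        ?\<phi> (\<iota> a) \<oplus>\<^bsub>presented_alg G R\<^esub> ?\<phi> (\<iota> b)"
      by (simp_all add: pr)
  next
    fix c a assume a: "a \<in> carrier A"
    have "\<iota> (c \<odot>\<^bsub>A\<^esub> a) \<ominus>\<^bsub>free_alg G\<^esub> (c \<odot>\<^bsub>free_alg G\<^esub> \<iota> a) \<in> R"
      using sub a unfolding alg_rels_def lin_rels_def by blast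
    from this[THEN presented_eqI[OF R, rotated -1]] a \<iota>
    show "?\<phi> (\<iota> (c \<odot>\<^bsub>A\<^esub> a)) =
        c \<odot>\<^bsub>presented_alg G R\<^esub> ?\<phi> (\<iota> a)"
      by (simp add: pr)
  next
    have "\<iota> \<one>\<^bsub>A\<^esub> \<ominus>\<^bsub>free_alg G\<^esub> \<one>\<^bsub>free_alg G\<^esub> \<in> R"
      using sub unfolding alg_rels_def by blast
    from this[THEN presented_eqI[OF R, rotated -1]] \<iota>
    show "?\<phi> (\<iota> \<one>\<^bsub>A\<^esub>) = \<one>\<^bsub>presented_alg G R\<^esub>"
      by (simp add: pr)
  qed (simp add: \<iota> pr)
qed

section \<open>The smash product with the Lie enveloping algebra\<close>

context poisson_algebra
begin

lemma lie_env_rels_closed: "lie_env_rels P \<subseteq> carrier (free_alg (carrier P))"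
proof -
  interpret F: assoc_algebra "free_alg (carrier P) :: ('k, 'p list \<Rightarrow> 'k) module" by (rule free_assoc)
  show ?thesis
    unfolding lie_env_rels_def Let_def
    using F.lin_rels_closed[OF module free_gen_closed]
    by (auto intro!: F.minus_closed commutator_closed F.ring_axioms free_gen_closed bracket_closed)
qed

lemma lie_env_assoc: "assoc_algebra (lie_env P)"
  unfolding lie_env_def by (rule presented_assoc[OF lie_env_rels_closed])

lemma lie_env_gen_closed: "a \<in> carrier P \<Longrightarrow> lie_env_gen P a \<in> carrier (lie_env P)"
  unfolding lie_env_def lie_env_gen_def presented_gen_def
  by (rule alg_homD(1)[OF presented_proj[OF lie_env_rels_closed] free_gen_closed])

lemma lie_env_gen_simps:
  assumes "a \<in> carrier P" "b \<in> carrier P"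
  shows "lie_env_gen P (a \<oplus>\<^bsub>P\<^esub> b) = lie_env_gen P a \<oplus>\<^bsub>lie_env P\<^esub> lie_env_gen P b"
    and "lie_env_gen P (c \<odot> a) = c \<odot>\<^bsub>lie_env P\<^esub> lie_env_gen P a"
    and "lie_env_gen P a \<otimes>\<^bsub>lie_env P\<^esub> lie_env_gen P b
       = lie_env_gen P \<lbrace>a, b\<rbrace> \<oplus>\<^bsub>lie_env P\<^esub> (lie_env_gen P b \<otimes>\<^bsub>lie_env P\<^esub> lie_env_gen P a)"
proof -
  let ?F = "free_alg (carrier P) :: ('k, 'p list \<Rightarrow> 'k) module"
  interpret F: assoc_algebra ?F by (rule free_assoc)
  interpret L: assoc_algebra "lie_env P" by (rule lie_env_assoc)
  note pr = alg_homD[OF presented_proj[OF lie_env_rels_closed], folded lie_env_def]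
  note cl = assms free_gen_closed[of _ "carrier P"] bracket_closed
  have m: "free_gen (a \<oplus>\<^bsub>P\<^esub> b) \<ominus>\<^bsub>?F\<^esub> (free_gen a \<oplus>\<^bsub>?F\<^esub> free_gen b) \<in> lie_env_rels P"
    "free_gen (c \<odot> a) \<ominus>\<^bsub>?F\<^esub> (c \<odot>\<^bsub>?F\<^esub> free_gen a) \<in> lie_env_rels P"
    "commutator ?F (free_gen a) (free_gen b) \<ominus>\<^bsub>?F\<^esub> free_gen \<lbrace>a, b\<rbrace> \<in> lie_env_rels P"
    using assms unfolding lie_env_rels_def lin_rels_def Let_def by blast+
  show "lie_env_gen P (a \<oplus>\<^bsub>P\<^esub> b) = lie_env_gen P a \<oplus>\<^bsub>lie_env P\<^esub> lie_env_gen P b"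
    using presented_eqI[OF lie_env_rels_closed _ _ m(1)]
    by (simp add: cl lie_env_gen_def presented_gen_def pr)
  show "lie_env_gen P (c \<odot> a) = c \<odot>\<^bsub>lie_env P\<^esub> lie_env_gen P a"
    using presented_eqI[OF lie_env_rels_closed _ _ m(2)]
    by (simp add: cl lie_env_gen_def presented_gen_def pr)
  have "lie_env_gen P \<lbrace>a, b\<rbrace> = commutator (lie_env P) (lie_env_gen P a) (lie_env_gen P b)"
    using presented_eqI[OF lie_env_rels_closed _ _ m(3)]
      alg_hom_minus[OF F.ring_axioms L.ring_axioms presented_proj[OF lie_env_rels_closed, folded lie_env_def]]
    by (simp add: cl lie_env_gen_def presented_gen_def pr commutator_closed[OF F.ring_axioms])
      (simp add: cl commutator_def pr)
  then show "lie_env_gen P a \<otimes>\<^bsub>lie_env P\<^esub> lie_env_gen P b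
       = lie_env_gen P \<lbrace>a, b\<rbrace> \<oplus>\<^bsub>lie_env P\<^esub> (lie_env_gen P b \<otimes>\<^bsub>lie_env P\<^esub> lie_env_gen P a)"
    by (intro commutator_eq_iff[THEN iffD1, OF L.ring_axioms lie_env_gen_closed lie_env_gen_closed lie_env_gen_closed])
      (simp_all add: assms bracket_closed)
qed

text \<open>The Lie condition is written without subtraction so that the laws of a Poisson triple
  for \<beta> discharge the hypotheses directly.\<close>

lemma lie_env_universal:
  assumes A: "assoc_algebra A" and "\<And>a. a \<in> carrier P \<Longrightarrow> \<gamma> a \<in> carrier A"
    and "\<And>a b. \<lbrakk>a \<in> carrier P; b \<in> carrier P\<rbrakk> \<Longrightarrow> \<gamma> (a \<oplus>\<^bsub>P\<^esub> b) = \<gamma> a \<oplus>\<^bsub>A\<^esub> \<gamma> b"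
    and "\<And>c a. a \<in> carrier P \<Longrightarrow> \<gamma> (c \<odot> a) = c \<odot>\<^bsub>A\<^esub> \<gamma> a"
    and "\<And>a b. \<lbrakk>a \<in> carrier P; b \<in> carrier P\<rbrakk> \<Longrightarrow> \<gamma> a \<otimes>\<^bsub>A\<^esub> \<gamma> b = \<gamma> \<lbrace>a, b\<rbrace> \<oplus>\<^bsub>A\<^esub> (\<gamma> b \<otimes>\<^bsub>A\<^esub> \<gamma> a)"
  obtains k where "k \<in> alg_hom (lie_env P) A" "\<And>a. a \<in> carrier P \<Longrightarrow> k (lie_env_gen P a) = \<gamma> a"
proof -
  let ?F = "free_alg (carrier P) :: ('k, 'p list \<Rightarrow> 'k) module"
  interpret F: assoc_algebra ?F by (rule free_assoc)
  interpret A: assoc_algebra A by (rule A)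
  have \<gamma>: "\<gamma> \<in> carrier P \<rightarrow> carrier A" using assms(2) by blast
  define h where "h = A.ev \<gamma>"
  have h: "h \<in> alg_hom ?F A" unfolding h_def by (rule A.ev_hom[OF \<gamma>])
  have hg: "h (free_gen a) = \<gamma> a" if "a \<in> carrier P" for a
    using A.ev_gen[OF \<gamma> that] by (simp add: h_def)
  have "h (commutator ?F (free_gen a) (free_gen b)) = \<gamma> \<lbrace>a, b\<rbrace>"
    if ab: "a \<in> carrier P" "b \<in> carrier P" for a b
  proof -
    have "h (commutator ?F (free_gen a) (free_gen b)) = commutator A (\<gamma> a) (\<gamma> b)"
      using ab by (simp add: commutator_def alg_hom_minus[OF F.ring_axioms A.ring_axioms h]
          free_gen_closed alg_homD(2)[OF h] hg)
    also have "\<dots> = \<gamma> \<lbrace>a, b\<rbrace>"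
      using ab by (intro commutator_eq_iff[THEN iffD2, OF A.ring_axioms] assms bracket_closed)
    finally show ?thesis .
  qed
  moreover have "h p = \<zero>\<^bsub>A\<^esub>" if "p \<in> lin_rels ?F P free_gen" for p
    by (rule F.lin_rels_zero[OF A.ring_axioms h module _ _ _ that])
      (simp_all add: hg assms free_gen_closed)
  ultimately have "h p = \<zero>\<^bsub>A\<^esub>" if "p \<in> lie_env_rels P" for p
    using that unfolding lie_env_rels_def Let_def
    by (auto intro!: F.hom_diff_zero[OF A.ring_axioms h] commutator_closed F.ring_axioms
        simp: free_gen_closed bracket_closed hg)
  from presented_universal[OF lie_env_rels_closed A h this]
  obtain k where "k \<in> alg_hom (lie_env P) A" "\<forall>a\<in>carrier P. k (lie_env_gen P a) = h (free_gen a)"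
    unfolding lie_env_def lie_env_gen_def by blast
  then show ?thesis using that hg by simp
qed

section \<open>The smash product and its quotient by the Poisson ideal\<close>

lemma pad_smash_gens_mem:
  "Inl a \<in> pad_smash_gens P \<longleftrightarrow> a \<in> carrier P"
  "Inr u \<in> pad_smash_gens P \<longleftrightarrow> u \<in> carrier (lie_env P)"
  by (auto simp: pad_smash_gens_def)

lemma pad_smash_gens_closed:
  "a \<in> carrier P \<Longrightarrow> free_gen (Inl a) \<in> carrier (free_alg (pad_smash_gens P))"
  "u \<in> carrier (lie_env P) \<Longrightarrow> free_gen (Inr u) \<in> carrier (free_alg (pad_smash_gens P))"
  by (auto intro!: free_gen_closed simp: pad_smash_gens_def)

lemma pad_smash_rels_closed: "pad_smash_rels P \<subseteq> carrier (free_alg (pad_smash_gens P))"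
proof -
  interpret F: assoc_algebra "free_alg (pad_smash_gens P) :: ('k, ('k, 'p) smash_free) module"
    by (rule free_assoc)
  have "alg_rels (free_alg (pad_smash_gens P)) P (\<lambda>a. free_gen (Inl a)) \<subseteq> carrier (free_alg (pad_smash_gens P))"
    by (rule F.alg_rels_closed[OF assoc_algebra_P pad_smash_gens_closed(1)])
  moreover have "alg_rels (free_alg (pad_smash_gens P)) (lie_env P) (\<lambda>a. free_gen (Inr a))
      \<subseteq> carrier (free_alg (pad_smash_gens P))"
    by (rule F.alg_rels_closed[OF lie_env_assoc pad_smash_gens_closed(2)])
  ultimately show ?thesis
    unfolding pad_smash_rels_def Let_def
    by (auto intro!: F.minus_closed pad_smash_gens_closed lie_env_gen_closed bracket_closed F.m_closed F.a_closed)
qed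

lemma pad_smash_assoc: "assoc_algebra (pad_smash P)"
  unfolding pad_smash_def by (rule presented_assoc[OF pad_smash_rels_closed])

text \<open>The smash product has every element of \<open>lie_env P\<close> as a generator, whereas
  \<open>smash_delta\<close> only reaches those coming from \<open>P\<close>; this is the
  homomorphism behind it.\<close>

definition smash_lie :: "('p list \<Rightarrow> 'k) set \<Rightarrow> ('k, 'p) smash_free set" where
  "smash_lie u = presented_gen (pad_smash_gens P) (pad_smash_rels P) (Inr u)"

lemma smash_delta_eq: "smash_delta P a = smash_lie (lie_env_gen P a)"
  by (simp add: smash_delta_def smash_lie_def)

lemma smash_elt_hom: "smash_elt P \<in> alg_hom P (pad_smash P)"
proof -
  have "(\<lambda>a. Idl\<^bsub>free_alg (pad_smash_gens P)\<^esub> (pad_smash_rels P) +>\<^bsub>free_alg (pad_smash_gens P)\<^esub> free_gen (Inl a))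
      \<in> alg_hom P (presented_alg (pad_smash_gens P) (pad_smash_rels P))"
    by (rule presented_alg_rels_hom[OF pad_smash_rels_closed assoc_algebra_P pad_smash_gens_closed(1)])
      (auto simp: pad_smash_rels_def Let_def)
  then show ?thesis by (simp add: smash_elt_def[abs_def] presented_gen_def pad_smash_def)
qed

lemma smash_lie_hom: "smash_lie \<in> alg_hom (lie_env P) (pad_smash P)"
proof -
  have "(\<lambda>a. Idl\<^bsub>free_alg (pad_smash_gens P)\<^esub> (pad_smash_rels P) +>\<^bsub>free_alg (pad_smash_gens P)\<^esub> free_gen (Inr a))
      \<in> alg_hom (lie_env P) (presented_alg (pad_smash_gens P) (pad_smash_rels P))"
    by (rule presented_alg_rels_hom[OF pad_smash_rels_closed lie_env_assoc pad_smash_gens_closed(2)])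
      (auto simp: pad_smash_rels_def Let_def)
  then show ?thesis by (simp add: smash_lie_def[abs_def] presented_gen_def pad_smash_def)
qed

lemma smash_comm:
  assumes "a \<in> carrier P" "b \<in> carrier P"
  shows "smash_delta P a \<otimes>\<^bsub>pad_smash P\<^esub> smash_elt P b
     = (smash_elt P b \<otimes>\<^bsub>pad_smash P\<^esub> smash_delta P a) \<oplus>\<^bsub>pad_smash P\<^esub> smash_elt P \<lbrace>a, b\<rbrace>"
proof -
  let ?F = "free_alg (pad_smash_gens P) :: ('k, ('k, 'p) smash_free) module"
  interpret F: assoc_algebra ?F by (rule free_assoc)
  note pr = alg_homD[OF presented_proj[OF pad_smash_rels_closed], folded pad_smash_def]
  have "(free_gen (Inr (lie_env_gen P a)) \<otimes>\<^bsub>?F\<^esub> free_gen (Inl b)) \<ominus>\<^bsub>?F\<^esub>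
     ((free_gen (Inl b) \<otimes>\<^bsub>?F\<^esub> free_gen (Inr (lie_env_gen P a))) \<oplus>\<^bsub>?F\<^esub> free_gen (Inl \<lbrace>a, b\<rbrace>))
    \<in> pad_smash_rels P"
    using assms unfolding pad_smash_rels_def Let_def by blast
  from presented_eqI[OF pad_smash_rels_closed _ _ this] show ?thesis
    using assms by (simp add: pad_smash_gens_closed lie_env_gen_closed bracket_closed pr
        smash_elt_def smash_delta_def presented_gen_def)
qed

definition poisson_ideal_gens :: "('k, 'p) smash_free set set" where
  "poisson_ideal_gens =
     {smash_delta P (a \<otimes>\<^bsub>P\<^esub> b)
        \<ominus>\<^bsub>pad_smash P\<^esub> (smash_elt P a \<otimes>\<^bsub>pad_smash P\<^esub> smash_delta P b)
        \<ominus>\<^bsub>pad_smash P\<^esub> (smash_elt P b \<otimes>\<^bsub>pad_smash P\<^esub> smash_delta P a)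
      | a b. a \<in> carrier P \<and> b \<in> carrier P}"

lemma poisson_ideal_eq: "poisson_ideal P = Idl\<^bsub>pad_smash P\<^esub> poisson_ideal_gens"
  by (simp add: poisson_ideal_def poisson_ideal_gens_def Let_def)

lemma smash_closed:
  "a \<in> carrier P \<Longrightarrow> smash_elt P a \<in> carrier (pad_smash P)"
  "a \<in> carrier P \<Longrightarrow> smash_delta P a \<in> carrier (pad_smash P)"
  using alg_homD(1)[OF smash_elt_hom] alg_homD(1)[OF smash_lie_hom lie_env_gen_closed]
  by (simp_all add: smash_delta_eq)

lemma poisson_ideal_gens_closed: "poisson_ideal_gens \<subseteq> carrier (pad_smash P)"
proof -
  interpret B: assoc_algebra "pad_smash P" by (rule pad_smash_assoc)
  show ?thesis unfolding poisson_ideal_gens_def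
    by (auto intro!: B.minus_closed smash_closed B.m_closed)
qed

lemma smash_delta_simps:
  assumes "a \<in> carrier P" "b \<in> carrier P"
  shows "smash_delta P (a \<oplus>\<^bsub>P\<^esub> b) = smash_delta P a \<oplus>\<^bsub>pad_smash P\<^esub> smash_delta P b"
    and "smash_delta P (c \<odot> a) = c \<odot>\<^bsub>pad_smash P\<^esub> smash_delta P a"
    and "smash_delta P a \<otimes>\<^bsub>pad_smash P\<^esub> smash_delta P b
       = smash_delta P \<lbrace>a, b\<rbrace> \<oplus>\<^bsub>pad_smash P\<^esub> (smash_delta P b \<otimes>\<^bsub>pad_smash P\<^esub> smash_delta P a)"
proof -
  interpret L: assoc_algebra "lie_env P" by (rule lie_env_assoc)
  note h = alg_homD[OF smash_lie_hom] and cl = lie_env_gen_closed bracket_closed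
  show "smash_delta P (a \<oplus>\<^bsub>P\<^esub> b) = smash_delta P a \<oplus>\<^bsub>pad_smash P\<^esub> smash_delta P b"
    "smash_delta P (c \<odot> a) = c \<odot>\<^bsub>pad_smash P\<^esub> smash_delta P a"
    by (simp_all add: smash_delta_eq assms cl lie_env_gen_simps(1,2)[OF assms] h)
  show "smash_delta P a \<otimes>\<^bsub>pad_smash P\<^esub> smash_delta P b
       = smash_delta P \<lbrace>a, b\<rbrace> \<oplus>\<^bsub>pad_smash P\<^esub> (smash_delta P b \<otimes>\<^bsub>pad_smash P\<^esub> smash_delta P a)"
    using arg_cong[OF lie_env_gen_simps(3)[OF assms], of smash_lie]
    by (simp add: smash_delta_eq assms cl h del: lie_env_gen_simps)
qed

text \<open>Every law of a triple except the product rule for \<delta> holds in the smash product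
  already; dividing by the ideal adds precisely that rule.\<close>

lemma smash_quot_triple:
  "poisson_triple P (alg_quot (pad_smash P) (poisson_ideal P))
     (\<lambda>a. poisson_ideal P +>\<^bsub>pad_smash P\<^esub> smash_elt P a) (\<lambda>a. poisson_ideal P +>\<^bsub>pad_smash P\<^esub> smash_delta P a)"
proof -
  interpret B: assoc_algebra "pad_smash P" by (rule pad_smash_assoc)
  have I: "ideal (poisson_ideal P) (pad_smash P)"
    unfolding poisson_ideal_eq by (rule B.genideal_ideal[OF poisson_ideal_gens_closed])
  let ?Q = "alg_quot (pad_smash P) (poisson_ideal P)"
  let ?\<eta> = "\<lambda>x. poisson_ideal P +>\<^bsub>pad_smash P\<^esub> x"
  have Q: "assoc_algebra ?Q" by (rule B.alg_quot_assoc[OF I])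
  then interpret Q: assoc_algebra ?Q .
  note \<eta> = B.alg_quot_proj[OF I] note h = alg_homD[OF \<eta>]
  note cl = smash_closed bracket_closed
  show ?thesis
  proof (rule poisson_tripleI[OF poisson_algebra_axioms Q])
    fix a b assume ab: "a \<in> carrier P" "b \<in> carrier P"
    show "?\<eta> (smash_delta P a) \<otimes>\<^bsub>?Q\<^esub> ?\<eta> (smash_delta P b)
      = ?\<eta> (smash_delta P \<lbrace>a, b\<rbrace>) \<oplus>\<^bsub>?Q\<^esub> (?\<eta> (smash_delta P b) \<otimes>\<^bsub>?Q\<^esub> ?\<eta> (smash_delta P a))"
      using ab arg_cong[OF smash_delta_simps(3)[OF ab], of ?\<eta>] by (simp add: cl h)
    show "?\<eta> (smash_delta P a) \<otimes>\<^bsub>?Q\<^esub> ?\<eta> (smash_elt P b)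
      = ?\<eta> (smash_elt P \<lbrace>a, b\<rbrace>) \<oplus>\<^bsub>?Q\<^esub> (?\<eta> (smash_elt P b) \<otimes>\<^bsub>?Q\<^esub> ?\<eta> (smash_delta P a))"
      using ab arg_cong[OF smash_comm[OF ab], of ?\<eta>] by (simp add: cl h Q.a_comm)
    have "smash_delta P (a \<otimes>\<^bsub>P\<^esub> b)
        \<ominus>\<^bsub>pad_smash P\<^esub> (smash_elt P a \<otimes>\<^bsub>pad_smash P\<^esub> smash_delta P b)
        \<ominus>\<^bsub>pad_smash P\<^esub> (smash_elt P b \<otimes>\<^bsub>pad_smash P\<^esub> smash_delta P a) \<in> poisson_ideal_gens"
      using ab unfolding poisson_ideal_gens_def by blast
    from B.genideal_proj_zero[OF poisson_ideal_gens_closed this]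
    have "(?\<eta> (smash_delta P (a \<otimes>\<^bsub>P\<^esub> b)) \<ominus>\<^bsub>?Q\<^esub> (?\<eta> (smash_elt P a) \<otimes>\<^bsub>?Q\<^esub> ?\<eta> (smash_delta P b)))
       \<ominus>\<^bsub>?Q\<^esub> (?\<eta> (smash_elt P b) \<otimes>\<^bsub>?Q\<^esub> ?\<eta> (smash_delta P a)) = \<zero>\<^bsub>?Q\<^esub>"
      using ab by (simp add: cl h alg_hom_minus[OF B.ring_axioms Q.ring_axioms \<eta>] flip: poisson_ideal_eq)
    then have "?\<eta> (smash_delta P (a \<otimes>\<^bsub>P\<^esub> b)) \<ominus>\<^bsub>?Q\<^esub> (?\<eta> (smash_elt P a) \<otimes>\<^bsub>?Q\<^esub> ?\<eta> (smash_delta P b))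
       = ?\<eta> (smash_elt P b) \<otimes>\<^bsub>?Q\<^esub> ?\<eta> (smash_delta P a)"
      using ab by (subst (asm) Q.r_right_minus_eq) (simp_all add: cl h(1))
    then show "?\<eta> (smash_delta P (a \<otimes>\<^bsub>P\<^esub> b)) = (?\<eta> (smash_elt P b) \<otimes>\<^bsub>?Q\<^esub> ?\<eta> (smash_delta P a))
        \<oplus>\<^bsub>?Q\<^esub> (?\<eta> (smash_elt P a) \<otimes>\<^bsub>?Q\<^esub> ?\<eta> (smash_delta P b))"
      using ab by (metis Q.add.inv_solve_right Q.m_closed Q.minus_eq cl(1,2) h(1) m_closed)
  next
    show "(\<lambda>a. ?\<eta> (smash_elt P a)) \<in> alg_hom P ?Q"
      by (rule alg_hom_comp[OF smash_elt_hom \<eta>])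
  qed (simp_all add: cl h smash_delta_simps(1,2))
qed

end

context enveloping
begin

lemma smash_presentation:
  "\<exists>\<phi> \<in> alg_iso U (alg_quot (pad_smash P) (poisson_ideal P)).
     \<forall>a \<in> carrier P.
       \<phi> (\<alpha> a) = poisson_ideal P +>\<^bsub>pad_smash P\<^esub> smash_elt P a \<and>
       \<phi> (\<beta> a) = poisson_ideal P +>\<^bsub>pad_smash P\<^esub> smash_delta P a"
proof -
  interpret B: assoc_algebra "pad_smash P" by (rule pad_smash_assoc)
  let ?F = "free_alg (pad_smash_gens P) :: ('k, ('k, 'p) smash_free) module"
  interpret F: assoc_algebra ?F by (rule free_assoc)
  have I: "ideal (poisson_ideal P) (pad_smash P)"
    unfolding poisson_ideal_eq by (rule B.genideal_ideal[OF poisson_ideal_gens_closed])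
  let ?Q = "alg_quot (pad_smash P) (poisson_ideal P)"
  let ?\<eta> = "\<lambda>x. poisson_ideal P +>\<^bsub>pad_smash P\<^esub> x"
  have Q: "assoc_algebra ?Q" by (rule B.alg_quot_assoc[OF I])
  then interpret Q: assoc_algebra ?Q .
  note \<eta> = B.alg_quot_proj[OF I]
  \<comment> \<open>Since all of U(P) occurs among the generators of the smash product, \<beta> must
    first be extended from \<open>P\<close> to U(P).\<close>
  obtain k where k: "k \<in> alg_hom (lie_env P) U" "\<And>a. a \<in> carrier P \<Longrightarrow> k (lie_env_gen P a) = \<beta> a"
    by (rule lie_env_universal[OF U.assoc_algebra_axioms U_triple(4-7)]) blast+
  let ?g = "case_sum \<alpha> k"
  have g: "?g \<in> pad_smash_gens P \<rightarrow> carrier U"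
    by (auto simp: pad_smash_gens_def U_triple(3) alg_homD(1)[OF k(1)])
  define h where "h = U.ev ?g"
  have h: "h \<in> alg_hom ?F U" unfolding h_def by (rule U.ev_hom[OF g])
  have hg: "h (free_gen (Inl a)) = \<alpha> a" "h (free_gen (Inr u)) = k u"
    if "a \<in> carrier P" "u \<in> carrier (lie_env P)" for a u
    using that U.ev_gen[OF g, of "Inl a"] U.ev_gen[OF g, of "Inr u"] by (auto simp: h_def pad_smash_gens_def)
  have "h p = \<zero>\<^bsub>U\<^esub>" if "p \<in> alg_rels ?F P (\<lambda>a. free_gen (Inl a))" for p
    by (rule F.alg_rels_zero[OF U.ring_axioms h assoc_algebra_P _ U_triple(2) _ that])
      (simp_all add: hg(1)[OF _ lie_env_gen_closed[OF M.zero_closed]] pad_smash_gens_closed)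
  moreover have "h p = \<zero>\<^bsub>U\<^esub>" if "p \<in> alg_rels ?F (lie_env P) (\<lambda>a. free_gen (Inr a))" for p
    by (rule F.alg_rels_zero[OF U.ring_axioms h lie_env_assoc _ k(1) _ that])
      (simp_all add: hg(2)[OF M.zero_closed] pad_smash_gens_closed)
  moreover have "h ((free_gen (Inr (lie_env_gen P a)) \<otimes>\<^bsub>?F\<^esub> free_gen (Inl b)) \<ominus>\<^bsub>?F\<^esub>
     ((free_gen (Inl b) \<otimes>\<^bsub>?F\<^esub> free_gen (Inr (lie_env_gen P a))) \<oplus>\<^bsub>?F\<^esub> free_gen (Inl \<lbrace>a, b\<rbrace>))) = \<zero>\<^bsub>U\<^esub>"
    if ab: "a \<in> carrier P" "b \<in> carrier P" for a b
    using ab lie_env_gen_closed[OF ab(1)] U_triple(8)[OF ab]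
    by (intro F.hom_diff_zero[OF U.ring_axioms h])
      (simp_all add: pad_smash_gens_closed bracket_closed alg_homD[OF h] hg k(2) U_triple(3,4) U.a_comm)
  ultimately have "h p = \<zero>\<^bsub>U\<^esub>" if "p \<in> pad_smash_rels P" for p
    using that unfolding pad_smash_rels_def Let_def by blast
  from presented_universal[OF pad_smash_rels_closed U.assoc_algebra_axioms h this]
  obtain g0 where g0: "g0 \<in> alg_hom (pad_smash P) U"
    "\<forall>x\<in>pad_smash_gens P. g0 (presented_gen (pad_smash_gens P) (pad_smash_rels P) x) = h (free_gen x)"
    unfolding pad_smash_def by blast
  have g0v: "g0 (smash_elt P a) = \<alpha> a" "g0 (smash_delta P a) = \<beta> a" if "a \<in> carrier P" for a
    using that lie_env_gen_closed[OF that] g0(2)[rule_format, of "Inl a"] g0(2)[rule_format, of "Inr (lie_env_gen P a)"]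
      hg(1)[OF that lie_env_gen_closed[OF that]] hg(2)[OF that lie_env_gen_closed[OF that]]
    by (simp_all add: smash_elt_def smash_delta_def k(2) pad_smash_gens_mem)
  have "g0 x = \<zero>\<^bsub>U\<^esub>" if "x \<in> poisson_ideal_gens" for x
  proof -
    from that obtain a b where ab: "a \<in> carrier P" "b \<in> carrier P" and
      x: "x = smash_delta P (a \<otimes>\<^bsub>P\<^esub> b)
        \<ominus>\<^bsub>pad_smash P\<^esub> (smash_elt P a \<otimes>\<^bsub>pad_smash P\<^esub> smash_delta P b)
        \<ominus>\<^bsub>pad_smash P\<^esub> (smash_elt P b \<otimes>\<^bsub>pad_smash P\<^esub> smash_delta P a)"
      unfolding poisson_ideal_gens_def by blast
    have "g0 x = (\<beta> (a \<otimes>\<^bsub>P\<^esub> b) \<ominus>\<^bsub>U\<^esub> (\<alpha> a \<otimes>\<^bsub>U\<^esub> \<beta> b)) \<ominus>\<^bsub>U\<^esub> (\<alpha> b \<otimes>\<^bsub>U\<^esub> \<beta> a)"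
      unfolding x using ab
      by (simp add: alg_hom_minus[OF B.ring_axioms U.ring_axioms g0(1)] alg_homD(2)[OF g0(1)] g0v smash_closed)
    then show ?thesis using ab U_triple(3,4)
      by (simp add: U_triple(9) U.minus_eq U.a_assoc U.r_neg)
  qed
  then obtain g where g: "g \<in> alg_hom ?Q U" "\<And>x. x \<in> carrier (pad_smash P) \<Longrightarrow> g (?\<eta> x) = g0 x"
    by (rule B.genideal_quot_hom[OF poisson_ideal_gens_closed U.ring_axioms g0(1), folded poisson_ideal_eq]) blast+
  show ?thesis
  proof (rule iso_of_triple(2)[OF smash_quot_triple g(1)])
    fix f x
    assume f: "f \<in> alg_hom ?Q ?Q" and x: "x \<in> carrier ?Q"
      and fa: "\<And>a. a \<in> carrier P \<Longrightarrow> f (?\<eta> (smash_elt P a)) = ?\<eta> (smash_elt P a)"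
      and fd: "\<And>a. a \<in> carrier P \<Longrightarrow> f (?\<eta> (smash_delta P a)) = ?\<eta> (smash_delta P a)"
    obtain y where y: "y \<in> carrier (pad_smash P)" "x = ?\<eta> y"
      using x by (auto simp: B.alg_quot_carrier[OF I])
    \<comment> \<open>Only the elements \<delta>_a are known to be fixed. Two homomorphisms out of
      U(P) that agree on them agree everywhere, so the remaining generators of the smash product are
      fixed as well.\<close>
    have lie: "f (?\<eta> (smash_lie u)) = ?\<eta> (smash_lie u)" if "u \<in> carrier (lie_env P)" for u
    proof (rule presented_unique[OF lie_env_rels_closed Q.ring_axioms])
      show "(\<lambda>u. f (?\<eta> (smash_lie u))) \<in> alg_hom (presented_alg (carrier P) (lie_env_rels P)) ?Q"
        "(\<lambda>u. ?\<eta> (smash_lie u)) \<in> alg_hom (presented_alg (carrier P) (lie_env_rels P)) ?Q"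
        using alg_hom_comp[OF alg_hom_comp[OF smash_lie_hom \<eta>] f] alg_hom_comp[OF smash_lie_hom \<eta>]
        by (simp_all add: lie_env_def)
    qed (use that fd in \<open>auto simp: lie_env_def smash_delta_eq lie_env_gen_def\<close>)
    have "f (?\<eta> y) = ?\<eta> y"
    proof (rule presented_unique[OF pad_smash_rels_closed Q.ring_axioms, folded pad_smash_def])
      show "(\<lambda>y. f (?\<eta> y)) \<in> alg_hom (pad_smash P) ?Q" by (rule alg_hom_comp[OF \<eta> f])
      show "?\<eta> \<in> alg_hom (pad_smash P) ?Q" by (rule \<eta>)
    qed (use y(1) fa lie in \<open>auto simp: pad_smash_gens_def smash_elt_def smash_lie_def\<close>)
    then show "f x = x" by (simp add: y(2))
  qed (simp_all add: g(2) smash_closed g0v)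
qed

end

section \<open>Polynomials and partial derivatives\<close>

text \<open>The term split off has a key that does not occur in the rest. No cancellation can
  happen, so the keys of the sum are exactly those of its parts and a condition on all keys passes
  to both.\<close>

lemma poly_mapping_single_induct [case_names zero add]:
  fixes p :: "'a \<Rightarrow>\<^sub>0 'b::comm_monoid_add"
  assumes "Q 0"
    and "\<And>m c p. \<lbrakk>m \<notin> Poly_Mapping.keys p; c \<noteq> 0; Q p\<rbrakk> \<Longrightarrow> Q (Poly_Mapping.single m c + p)"
  shows "Q p"
proof (induction p rule: Poly_Mapping.update_induct)
  case (update f m c)
  have "Poly_Mapping.update m c f = Poly_Mapping.single m c + f"
    by (rule poly_mapping_eqI)
      (use update(1) in \<open>auto simp: lookup_update lookup_add lookup_single when_def in_keys_iff\<close>)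
  then show ?case using update assms(2)[of m f c] by simp
qed (rule assms(1))

lemma poly_alg_simps:
  "monoid.mult (poly_alg \<Lambda>) = (*)" "monoid.one (poly_alg \<Lambda>) = 1" "ring.zero (poly_alg \<Lambda>) = 0"
  "ring.add (poly_alg \<Lambda>) = (+)" "module.smult (poly_alg \<Lambda>) = (\<lambda>c p. Poly_Mapping.single 0 c * p)"
  by (simp_all add: poly_alg_def)

abbreviation poly_carrier :: "'i set \<Rightarrow> (('i \<Rightarrow>\<^sub>0 nat) \<Rightarrow>\<^sub>0 'k::field) set" where
  "poly_carrier \<Lambda> \<equiv> carrier (poly_alg \<Lambda>)"

lemma poly_carrier_iff:
  "p \<in> poly_carrier \<Lambda> \<longleftrightarrow> (\<forall>m \<in> Poly_Mapping.keys p. Poly_Mapping.keys m \<subseteq> \<Lambda>)"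
  by (simp add: poly_alg_def)

lemma poly_carrier_closed:
  fixes p q :: "('i \<Rightarrow>\<^sub>0 nat) \<Rightarrow>\<^sub>0 'k::field"
  shows "0 \<in> poly_carrier \<Lambda>" "1 \<in> poly_carrier \<Lambda>"
    and "Poly_Mapping.keys m \<subseteq> \<Lambda> \<Longrightarrow> Poly_Mapping.single m c \<in> poly_carrier \<Lambda>"
    and "i \<in> \<Lambda> \<Longrightarrow> poly_var i \<in> poly_carrier \<Lambda>"
    and "\<lbrakk>p \<in> poly_carrier \<Lambda>; q \<in> poly_carrier \<Lambda>\<rbrakk> \<Longrightarrow> p + q \<in> poly_carrier \<Lambda>"
    and "\<lbrakk>p \<in> poly_carrier \<Lambda>; q \<in> poly_carrier \<Lambda>\<rbrakk> \<Longrightarrow> p * q \<in> poly_carrier \<Lambda>"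
    and "\<lbrakk>p \<in> poly_carrier \<Lambda>; q \<in> poly_carrier \<Lambda>\<rbrakk> \<Longrightarrow> p - q \<in> poly_carrier \<Lambda>"
proof -
  show "0 \<in> poly_carrier \<Lambda>" "1 \<in> poly_carrier \<Lambda>"
    "Poly_Mapping.keys m \<subseteq> \<Lambda> \<Longrightarrow> Poly_Mapping.single m c \<in> poly_carrier \<Lambda>"
    "i \<in> \<Lambda> \<Longrightarrow> poly_var i \<in> poly_carrier \<Lambda>"
    by (auto simp: poly_carrier_iff poly_var_def)
  show "\<lbrakk>p \<in> poly_carrier \<Lambda>; q \<in> poly_carrier \<Lambda>\<rbrakk> \<Longrightarrow> p + q \<in> poly_carrier \<Lambda>"
    using keys_add[of p q] unfolding poly_carrier_iff by blast
  show "\<lbrakk>p \<in> poly_carrier \<Lambda>; q \<in> poly_carrier \<Lambda>\<rbrakk> \<Longrightarrow> p - q \<in> poly_carrier \<Lambda>"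
  proof -
    have "Poly_Mapping.keys (p - q) \<subseteq> Poly_Mapping.keys p \<union> Poly_Mapping.keys q"
      by (auto simp: in_keys_iff lookup_minus)
    then show "\<lbrakk>p \<in> poly_carrier \<Lambda>; q \<in> poly_carrier \<Lambda>\<rbrakk> \<Longrightarrow> p - q \<in> poly_carrier \<Lambda>"
      unfolding poly_carrier_iff by blast
  qed
  assume pq: "p \<in> poly_carrier \<Lambda>" "q \<in> poly_carrier \<Lambda>"
  show "p * q \<in> poly_carrier \<Lambda>"
    unfolding poly_carrier_iff
  proof
    fix m assume "m \<in> Poly_Mapping.keys (p * q)"
    then obtain a b where ab: "m = a + b" "a \<in> Poly_Mapping.keys p" "b \<in> Poly_Mapping.keys q"
      using keys_mult[of p q] by auto
    then have "Poly_Mapping.keys a \<subseteq> \<Lambda>" "Poly_Mapping.keys b \<subseteq> \<Lambda>"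
      using pq unfolding poly_carrier_iff by blast+
    then show "Poly_Mapping.keys m \<subseteq> \<Lambda>" unfolding ab(1) using keys_add[of a b] by blast
  qed
qed

text \<open>Polynomials are built up as powers of one variable, then monomials, terms and sums, each
  time staying within the variables from \<Lambda>.\<close>

lemma poly_alg_induct [consumes 1, case_names const var add mult]:
  fixes p :: "('i \<Rightarrow>\<^sub>0 nat) \<Rightarrow>\<^sub>0 'k::field"
  assumes p: "p \<in> poly_carrier \<Lambda>"
    and const: "\<And>c. Q (Poly_Mapping.single 0 c)" and var: "\<And>i. i \<in> \<Lambda> \<Longrightarrow> Q (poly_var i)"
    and add: "\<And>p q. \<lbrakk>p \<in> poly_carrier \<Lambda>; q \<in> poly_carrier \<Lambda>; Q p; Q q\<rbrakk> \<Longrightarrow> Q (p + q)"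
    and mult: "\<And>p q. \<lbrakk>p \<in> poly_carrier \<Lambda>; q \<in> poly_carrier \<Lambda>; Q p; Q q\<rbrakk> \<Longrightarrow> Q (p * q)"
  shows "Q p"
proof -
  have pow: "Q (Poly_Mapping.single (Poly_Mapping.single i n) 1)" if "i \<in> \<Lambda>" for i n
  proof (induction n)
    case 0 then show ?case using const[of 1] by simp
  next
    case (Suc n)
    have "Poly_Mapping.single (Poly_Mapping.single i (Suc n)) 1 =
      poly_var i * Poly_Mapping.single (Poly_Mapping.single i n) (1 :: 'k)"
      by (simp add: poly_var_def mult_single flip: single_add)
    then show ?case
      using mult[OF _ _ var[OF that] Suc] that by (simp add: poly_carrier_closed)
  qed
  have mon1: "Poly_Mapping.keys m \<subseteq> \<Lambda> \<longrightarrow> Q (Poly_Mapping.single m 1)" for m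
  proof (induction m rule: poly_mapping_single_induct)
    case zero then show ?case using const[of 1] by simp
  next
    case (add i n m)
    have k: "Poly_Mapping.keys (Poly_Mapping.single i n + m) = insert i (Poly_Mapping.keys m)"
      using add by (auto simp: in_keys_iff lookup_add lookup_single when_def split: if_splits)
    have e: "Poly_Mapping.single (Poly_Mapping.single i n + m) 1 =
       Poly_Mapping.single (Poly_Mapping.single i n) 1 * Poly_Mapping.single m (1 :: 'k)"
      by (simp add: mult_single)
    show ?case unfolding k e
      using mult[OF _ _ pow] add(3) add(2) by (auto simp: poly_carrier_closed)
  qed
  have mon: "Q (Poly_Mapping.single m c)" if "Poly_Mapping.keys m \<subseteq> \<Lambda>" for m c
    using mult[OF _ _ const[of c] mon1[THEN mp, OF that]] that by (simp add: poly_carrier_closed mult_single)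
  have "p \<in> poly_carrier \<Lambda> \<longrightarrow> Q p"
  proof (induction p rule: poly_mapping_single_induct)
    case zero then show ?case using const[of 0] by simp
  next
    case (add m c p)
    have k: "Poly_Mapping.keys (Poly_Mapping.single m c + p) = insert m (Poly_Mapping.keys p)"
      using add by (auto simp: in_keys_iff lookup_add lookup_single when_def split: if_splits)
    show ?case
    proof
      assume "Poly_Mapping.single m c + p \<in> poly_carrier \<Lambda>"
      then have "Poly_Mapping.keys m \<subseteq> \<Lambda>" "p \<in> poly_carrier \<Lambda>" unfolding poly_carrier_iff k by auto
      then show "Q (Poly_Mapping.single m c + p)"
        using assms(4)[OF _ _ mon, of m c p] add(3) by (simp add: poly_carrier_closed)
    qed
  qed
  then show ?thesis using p by blast
qed

section \<open>Partial derivatives of polynomials\<close>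

lemma poly_pd_superset:
  assumes "finite W" "Poly_Mapping.keys p \<subseteq> W"
  shows "poly_pd i p = (\<Sum>m \<in> W. Poly_Mapping.single (m - Poly_Mapping.single i 1)
     (of_nat (Poly_Mapping.lookup m i) * Poly_Mapping.lookup p m))"
  unfolding poly_pd_def using assms
  by (intro sum.mono_neutral_left) (auto simp: in_keys_iff)

lemma poly_pd_single:
  "poly_pd i (Poly_Mapping.single m c)
    = Poly_Mapping.single (m - Poly_Mapping.single i 1) (of_nat (Poly_Mapping.lookup m i) * c)"
  by (simp add: poly_pd_def)

lemma poly_pd_add: "poly_pd i (p + q) = poly_pd i p + poly_pd i q"
proof -
  let ?W = "Poly_Mapping.keys p \<union> Poly_Mapping.keys q"
  have "Poly_Mapping.keys (p + q) \<subseteq> ?W" by (rule keys_add)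
  then show ?thesis
    by (simp add: poly_pd_superset[of ?W] lookup_add ring_distribs single_add sum.distrib)
qed

lemma poly_pd_zero: "poly_pd i 0 = 0"
  by (simp add: poly_pd_def)

lemma poly_pd_mult_single:
  fixes c d :: "'k::field"
  shows "poly_pd i (Poly_Mapping.single m c * Poly_Mapping.single n d)
    = Poly_Mapping.single m c * poly_pd i (Poly_Mapping.single n d)
      + poly_pd i (Poly_Mapping.single m c) * Poly_Mapping.single n d"
proof -
  let ?e = "Poly_Mapping.single i (1::nat)"
  \<comment> \<open>Exponents are natural numbers, so \<open>v - ?e\<close> is truncated when v does
    not involve i. Then the coefficient is 0 and the wrong exponent is harmless; otherwise the
    subtraction commutes with adding u.\<close>
  have shift: "Poly_Mapping.single (u + (v - ?e)) (of_nat (Poly_Mapping.lookup v i) * x)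
     = Poly_Mapping.single (u + v - ?e) (of_nat (Poly_Mapping.lookup v i) * x)" for u v and x :: 'k
  proof (cases "Poly_Mapping.lookup v i = 0")
    case False
    then have "u + (v - ?e) = u + v - ?e"
      by (intro poly_mapping_eqI) (auto simp: lookup_add lookup_minus lookup_single when_def)
    then show ?thesis by simp
  qed simp
  show ?thesis
    using shift[of m n "c * d"] shift[of n m "c * d"]
    by (simp add: poly_pd_single mult_single lookup_add algebra_simps flip: single_add)
qed

lemma poly_pd_mult:
  fixes p q :: "('i \<Rightarrow>\<^sub>0 nat) \<Rightarrow>\<^sub>0 'k::field"
  shows "poly_pd i (p * q) = p * poly_pd i q + q * poly_pd i p"
proof -
  have 1: "poly_pd i (Poly_Mapping.single m c * q)
     = Poly_Mapping.single m c * poly_pd i q + poly_pd i (Poly_Mapping.single m c) * q" for m c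
    by (induction q rule: poly_mapping_single_induct)
      (simp_all add: poly_pd_zero poly_pd_add distrib_left poly_pd_mult_single)
  have "poly_pd i (p * q) = p * poly_pd i q + poly_pd i p * q"
    by (induction p rule: poly_mapping_single_induct)
      (simp_all add: poly_pd_zero poly_pd_add distrib_right 1)
  then show ?thesis by (simp add: mult.commute)
qed

lemma poly_pd_const: "poly_pd i (Poly_Mapping.single 0 c) = 0"
  by (simp add: poly_pd_single)

lemma poly_pd_one: "poly_pd i 1 = (0 :: ('i \<Rightarrow>\<^sub>0 nat) \<Rightarrow>\<^sub>0 'k::field)"
  using poly_pd_const[of i "1 :: 'k"] by simp

lemma poly_pd_var: "poly_pd i (poly_var j) = (if i = j then 1 else 0)"
  by (simp add: poly_var_def poly_pd_single lookup_single when_def)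

lemma poly_pd_closed: "p \<in> poly_carrier \<Lambda> \<Longrightarrow> poly_pd i p \<in> poly_carrier \<Lambda>"
proof -
  assume p: "p \<in> poly_carrier \<Lambda>"
  have sum: "(\<Sum>m\<in>W. g m) \<in> poly_carrier \<Lambda>" if "\<And>m. m \<in> W \<Longrightarrow> g m \<in> poly_carrier \<Lambda>" for W and g
    using that by (induction W rule: infinite_finite_induct) (simp_all add: poly_carrier_closed)
  have "Poly_Mapping.keys (m - Poly_Mapping.single i 1) \<subseteq> \<Lambda>" if "m \<in> Poly_Mapping.keys p" for m
  proof -
    have "Poly_Mapping.keys m \<subseteq> \<Lambda>" using p that by (simp add: poly_carrier_iff)
    then show ?thesis by (auto simp: in_keys_iff lookup_minus)
  qed
  then show ?thesis unfolding poly_pd_def by (intro sum poly_carrier_closed(3))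
qed

lemma poly_pd_finite: "finite {i. poly_pd i p \<noteq> 0}"
proof -
  have "{i. poly_pd i p \<noteq> 0} \<subseteq> (\<Union>m \<in> Poly_Mapping.keys p. Poly_Mapping.keys m)"
  proof
    fix i assume "i \<in> {i. poly_pd i p \<noteq> 0}"
    then obtain m where "m \<in> Poly_Mapping.keys p" "Poly_Mapping.single (m - Poly_Mapping.single i 1)
        (of_nat (Poly_Mapping.lookup m i) * Poly_Mapping.lookup p m) \<noteq> 0"
      unfolding poly_pd_def mem_Collect_eq by (rule sum.not_neutral_contains_not_neutral)
    then show "i \<in> (\<Union>m \<in> Poly_Mapping.keys p. Poly_Mapping.keys m)"
      by (auto simp: in_keys_iff intro!: bexI[of _ m] gr0I)
  qed
  then show ?thesis by (rule finite_subset) simp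
qed

section \<open>The localized polynomial algebra\<close>

locale localized_poly =
  fixes \<Lambda> :: "'i set" and S :: "(('i \<Rightarrow>\<^sub>0 nat) \<Rightarrow>\<^sub>0 'k::field) set"
  assumes S: "submonoid S (poly_alg \<Lambda> :: ('k, ('i \<Rightarrow>\<^sub>0 nat) \<Rightarrow>\<^sub>0 'k) module)"
begin

abbreviation "A \<equiv> poly_carrier \<Lambda> :: (('i \<Rightarrow>\<^sub>0 nat) \<Rightarrow>\<^sub>0 'k) set"
abbreviation "L \<equiv> loc_poly \<Lambda> S"
abbreviation "fr \<equiv> frac (poly_alg \<Lambda>) S"
abbreviation "xv \<equiv> loc_var \<Lambda> S"

lemma S_closed: "s \<in> S \<Longrightarrow> s \<in> A" "1 \<in> S" "\<lbrakk>s \<in> S; t \<in> S\<rbrakk> \<Longrightarrow> s * t \<in> S"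
  using submonoid.subset[OF S] submonoid.one_closed[OF S] submonoid.m_closed[OF S]
  by (auto simp: poly_alg_simps)

lemmas A_closed = poly_carrier_closed[where \<Lambda> = \<Lambda>] poly_pd_closed[where \<Lambda> = \<Lambda>] S_closed

lemma frac_mem:
  "a \<in> A \<Longrightarrow> s \<in> S \<Longrightarrow> (b, t) \<in> fr a s \<longleftrightarrow> b \<in> A \<and> t \<in> S \<and> (\<exists>u\<in>S. u * (t * a - s * b) = 0)"
  by (auto simp: frac_def loc_rel_def poly_alg_simps right_diff_distrib)

lemma frac_eq_iff:
  assumes "a \<in> A" "s \<in> S" "b \<in> A" "t \<in> S"
  shows "fr a s = fr b t \<longleftrightarrow> (\<exists>u\<in>S. u * (t * a - s * b) = 0)"
proof
  assume "fr a s = fr b t"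
  moreover have "(b, t) \<in> fr b t" using assms S_closed by (auto simp: frac_mem)
  ultimately show "\<exists>u\<in>S. u * (t * a - s * b) = 0" using assms by (metis frac_mem)
next
  have tr: "\<exists>u\<in>S. u * (r * a' - s' * c) = 0"
    if st: "s' \<in> S" "t' \<in> S" "r \<in> S" and "\<exists>u\<in>S. u * (t' * a' - s' * b') = 0" "\<exists>v\<in>S. v * (r * b' - t' * c) = 0"
    for a' b' c s' t' r
  proof -
    from that obtain u v where u: "u \<in> S" "u * (t' * a' - s' * b') = 0" and v: "v \<in> S" "v * (r * b' - t' * c) = 0"
      by blast
    \<comment> \<open>The middle fraction b'/t' is eliminated between the two hypotheses without
      cancelling anything, which costs the extra factor t' in the multiplier.\<close>
    have "(u * v * t') * (r * a' - s' * c)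
       = v * r * (u * (t' * a' - s' * b')) + u * s' * (v * (r * b' - t' * c))"
      by (simp add: algebra_simps)
    then have "(u * v * t') * (r * a' - s' * c) = 0" using u v by simp
    moreover have "u * v * t' \<in> S" using u v st by (intro S_closed)
    ultimately show ?thesis by (rule bexI)
  qed
  have sym: "\<exists>u\<in>S. u * (s' * b' - t' * a') = 0" if "\<exists>u\<in>S. u * (t' * a' - s' * b') = 0" for a' b' s' t'
  proof -
    from that obtain u where u: "u \<in> S" "u * (t' * a' - s' * b') = 0" by blast
    have "u * (s' * b' - t' * a') = - (u * (t' * a' - s' * b'))" by (simp add: algebra_simps)
    then have "u * (s' * b' - t' * a') = 0" using u(2) by simp
    then show ?thesis using u(1) by (rule bexI)
  qed
  assume e: "\<exists>u\<in>S. u * (t * a - s * b) = 0"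
  have "(c, r) \<in> fr a s \<longleftrightarrow> (c, r) \<in> fr b t" for c r
  proof
    assume c: "(c, r) \<in> fr a s"
    then have cr: "c \<in> A" "r \<in> S" "\<exists>u\<in>S. u * (r * a - s * c) = 0" using assms by (simp_all add: frac_mem)
    show "(c, r) \<in> fr b t"
      using tr[OF assms(4,2) cr(2) sym[OF e] cr(3)] cr assms by (simp add: frac_mem)
  next
    assume c: "(c, r) \<in> fr b t"
    then have cr: "c \<in> A" "r \<in> S" "\<exists>u\<in>S. u * (r * b - t * c) = 0" using assms by (simp_all add: frac_mem)
    show "(c, r) \<in> fr a s"
      using tr[OF assms(2,4) cr(2) e cr(3)] cr assms by (simp add: frac_mem)
  qed
  then show "fr a s = fr b t" by (simp add: set_eq_iff)
qed

lemma frac_eqI: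
  assumes "a \<in> A" "s \<in> S" "b \<in> A" "t \<in> S" "t * a = s * b"
  shows "fr a s = fr b t"
  using assms S_closed(2) by (subst frac_eq_iff) auto

lemma frac_self: "a \<in> A \<Longrightarrow> s \<in> S \<Longrightarrow> (a, s) \<in> fr a s"
  using S_closed(2) by (auto simp: frac_mem)

lemma frac_memD:
  assumes "a \<in> A" "s \<in> S" "(b, t) \<in> fr a s"
  shows "b \<in> A" "t \<in> S" "fr b t = fr a s"
  using assms frac_eq_iff[of a s b t] by (auto simp: frac_mem)

text \<open>Operations on fractions are unions over representatives. Once the value is the same for
  all of them, the union collapses to it; every well-definedness proof below takes this
  form.\<close>

lemma frac_UN:
  assumes "a \<in> A" "s \<in> S"
    and "\<And>b t. \<lbrakk>b \<in> A; t \<in> S; fr b t = fr a s\<rbrakk> \<Longrightarrow> g b t = g a s"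
  shows "(\<Union>(b, t)\<in>fr a s. g b t) = g a s"
  using frac_self[OF assms(1,2)] assms(3) frac_memD[OF assms(1,2)] by fast

lemma loc_simps:
  assumes "a \<in> A" "s \<in> S" "b \<in> A" "t \<in> S"
  shows "fr a s \<otimes>\<^bsub>L\<^esub> fr b t = fr (a * b) (s * t)"
    and "fr a s \<oplus>\<^bsub>L\<^esub> fr b t = fr (t * a + s * b) (s * t)"
proof -
  have *: "fr (a' * b') (s' * t') = fr (a * b) (s * t)" "fr (t' * a' + s' * b') (s' * t') = fr (t * a + s * b) (s * t)"
    if "a' \<in> A" "s' \<in> S" "fr a' s' = fr a s" "b' \<in> A" "t' \<in> S" "fr b' t' = fr b t" for a' b' s' t'
  proof -
    from that assms obtain u v where u: "u \<in> S" "u * (s * a' - s' * a) = 0"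
      and v: "v \<in> S" "v * (t * b' - t' * b) = 0"
      by (auto simp: frac_eq_iff)
    have "(u * v) * ((s * t) * (a' * b') - (s' * t') * (a * b))
       = (v * t * b') * (u * (s * a' - s' * a)) + (u * s' * a) * (v * (t * b' - t' * b))"
      by (simp add: algebra_simps)
    then have "(u * v) * ((s * t) * (a' * b') - (s' * t') * (a * b)) = 0" using u v by simp
    then show "fr (a' * b') (s' * t') = fr (a * b) (s * t)"
      using that assms u(1) v(1) by (subst frac_eq_iff) (auto simp: A_closed intro!: bexI[of _ "u * v"])
    have "(u * v) * ((s * t) * (t' * a' + s' * b') - (s' * t') * (t * a + s * b))
       = (v * t * t') * (u * (s * a' - s' * a)) + (u * s * s') * (v * (t * b' - t' * b))"
      by (simp add: algebra_simps)
    then have "(u * v) * ((s * t) * (t' * a' + s' * b') - (s' * t') * (t * a + s * b)) = 0" using u v by simp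
    then show "fr (t' * a' + s' * b') (s' * t') = fr (t * a + s * b) (s * t)"
      using that assms u(1) v(1) by (subst frac_eq_iff) (auto simp: A_closed intro!: bexI[of _ "u * v"])
  qed
  have inner: "(\<Union>(b', t')\<in>fr b t. fr (a' * b') (s' * t')) = fr (a * b) (s * t)"
    "(\<Union>(b', t')\<in>fr b t. fr (t' * a' + s' * b') (s' * t')) = fr (t * a + s * b) (s * t)"
    if "a' \<in> A" "s' \<in> S" "fr a' s' = fr a s" for a' s'
    using *[OF that] frac_UN[OF assms(3,4), of "\<lambda>b' t'. fr (a' * b') (s' * t')"]
      frac_UN[OF assms(3,4), of "\<lambda>b' t'. fr (t' * a' + s' * b') (s' * t')"] assms(3,4) by simp_all
  show "fr a s \<otimes>\<^bsub>L\<^esub> fr b t = fr (a * b) (s * t)"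
    using frac_UN[OF assms(1,2), of "\<lambda>a' s'. \<Union>(b', t')\<in>fr b t. fr (a' * b') (s' * t')"] inner assms
    by (simp add: loc_alg_def poly_alg_simps)
  show "fr a s \<oplus>\<^bsub>L\<^esub> fr b t = fr (t * a + s * b) (s * t)"
    using frac_UN[OF assms(1,2), of "\<lambda>a' s'. \<Union>(b', t')\<in>fr b t. fr (t' * a' + s' * b') (s' * t')"] inner assms
    by (simp add: loc_alg_def poly_alg_simps)
qed

lemma loc_smult:
  assumes "a \<in> A" "s \<in> S"
  shows "c \<odot>\<^bsub>L\<^esub> fr a s = fr (Poly_Mapping.single 0 c * a) s"
proof -
  have "fr (Poly_Mapping.single 0 c * a') s' = fr (Poly_Mapping.single 0 c * a) s"
    if a': "a' \<in> A" "s' \<in> S" "fr a' s' = fr a s" for a' s'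
  proof -
    from that assms obtain u where u: "u \<in> S" "u * (s * a' - s' * a) = 0" by (auto simp: frac_eq_iff)
    have "u * (s * (Poly_Mapping.single 0 c * a') - s' * (Poly_Mapping.single 0 c * a))
       = Poly_Mapping.single 0 c * (u * (s * a' - s' * a))" by (simp add: algebra_simps)
    then show ?thesis
      using that assms u by (subst frac_eq_iff) (auto simp: A_closed)
  qed
  then show "c \<odot>\<^bsub>L\<^esub> fr a s = fr (Poly_Mapping.single 0 c * a) s"
    using frac_UN[OF assms(1,2), of "\<lambda>a' s'. fr (Poly_Mapping.single 0 c * a') s'"]
    by (simp add: loc_alg_def poly_alg_simps)
qed

lemma loc_consts: "\<zero>\<^bsub>L\<^esub> = fr 0 1" "\<one>\<^bsub>L\<^esub> = fr 1 1"
  by (simp_all add: loc_alg_def poly_alg_simps)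

lemma frac_closed: "\<lbrakk>a \<in> A; s \<in> S\<rbrakk> \<Longrightarrow> fr a s \<in> carrier L"
  by (auto simp: loc_alg_def)

lemma loc_cases [cases set]:
  assumes "g \<in> carrier L"
  obtains a s where "a \<in> A" "s \<in> S" "g = fr a s"
  using assms by (auto simp: loc_alg_def)

lemma frac_zero: "s \<in> S \<Longrightarrow> fr 0 s = \<zero>\<^bsub>L\<^esub>"
  unfolding loc_consts by (rule frac_eqI) (auto simp: A_closed)

lemma xv_closed: "i \<in> \<Lambda> \<Longrightarrow> xv i \<in> carrier L"
  by (simp add: loc_var_def frac_closed A_closed)

lemma loc_ring_laws:
  assumes "g \<in> carrier L" "h \<in> carrier L" "k \<in> carrier L"
  shows "g \<oplus>\<^bsub>L\<^esub> h \<in> carrier L" "g \<otimes>\<^bsub>L\<^esub> h \<in> carrier L" "c \<odot>\<^bsub>L\<^esub> g \<in> carrier L"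
    and "g \<oplus>\<^bsub>L\<^esub> h = h \<oplus>\<^bsub>L\<^esub> g" "g \<otimes>\<^bsub>L\<^esub> h = h \<otimes>\<^bsub>L\<^esub> g"
    and "(g \<oplus>\<^bsub>L\<^esub> h) \<oplus>\<^bsub>L\<^esub> k = g \<oplus>\<^bsub>L\<^esub> (h \<oplus>\<^bsub>L\<^esub> k)"
    and "(g \<otimes>\<^bsub>L\<^esub> h) \<otimes>\<^bsub>L\<^esub> k = g \<otimes>\<^bsub>L\<^esub> (h \<otimes>\<^bsub>L\<^esub> k)"
    and "(g \<oplus>\<^bsub>L\<^esub> h) \<otimes>\<^bsub>L\<^esub> k = (g \<otimes>\<^bsub>L\<^esub> k) \<oplus>\<^bsub>L\<^esub> (h \<otimes>\<^bsub>L\<^esub> k)"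
    and "\<zero>\<^bsub>L\<^esub> \<oplus>\<^bsub>L\<^esub> g = g" "\<one>\<^bsub>L\<^esub> \<otimes>\<^bsub>L\<^esub> g = g" "1 \<odot>\<^bsub>L\<^esub> g = g"
    and "(c + d) \<odot>\<^bsub>L\<^esub> g = (c \<odot>\<^bsub>L\<^esub> g) \<oplus>\<^bsub>L\<^esub> (d \<odot>\<^bsub>L\<^esub> g)"
    and "c \<odot>\<^bsub>L\<^esub> (g \<oplus>\<^bsub>L\<^esub> h) = (c \<odot>\<^bsub>L\<^esub> g) \<oplus>\<^bsub>L\<^esub> (c \<odot>\<^bsub>L\<^esub> h)"
    and "(c * d) \<odot>\<^bsub>L\<^esub> g = c \<odot>\<^bsub>L\<^esub> (d \<odot>\<^bsub>L\<^esub> g)"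
    and "(c \<odot>\<^bsub>L\<^esub> g) \<otimes>\<^bsub>L\<^esub> h = c \<odot>\<^bsub>L\<^esub> (g \<otimes>\<^bsub>L\<^esub> h)"
    and "\<exists>h\<in>carrier L. h \<oplus>\<^bsub>L\<^esub> g = \<zero>\<^bsub>L\<^esub>"
proof -
  obtain a s where g: "a \<in> A" "s \<in> S" "g = fr a s" using assms(1) by (rule loc_cases)
  obtain b t where h: "b \<in> A" "t \<in> S" "h = fr b t" using assms(2) by (rule loc_cases)
  obtain e r where k: "e \<in> A" "r \<in> S" "k = fr e r" using assms(3) by (rule loc_cases)
  note eqs = g h k loc_simps loc_smult loc_consts A_closed
  have cd: "Poly_Mapping.single 0 (c * d) = Poly_Mapping.single 0 c * (Poly_Mapping.single 0 d :: ('i \<Rightarrow>\<^sub>0 nat) \<Rightarrow>\<^sub>0 'k)"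
    by (simp add: mult_single)
  show "g \<oplus>\<^bsub>L\<^esub> h \<in> carrier L" "g \<otimes>\<^bsub>L\<^esub> h \<in> carrier L" "c \<odot>\<^bsub>L\<^esub> g \<in> carrier L"
    by (simp_all add: eqs frac_closed)
  show "g \<oplus>\<^bsub>L\<^esub> h = h \<oplus>\<^bsub>L\<^esub> g" "g \<otimes>\<^bsub>L\<^esub> h = h \<otimes>\<^bsub>L\<^esub> g"
    by (simp_all add: eqs ac_simps)
  show "(g \<oplus>\<^bsub>L\<^esub> h) \<oplus>\<^bsub>L\<^esub> k = g \<oplus>\<^bsub>L\<^esub> (h \<oplus>\<^bsub>L\<^esub> k)" "(g \<otimes>\<^bsub>L\<^esub> h) \<otimes>\<^bsub>L\<^esub> k = g \<otimes>\<^bsub>L\<^esub> (h \<otimes>\<^bsub>L\<^esub> k)"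
    "\<zero>\<^bsub>L\<^esub> \<oplus>\<^bsub>L\<^esub> g = g" "\<one>\<^bsub>L\<^esub> \<otimes>\<^bsub>L\<^esub> g = g" "1 \<odot>\<^bsub>L\<^esub> g = g"
    "(c * d) \<odot>\<^bsub>L\<^esub> g = c \<odot>\<^bsub>L\<^esub> (d \<odot>\<^bsub>L\<^esub> g)" "(c \<odot>\<^bsub>L\<^esub> g) \<otimes>\<^bsub>L\<^esub> h = c \<odot>\<^bsub>L\<^esub> (g \<otimes>\<^bsub>L\<^esub> h)"
    by (simp_all add: eqs cd, simp_all add: algebra_simps)
  show "c \<odot>\<^bsub>L\<^esub> (g \<oplus>\<^bsub>L\<^esub> h) = (c \<odot>\<^bsub>L\<^esub> g) \<oplus>\<^bsub>L\<^esub> (c \<odot>\<^bsub>L\<^esub> h)"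
    by (simp add: eqs, simp add: algebra_simps)
  \<comment> \<open>In these two laws the sides come out with different denominators, so they have
    to be cross-multiplied.\<close>
  show "(g \<oplus>\<^bsub>L\<^esub> h) \<otimes>\<^bsub>L\<^esub> k = (g \<otimes>\<^bsub>L\<^esub> k) \<oplus>\<^bsub>L\<^esub> (h \<otimes>\<^bsub>L\<^esub> k)"
    "(c + d) \<odot>\<^bsub>L\<^esub> g = (c \<odot>\<^bsub>L\<^esub> g) \<oplus>\<^bsub>L\<^esub> (d \<odot>\<^bsub>L\<^esub> g)"
    by (simp_all add: eqs)
      ((rule frac_eqI; simp add: g h k A_closed single_add algebra_simps)+)
  have m: "- a \<in> A" using poly_carrier_closed(7)[OF poly_carrier_closed(1) g(1)] by simp
  have "fr (- a) s \<oplus>\<^bsub>L\<^esub> g = \<zero>\<^bsub>L\<^esub>"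
    using g m by (simp add: loc_simps A_closed frac_zero)
  then show "\<exists>h\<in>carrier L. h \<oplus>\<^bsub>L\<^esub> g = \<zero>\<^bsub>L\<^esub>" using g(2) frac_closed[OF m] by blast
qed

lemma loc_cring: "cring L"
proof (rule cringI)
  have c: "\<zero>\<^bsub>L\<^esub> \<in> carrier L" "\<one>\<^bsub>L\<^esub> \<in> carrier L" by (simp_all add: loc_consts frac_closed A_closed)
  show "abelian_group L"
    by (rule abelian_groupI) (rule c loc_ring_laws(1,4,6,9,16); assumption)+
  show "comm_monoid L"
    by (rule comm_monoidI) (rule c loc_ring_laws(2,5,7,10); assumption)+
qed (rule loc_ring_laws(8); assumption)

lemma loc_assoc_algebra: "assoc_algebra L"
proof -
  interpret L: cring L by (rule loc_cring)
  have "module KR L"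
    by (rule moduleI; (unfold K_simps)?)
      (rule L.is_abelian_group cring_from_type_algebra loc_ring_laws(3,11-14); assumption)+
  moreover have "g \<otimes>\<^bsub>L\<^esub> (c \<odot>\<^bsub>L\<^esub> h) = c \<odot>\<^bsub>L\<^esub> (g \<otimes>\<^bsub>L\<^esub> h)" if "g \<in> carrier L" "h \<in> carrier L" for c g h
    using loc_ring_laws(15)[OF that(2,1,1), of c] that loc_ring_laws(3)[OF that(2,2,2), of c] by (simp add: L.m_comm)
  ultimately show ?thesis
    by (intro assoc_algebra.intro assoc_algebra_axioms.intro L.ring_axioms)
      (rule loc_ring_laws(15), assumption+ | simp)+
qed

sublocale L: assoc_algebra L by (rule loc_assoc_algebra)
sublocale L: cring L by (rule loc_cring)

section \<open>Partial derivatives on the localization and the induction principle\<close>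

lemma loc_pd_frac:
  assumes "a \<in> A" "s \<in> S"
  shows "loc_pd \<Lambda> S i (fr a s) = fr (s * poly_pd i a - a * poly_pd i s) (s * s)"
  unfolding loc_pd_def
proof (rule frac_UN[OF assms])
  fix b t assume b: "b \<in> A" "t \<in> S" "fr b t = fr a s"
  then obtain u where u: "u \<in> S" "u * (s * b - t * a) = 0"
    using assms by (auto simp: frac_eq_iff)
  define e where "e = s * b - t * a"
  have ue: "u * e = 0" using u by (simp add: e_def)
  have pue: "u * poly_pd i e + e * poly_pd i u = 0"
    using ue by (simp add: poly_pd_zero flip: poly_pd_mult)
  \<comment> \<open>Differentiating u e = 0 leaves the stray term e times the derivative of u; one
    more factor u kills it. Hence the multiplier u * u in the comparison of the two quotient
    rules.\<close>
  have "u * u * poly_pd i e = u * (u * poly_pd i e + e * poly_pd i u) - poly_pd i u * (u * e)"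
    by (simp add: algebra_simps)
  then have ue': "u * u * poly_pd i e = 0" by (simp add: ue pue)
  have pe: "poly_pd i e = s * poly_pd i b + b * poly_pd i s - (t * poly_pd i a + a * poly_pd i t)"
  proof -
    have "poly_pd i (e + t * a) = poly_pd i (s * b)" by (simp add: e_def)
    then show ?thesis unfolding poly_pd_add poly_pd_mult by (simp add: algebra_simps)
  qed
  have "(s * s) * (t * poly_pd i b - b * poly_pd i t) - (t * t) * (s * poly_pd i a - a * poly_pd i s)
    = s * t * poly_pd i e - (t * poly_pd i s + s * poly_pd i t) * e"
    unfolding pe by (simp add: e_def algebra_simps)
  then have "(u * u) * ((s * s) * (t * poly_pd i b - b * poly_pd i t) - (t * t) * (s * poly_pd i a - a * poly_pd i s))
    = (u * u) * (s * t * poly_pd i e - (t * poly_pd i s + s * poly_pd i t) * e)" by (simp only:)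
  also have "\<dots> = s * t * (u * u * poly_pd i e) - (t * poly_pd i s + s * poly_pd i t) * u * (u * e)"
    by (simp add: algebra_simps)
  also have "\<dots> = 0" by (simp add: ue ue')
  finally show "fr (t * poly_pd i b - b * poly_pd i t) (t * t) = fr (s * poly_pd i a - a * poly_pd i s) (s * s)"
    using assms b u(1) by (subst frac_eq_iff) (auto simp: A_closed)
qed

lemma loc_pd_closed: "g \<in> carrier L \<Longrightarrow> loc_pd \<Lambda> S i g \<in> carrier L"
  by (auto elim!: loc_cases simp: loc_pd_frac A_closed intro!: frac_closed)

lemma loc_pd_xv: "j \<in> \<Lambda> \<Longrightarrow> loc_pd \<Lambda> S i (xv j) = (if i = j then \<one>\<^bsub>L\<^esub> else \<zero>\<^bsub>L\<^esub>)"
  by (simp add: loc_var_def loc_pd_frac A_closed poly_pd_var poly_pd_one loc_consts)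

lemma loc_pd_derivation:
  assumes "g \<in> carrier L" "h \<in> carrier L"
  shows "loc_pd \<Lambda> S i (g \<oplus>\<^bsub>L\<^esub> h) = loc_pd \<Lambda> S i g \<oplus>\<^bsub>L\<^esub> loc_pd \<Lambda> S i h"
    and "loc_pd \<Lambda> S i (g \<otimes>\<^bsub>L\<^esub> h) = (g \<otimes>\<^bsub>L\<^esub> loc_pd \<Lambda> S i h) \<oplus>\<^bsub>L\<^esub> (h \<otimes>\<^bsub>L\<^esub> loc_pd \<Lambda> S i g)"
    and "loc_pd \<Lambda> S i (c \<odot>\<^bsub>L\<^esub> g) = c \<odot>\<^bsub>L\<^esub> loc_pd \<Lambda> S i g"
proof -
  obtain a s where g: "a \<in> A" "s \<in> S" "g = fr a s" using assms(1) by (rule loc_cases)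
  obtain b t where h: "b \<in> A" "t \<in> S" "h = fr b t" using assms(2) by (rule loc_cases)
  note eqs = g h loc_pd_frac loc_simps loc_smult A_closed
  show "loc_pd \<Lambda> S i (g \<oplus>\<^bsub>L\<^esub> h) = loc_pd \<Lambda> S i g \<oplus>\<^bsub>L\<^esub> loc_pd \<Lambda> S i h"
    by (simp add: eqs)
      (rule frac_eqI; simp add: g h A_closed poly_pd_add poly_pd_mult algebra_simps)
  show "loc_pd \<Lambda> S i (g \<otimes>\<^bsub>L\<^esub> h) = (g \<otimes>\<^bsub>L\<^esub> loc_pd \<Lambda> S i h) \<oplus>\<^bsub>L\<^esub> (h \<otimes>\<^bsub>L\<^esub> loc_pd \<Lambda> S i g)"
    by (simp add: eqs)
      (rule frac_eqI; simp add: g h A_closed poly_pd_add poly_pd_mult algebra_simps)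
  show "loc_pd \<Lambda> S i (c \<odot>\<^bsub>L\<^esub> g) = c \<odot>\<^bsub>L\<^esub> loc_pd \<Lambda> S i g"
    by (simp add: eqs poly_pd_mult poly_pd_const algebra_simps)
qed

lemma loc_pd_finite: "g \<in> carrier L \<Longrightarrow> finite {i \<in> \<Lambda>. loc_pd \<Lambda> S i g \<noteq> \<zero>\<^bsub>L\<^esub>}"
proof -
  assume "g \<in> carrier L"
  then obtain a s where g: "a \<in> A" "s \<in> S" "g = fr a s" by (rule loc_cases)
  have "{i \<in> \<Lambda>. loc_pd \<Lambda> S i g \<noteq> \<zero>\<^bsub>L\<^esub>} \<subseteq> {i. poly_pd i a \<noteq> 0} \<union> {i. poly_pd i s \<noteq> 0}"
    using g by (auto simp: loc_pd_frac frac_zero A_closed)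
  then show ?thesis by (rule finite_subset) (simp add: poly_pd_finite)
qed

text \<open>Case \<open>inv\<close> expresses division without mentioning fractions: a/s is reached
  with h = s/1, for which both h and h times a/s are polynomials.\<close>

lemma loc_induct [consumes 1, case_names const var add mult inv]:
  assumes g: "g \<in> carrier L"
    and const: "\<And>c. Q (c \<odot>\<^bsub>L\<^esub> \<one>\<^bsub>L\<^esub>)" and var: "\<And>i. i \<in> \<Lambda> \<Longrightarrow> Q (xv i)"
    and add: "\<And>g h. \<lbrakk>g \<in> carrier L; h \<in> carrier L; Q g; Q h\<rbrakk> \<Longrightarrow> Q (g \<oplus>\<^bsub>L\<^esub> h)"
    and mult: "\<And>g h. \<lbrakk>g \<in> carrier L; h \<in> carrier L; Q g; Q h\<rbrakk> \<Longrightarrow> Q (g \<otimes>\<^bsub>L\<^esub> h)"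
    and inv: "\<And>g h k. \<lbrakk>g \<in> carrier L; h \<in> carrier L; k \<in> carrier L; h \<otimes>\<^bsub>L\<^esub> k = \<one>\<^bsub>L\<^esub>;
      Q (h \<otimes>\<^bsub>L\<^esub> g); Q h\<rbrakk> \<Longrightarrow> Q g"
  shows "Q g"
proof -
  have poly: "Q (fr p 1)" if "p \<in> A" for p
    using that
  proof (induction p rule: poly_alg_induct)
    case (const c)
    then show ?case using assms(2)[of c] by (simp add: loc_consts loc_smult A_closed)
  next
    case (var i)
    then show ?case using assms(3)[of i] by (simp add: loc_var_def)
  next
    case (add p q)
    then show ?case using assms(4)[of "fr p 1" "fr q 1"] by (simp add: frac_closed loc_simps A_closed)
  next
    case (mult p q)
    then show ?case using assms(5)[of "fr p 1" "fr q 1"] by (simp add: frac_closed loc_simps A_closed)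
  qed
  from g obtain a s where as: "a \<in> A" "s \<in> S" "g = fr a s" by (rule loc_cases)
  have e: "fr (s * a) s = fr a 1" "fr s s = fr 1 1"
    by (rule frac_eqI; simp add: A_closed as)+
  have "fr s 1 \<otimes>\<^bsub>L\<^esub> g = fr a 1" "fr s 1 \<otimes>\<^bsub>L\<^esub> fr 1 s = \<one>\<^bsub>L\<^esub>"
    using as e by (simp_all add: loc_simps loc_consts A_closed)
  then show ?thesis
    using inv[of g "fr s 1" "fr 1 s"] poly[of a] poly[of s] as by (simp add: frac_closed A_closed)
qed

end

section \<open>Derivations of the localized polynomial algebra\<close>

lemma alg_hom_finsum:
  assumes "ring A" "ring B" "h \<in> alg_hom A B" "f \<in> J \<rightarrow> carrier A" "finite J"
  shows "h (\<Oplus>\<^bsub>A\<^esub>i\<in>J. f i) = (\<Oplus>\<^bsub>B\<^esub>i\<in>J. h (f i))"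
proof -
  interpret A: ring A by fact
  interpret B: ring B by fact
  interpret H: ring_hom_ring A B h
    using assms(1-3) by (auto intro!: ring_hom_ringI2 simp: alg_hom_def)
  show ?thesis using assms(5,4)
    by (induction J rule: finite_induct) (auto simp: Pi_iff A.finsum_closed)
qed

lemma (in ring) commutator_mult_right:
  assumes "x \<in> carrier R" "y \<in> carrier R" "z \<in> carrier R"
  shows "commutator R z (x \<otimes> y) = (commutator R z x \<otimes> y) \<oplus> (x \<otimes> commutator R z y)"
proof -
  have "\<ominus> (x \<otimes> (z \<otimes> y)) \<oplus> ((x \<otimes> (z \<otimes> y)) \<oplus> (\<ominus> (x \<otimes> (y \<otimes> z)))) = \<ominus> (x \<otimes> (y \<otimes> z))"
    using assms by (simp add: r_neg1)
  then show ?thesis using assms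
    by (simp add: commutator_def l_distr r_distr minus_eq m_assoc l_minus r_minus a_assoc)
qed

lemma (in ring) commutator_antisym:
  "\<lbrakk>x \<in> carrier R; y \<in> carrier R\<rbrakk> \<Longrightarrow> commutator R y x = \<ominus> commutator R x y"
  by (simp add: commutator_def minus_eq minus_add a_comm)

lemma (in ring) commutator_add_right:
  "\<lbrakk>x \<in> carrier R; y \<in> carrier R; z \<in> carrier R\<rbrakk> \<Longrightarrow>
   commutator R z (x \<oplus> y) = commutator R z x \<oplus> commutator R z y"
  by (simp add: commutator_def l_distr r_distr minus_eq minus_add a_ac)

lemma (in assoc_algebra) smult_uminus: "x \<in> carrier A \<Longrightarrow> c \<odot> (\<ominus> x) = \<ominus> (c \<odot> x)"
  using smult_simps(2)[of "\<ominus> x" x c] smult_simps(6)[of c]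
  by (intro minus_equality[symmetric]) (simp_all add: l_neg)

lemma (in assoc_algebra) commutator_smult_right:
  "\<lbrakk>x \<in> carrier A; y \<in> carrier A\<rbrakk> \<Longrightarrow> commutator A x (c \<odot> y) = c \<odot> commutator A x y"
  using commutator_antisym[of y x] commutator_antisym[of "c \<odot> y" x]
  by (simp add: commutator_smult_left smult_uminus commutator_closed ring_axioms)

context localized_poly
begin

text \<open>
  The first argument of the product rule is left unspecified, so as to cover derivations into
  bimodules as well as the inhomogeneous rules satisfied by brackets.
\<close>
definition twisted_derivation ::
  "('k, 'v, 'n) module_scheme \<Rightarrow> (('k, 'i) poly_frac \<Rightarrow> 'v) \<Rightarrow>
   (('k, 'i) poly_frac \<Rightarrow> ('k, 'i) poly_frac \<Rightarrow> 'v \<Rightarrow> 'v) \<Rightarrow> (('k, 'i) poly_frac \<Rightarrow> 'v) \<Rightarrow> bool" where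
  "twisted_derivation V \<theta> r D \<longleftrightarrow>
     (\<forall>g \<in> carrier L. D g \<in> carrier V) \<and>
     (\<forall>g \<in> carrier L. \<forall>h \<in> carrier L. D (g \<oplus>\<^bsub>L\<^esub> h) = D g \<oplus>\<^bsub>V\<^esub> D h) \<and>
     (\<forall>c. \<forall>g \<in> carrier L. D (c \<odot>\<^bsub>L\<^esub> g) = c \<odot>\<^bsub>V\<^esub> D g) \<and>
     (\<forall>g \<in> carrier L. \<forall>h \<in> carrier L. D (g \<otimes>\<^bsub>L\<^esub> h) = r g h (D g) \<oplus>\<^bsub>V\<^esub> (\<theta> g \<otimes>\<^bsub>V\<^esub> D h))"

text \<open>In the inverse case the product rule for h g has the same first summand for D and D',
  because they agree on h. It cancels, and \<theta> k, a left inverse of \<theta> h, removes the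
  remaining factor. Equality at 1 is a hypothesis because a general \<open>r\<close> does not fix
  that value.\<close>

lemma twisted_derivation_unique:
  assumes V: "assoc_algebra V" and \<theta>: "\<theta> \<in> alg_hom L V"
    and D: "twisted_derivation V \<theta> r D" and D': "twisted_derivation V \<theta> r D'"
    and r: "\<And>g h x. \<lbrakk>g \<in> carrier L; h \<in> carrier L; x \<in> carrier V\<rbrakk> \<Longrightarrow> r g h x \<in> carrier V"
    and one: "D \<one>\<^bsub>L\<^esub> = D' \<one>\<^bsub>L\<^esub>" and var: "\<And>i. i \<in> \<Lambda> \<Longrightarrow> D (xv i) = D' (xv i)"
    and g: "g \<in> carrier L"
  shows "D g = D' g"
proof -
  interpret V: assoc_algebra V by (rule V)
  note DD = D[unfolded twisted_derivation_def] D'[unfolded twisted_derivation_def]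
  note \<theta>' = alg_homD[OF \<theta>]
  show ?thesis using g
  proof (induction g rule: loc_induct)
    case (const c)
    then show ?case using DD one by simp
  next
    case (var i)
    then show ?case by (rule assms(7))
  next
    case (add g h)
    then show ?case using DD by simp
  next
    case (mult g h)
    then show ?case using DD by simp
  next
    case (inv g h k)
    have Dc: "D g \<in> carrier V" "D' g \<in> carrier V" "D h \<in> carrier V" using DD inv by auto
    have "r h g (D h) \<oplus>\<^bsub>V\<^esub> (\<theta> h \<otimes>\<^bsub>V\<^esub> D g) = r h g (D h) \<oplus>\<^bsub>V\<^esub> (\<theta> h \<otimes>\<^bsub>V\<^esub> D' g)"
      using inv DD by metis
    then have e: "\<theta> h \<otimes>\<^bsub>V\<^esub> D g = \<theta> h \<otimes>\<^bsub>V\<^esub> D' g"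
      using inv Dc \<theta>'(1) r by simp
    have "\<theta> k \<otimes>\<^bsub>V\<^esub> \<theta> h = \<one>\<^bsub>V\<^esub>"
      using inv \<theta>'(2)[of k h] \<theta>'(4) L.m_comm[of k h] by simp
    then show ?case
      using e Dc \<theta>'(1) inv by (metis V.l_one V.m_assoc)
  qed
qed

text \<open>With \<theta> on the left in both terms, \<open>V\<close> is regarded as a left module
  over the commutative algebra \<open>L\<close>; this is the shape of the product rule for
  \<beta>.\<close>

abbreviation left_derivation ::
  "('k, 'v, 'n) module_scheme \<Rightarrow> (('k, 'i) poly_frac \<Rightarrow> 'v) \<Rightarrow> (('k, 'i) poly_frac \<Rightarrow> 'v) \<Rightarrow> bool" where
  "left_derivation V \<theta> D \<equiv> twisted_derivation V \<theta> (\<lambda>g h x. \<theta> h \<otimes>\<^bsub>V\<^esub> x) D"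

lemma left_derivation_one:
  assumes V: "assoc_algebra V" and \<theta>: "\<theta> \<in> alg_hom L V" and D: "left_derivation V \<theta> D"
  shows "D \<one>\<^bsub>L\<^esub> = \<zero>\<^bsub>V\<^esub>"
proof -
  interpret V: assoc_algebra V by (rule V)
  note D = D[unfolded twisted_derivation_def]
  have c: "D \<one>\<^bsub>L\<^esub> \<in> carrier V" using D by simp
  have "D (\<one>\<^bsub>L\<^esub> \<otimes>\<^bsub>L\<^esub> \<one>\<^bsub>L\<^esub>) = (\<theta> \<one>\<^bsub>L\<^esub> \<otimes>\<^bsub>V\<^esub> D \<one>\<^bsub>L\<^esub>) \<oplus>\<^bsub>V\<^esub> (\<theta> \<one>\<^bsub>L\<^esub> \<otimes>\<^bsub>V\<^esub> D \<one>\<^bsub>L\<^esub>)"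
    using D by blast
  then have "D \<one>\<^bsub>L\<^esub> = D \<one>\<^bsub>L\<^esub> \<oplus>\<^bsub>V\<^esub> D \<one>\<^bsub>L\<^esub>" using c by (simp add: alg_homD(4)[OF \<theta>])
  then show ?thesis using c by (metis V.add.l_cancel_one)
qed

lemma left_derivation_unique:
  assumes V: "assoc_algebra V" and \<theta>: "\<theta> \<in> alg_hom L V"
    and D: "left_derivation V \<theta> D" and D': "left_derivation V \<theta> D'"
    and var: "\<And>i. i \<in> \<Lambda> \<Longrightarrow> D (xv i) = D' (xv i)" and g: "g \<in> carrier L"
  shows "D g = D' g"
proof -
  interpret V: assoc_algebra V by (rule V)
  show ?thesis
    by (rule twisted_derivation_unique[OF V \<theta> D D' _ _ var g])
      (simp_all add: alg_homD(1)[OF \<theta>] left_derivation_one[OF V \<theta> D] left_derivation_one[OF V \<theta> D'])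
qed

section \<open>The derivation with prescribed values on the variables\<close>

context
  fixes V :: "('k, 'v, 'n) module_scheme" and \<iota> :: "'p \<Rightarrow> 'v" and q :: "('k, 'i) poly_frac \<Rightarrow> 'p" and y :: "'i \<Rightarrow> 'v"
  assumes V: "assoc_algebra V" and \<theta>: "(\<lambda>g. \<iota> (q g)) \<in> alg_hom L V"
    and y: "\<And>i. i \<in> \<Lambda> \<Longrightarrow> y i \<in> carrier V"
begin

interpretation V: assoc_algebra V by (rule V)

text \<open>The index set in \<open>pd_sum\<close> changes with the element that is differentiated.
  Comparing the sums for g, h, g + h and g h requires one common finite set.\<close>

lemma pd_sum_superset:
  assumes g: "g \<in> carrier L" and J: "finite J" "J \<subseteq> \<Lambda>" "{i \<in> \<Lambda>. loc_pd \<Lambda> S i g \<noteq> \<zero>\<^bsub>L\<^esub>} \<subseteq> J"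
  shows "pd_sum V \<iota> y \<Lambda> S q g = (\<Oplus>\<^bsub>V\<^esub>i\<in>J. \<iota> (q (loc_pd \<Lambda> S i g)) \<otimes>\<^bsub>V\<^esub> y i)"
  unfolding pd_sum_def
proof (rule V.add.finprod_mono_neutral_cong_left[OF J(1,3)])
  have "\<iota> (q \<zero>\<^bsub>L\<^esub>) = \<zero>\<^bsub>V\<^esub>"
    using alg_homD(5)[OF \<theta> L.zero_closed, of 0] alg_homD(1)[OF \<theta> L.zero_closed]
    by (simp add: L.smult_simps V.smult_simps)
  then show "\<iota> (q (loc_pd \<Lambda> S i g)) \<otimes>\<^bsub>V\<^esub> y i = \<zero>\<^bsub>V\<^esub>"
    if "i \<in> J - {i \<in> \<Lambda>. loc_pd \<Lambda> S i g \<noteq> \<zero>\<^bsub>L\<^esub>}" for i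
    using that J(2) y[of i] by auto
  show "(\<lambda>i. \<iota> (q (loc_pd \<Lambda> S i g)) \<otimes>\<^bsub>V\<^esub> y i) \<in> J \<rightarrow> carrier V"
    using J(2) y g by (auto simp: alg_homD(1)[OF \<theta>] loc_pd_closed)
qed simp

lemma pd_sum_derivation: "left_derivation V (\<lambda>g. \<iota> (q g)) (pd_sum V \<iota> y \<Lambda> S q)"
  unfolding twisted_derivation_def
proof (intro conjI ballI allI)
  fix g h c assume gh: "g \<in> carrier L" "h \<in> carrier L"
  note t = alg_homD[OF \<theta>]
  let ?s = "\<lambda>g. {i \<in> \<Lambda>. loc_pd \<Lambda> S i g \<noteq> \<zero>\<^bsub>L\<^esub>}"
  obtain J where J: "finite J" "J \<subseteq> \<Lambda>"
    and sub: "?s g \<subseteq> J" "?s h \<subseteq> J" "?s (g \<oplus>\<^bsub>L\<^esub> h) \<subseteq> J" "?s (c \<odot>\<^bsub>L\<^esub> g) \<subseteq> J" "?s (g \<otimes>\<^bsub>L\<^esub> h) \<subseteq> J"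
    by (rule that[of "?s g \<union> ?s h \<union> ?s (g \<oplus>\<^bsub>L\<^esub> h) \<union> ?s (c \<odot>\<^bsub>L\<^esub> g) \<union> ?s (g \<otimes>\<^bsub>L\<^esub> h)"])
      (use gh in \<open>simp_all add: loc_pd_finite, blast+\<close>)
  have yJ: "y i \<in> carrier V" if "i \<in> J" for i using that J(2) y by blast
  have sup: "pd_sum V \<iota> y \<Lambda> S q k = (\<Oplus>\<^bsub>V\<^esub>i\<in>J. \<iota> (q (loc_pd \<Lambda> S i k)) \<otimes>\<^bsub>V\<^esub> y i)"
    if "k \<in> carrier L" "?s k \<subseteq> J" for k
    by (rule pd_sum_superset[OF that(1) J that(2)])
  have s: "pd_sum V \<iota> y \<Lambda> S q g = (\<Oplus>\<^bsub>V\<^esub>i\<in>J. \<iota> (q (loc_pd \<Lambda> S i g)) \<otimes>\<^bsub>V\<^esub> y i)"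
    "pd_sum V \<iota> y \<Lambda> S q h = (\<Oplus>\<^bsub>V\<^esub>i\<in>J. \<iota> (q (loc_pd \<Lambda> S i h)) \<otimes>\<^bsub>V\<^esub> y i)"
    "pd_sum V \<iota> y \<Lambda> S q (g \<oplus>\<^bsub>L\<^esub> h) = (\<Oplus>\<^bsub>V\<^esub>i\<in>J. \<iota> (q (loc_pd \<Lambda> S i (g \<oplus>\<^bsub>L\<^esub> h))) \<otimes>\<^bsub>V\<^esub> y i)"
    "pd_sum V \<iota> y \<Lambda> S q (c \<odot>\<^bsub>L\<^esub> g) = (\<Oplus>\<^bsub>V\<^esub>i\<in>J. \<iota> (q (loc_pd \<Lambda> S i (c \<odot>\<^bsub>L\<^esub> g))) \<otimes>\<^bsub>V\<^esub> y i)"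
    "pd_sum V \<iota> y \<Lambda> S q (g \<otimes>\<^bsub>L\<^esub> h) = (\<Oplus>\<^bsub>V\<^esub>i\<in>J. \<iota> (q (loc_pd \<Lambda> S i (g \<otimes>\<^bsub>L\<^esub> h))) \<otimes>\<^bsub>V\<^esub> y i)"
    using gh sub by (simp_all add: sup)
  have summand: "\<iota> (q (loc_pd \<Lambda> S i k)) \<otimes>\<^bsub>V\<^esub> y i \<in> carrier V" if "i \<in> J" "k \<in> carrier L" for i k
    using that(2) yJ[OF that(1)] by (simp add: t(1) loc_pd_closed)
  have fin: "\<And>k. k \<in> carrier L \<Longrightarrow> (\<lambda>i. \<iota> (q (loc_pd \<Lambda> S i k)) \<otimes>\<^bsub>V\<^esub> y i) \<in> J \<rightarrow> carrier V"
    using summand by blast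
  show "pd_sum V \<iota> y \<Lambda> S q g \<in> carrier V"
    unfolding s(1) by (rule V.finsum_closed[OF fin[OF gh(1)]])
  show "pd_sum V \<iota> y \<Lambda> S q (g \<oplus>\<^bsub>L\<^esub> h) = pd_sum V \<iota> y \<Lambda> S q g \<oplus>\<^bsub>V\<^esub> pd_sum V \<iota> y \<Lambda> S q h"
    unfolding s(1-3) V.finsum_addf[OF fin[OF gh(1)] fin[OF gh(2)], symmetric]
  proof (rule V.finsum_cong'[OF refl])
    show "\<iota> (q (loc_pd \<Lambda> S i (g \<oplus>\<^bsub>L\<^esub> h))) \<otimes>\<^bsub>V\<^esub> y i =
      (\<iota> (q (loc_pd \<Lambda> S i g)) \<otimes>\<^bsub>V\<^esub> y i) \<oplus>\<^bsub>V\<^esub> (\<iota> (q (loc_pd \<Lambda> S i h)) \<otimes>\<^bsub>V\<^esub> y i)" if "i \<in> J" for i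
      using yJ[OF that] gh by (simp add: loc_pd_derivation(1) t(1,3) loc_pd_closed V.l_distr)
  qed (use summand gh in auto)
  have mul: "x \<otimes>\<^bsub>V\<^esub> (\<Oplus>\<^bsub>V\<^esub>i\<in>J. \<iota> (q (loc_pd \<Lambda> S i k)) \<otimes>\<^bsub>V\<^esub> y i)
    = (\<Oplus>\<^bsub>V\<^esub>i\<in>J. x \<otimes>\<^bsub>V\<^esub> (\<iota> (q (loc_pd \<Lambda> S i k)) \<otimes>\<^bsub>V\<^esub> y i))" if "x \<in> carrier V" "k \<in> carrier L" for x k
    by (rule V.finsum_rdistr[OF J(1) that(1) fin[OF that(2)]])
  have fin2: "\<And>x k. x \<in> carrier V \<Longrightarrow> k \<in> carrier L \<Longrightarrow>
     (\<lambda>i. x \<otimes>\<^bsub>V\<^esub> (\<iota> (q (loc_pd \<Lambda> S i k)) \<otimes>\<^bsub>V\<^esub> y i)) \<in> J \<rightarrow> carrier V"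
    using summand by blast
  have tg: "\<iota> (q g) \<in> carrier V" "\<iota> (q h) \<in> carrier V" using gh by (simp_all add: t(1))
  show "pd_sum V \<iota> y \<Lambda> S q (g \<otimes>\<^bsub>L\<^esub> h) =
    (\<iota> (q h) \<otimes>\<^bsub>V\<^esub> pd_sum V \<iota> y \<Lambda> S q g) \<oplus>\<^bsub>V\<^esub> (\<iota> (q g) \<otimes>\<^bsub>V\<^esub> pd_sum V \<iota> y \<Lambda> S q h)"
    unfolding s(1,2,5) mul[OF tg(1) gh(2)] mul[OF tg(2) gh(1)]
      V.finsum_addf[OF fin2[OF tg(2) gh(1)] fin2[OF tg(1) gh(2)], symmetric]
  proof (rule V.finsum_cong'[OF refl])
    show "\<iota> (q (loc_pd \<Lambda> S i (g \<otimes>\<^bsub>L\<^esub> h))) \<otimes>\<^bsub>V\<^esub> y i =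
      (\<iota> (q h) \<otimes>\<^bsub>V\<^esub> (\<iota> (q (loc_pd \<Lambda> S i g)) \<otimes>\<^bsub>V\<^esub> y i))
      \<oplus>\<^bsub>V\<^esub> (\<iota> (q g) \<otimes>\<^bsub>V\<^esub> (\<iota> (q (loc_pd \<Lambda> S i h)) \<otimes>\<^bsub>V\<^esub> y i))" if "i \<in> J" for i
      using yJ[OF that] gh tg
      by (simp add: loc_pd_derivation(2) t(1-3) loc_pd_closed V.l_distr V.m_assoc V.a_comm)
  qed (use summand gh tg in auto)
  \<comment> \<open>Scalars are rewritten as left multiplications, so that distributivity over
    finite sums also covers the scalar rule.\<close>
  have one: "c \<odot>\<^bsub>V\<^esub> v = (c \<odot>\<^bsub>V\<^esub> \<one>\<^bsub>V\<^esub>) \<otimes>\<^bsub>V\<^esub> v" if "v \<in> carrier V" for v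
    using that by (simp add: V.smult_mult_left)
  show "pd_sum V \<iota> y \<Lambda> S q (c \<odot>\<^bsub>L\<^esub> g) = c \<odot>\<^bsub>V\<^esub> pd_sum V \<iota> y \<Lambda> S q g"
    unfolding s(1,4) one[OF V.finsum_closed[OF fin[OF gh(1)]]] mul[OF V.smult_closed'[OF V.one_closed] gh(1)]
  proof (rule V.finsum_cong'[OF refl])
    show "\<iota> (q (loc_pd \<Lambda> S i (c \<odot>\<^bsub>L\<^esub> g))) \<otimes>\<^bsub>V\<^esub> y i =
      (c \<odot>\<^bsub>V\<^esub> \<one>\<^bsub>V\<^esub>) \<otimes>\<^bsub>V\<^esub> (\<iota> (q (loc_pd \<Lambda> S i g)) \<otimes>\<^bsub>V\<^esub> y i)" if "i \<in> J" for i
      using yJ[OF that] gh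
      by (simp add: loc_pd_derivation(3)[OF gh] t(1,5) loc_pd_closed V.smult_mult_left)
  qed (use summand gh in auto)
qed

lemma pd_sum_xv: "j \<in> \<Lambda> \<Longrightarrow> pd_sum V \<iota> y \<Lambda> S q (xv j) = y j"
proof -
  assume j: "j \<in> \<Lambda>"
  have "pd_sum V \<iota> y \<Lambda> S q (xv j) = (\<Oplus>\<^bsub>V\<^esub>i\<in>{j}. \<iota> (q (loc_pd \<Lambda> S i (xv j))) \<otimes>\<^bsub>V\<^esub> y i)"
    using j by (intro pd_sum_superset xv_closed) (auto simp: loc_pd_xv)
  also have "\<dots> = y j"
    using j y alg_homD(4)[OF \<theta>] by (simp add: loc_pd_xv alg_homD(1)[OF \<theta>])
  finally show ?thesis .
qed

end

text \<open>The index set depends on g but not on the ring, so a homomorphism can be applied summand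
  by summand. This carries relations written in a free algebra into its quotients and
  targets.\<close>

lemma pd_sum_hom:
  assumes "ring F" "ring V" "h \<in> alg_hom F V" "g \<in> carrier L"
    and "\<And>g. g \<in> carrier L \<Longrightarrow> \<iota> (q g) \<in> carrier F" "\<And>i. i \<in> \<Lambda> \<Longrightarrow> y i \<in> carrier F"
  shows "h (pd_sum F \<iota> y \<Lambda> S q g) = pd_sum V (\<lambda>a. h (\<iota> a)) (\<lambda>i. h (y i)) \<Lambda> S q g"
proof -
  interpret F: ring F by fact
  interpret V: ring V by fact
  note h = alg_homD[OF assms(3)]
  have "h (pd_sum F \<iota> y \<Lambda> S q g)
      = (\<Oplus>\<^bsub>V\<^esub>i\<in>{i \<in> \<Lambda>. loc_pd \<Lambda> S i g \<noteq> \<zero>\<^bsub>L\<^esub>}. h (\<iota> (q (loc_pd \<Lambda> S i g)) \<otimes>\<^bsub>F\<^esub> y i))"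
    unfolding pd_sum_def
    by (rule alg_hom_finsum[OF assms(1-3) _ loc_pd_finite[OF assms(4)]])
      (use assms(4-6) in \<open>auto simp: loc_pd_closed\<close>)
  also have "\<dots> = pd_sum V (\<lambda>a. h (\<iota> a)) (\<lambda>i. h (y i)) \<Lambda> S q g"
    unfolding pd_sum_def
    by (rule V.finsum_cong'[OF refl]) (use assms(4-6) in \<open>auto simp: loc_pd_closed h\<close>)
  finally show ?thesis .
qed

end

section \<open>Presentations by coordinates\<close>

locale presented_poisson = enveloping P U \<alpha> \<beta>
  for P :: "('k::field, 'p) poisson" (structure) and U :: "('k, 'u) module" and \<alpha> \<beta> :: "'p \<Rightarrow> 'u" +
  fixes \<Lambda> :: "'i set" and S :: "(('i \<Rightarrow>\<^sub>0 nat) \<Rightarrow>\<^sub>0 'k) set" and \<Gamma> :: "'s set"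
    and f :: "'s \<Rightarrow> ('k, 'i) poly_frac" and q :: "('k, 'i) poly_frac \<Rightarrow> 'p"
  assumes presentation: "poisson_presentation P \<Lambda> S \<Gamma> f q"
begin

sublocale localized_poly \<Lambda> S
  by (rule localized_poly.intro) (use presentation in \<open>simp add: poisson_presentation_def\<close>)

lemma q_hom: "q \<in> alg_hom L P"
  and f_closed: "s \<in> \<Gamma> \<Longrightarrow> f s \<in> carrier L"
  and q_image: "q ` carrier L = carrier P"
  and q_kernel: "a_kernel L P q = Idl\<^bsub>L\<^esub> (f ` \<Gamma>)"
  using presentation by (auto simp: poisson_presentation_def)

lemmas q_simps = alg_homD[OF q_hom]

lemma q_zero: "q \<zero>\<^bsub>L\<^esub> = \<zero>\<^bsub>P\<^esub>"
  using q_simps(5)[OF L.zero_closed, of 0] q_simps(1)[OF L.zero_closed] smult_l_null[of "q \<zero>\<^bsub>L\<^esub>"]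
  by (simp add: L.smult_simps)

lemma q_surj: "a \<in> carrier P \<Longrightarrow> \<exists>g \<in> carrier L. q g = a"
  using q_image by (metis imageE)

lemma q_f: "s \<in> \<Gamma> \<Longrightarrow> q (f s) = \<zero>\<^bsub>P\<^esub>"
proof -
  assume s: "s \<in> \<Gamma>"
  have "f ` \<Gamma> \<subseteq> Idl\<^bsub>L\<^esub> (f ` \<Gamma>)" by (rule L.genideal_self) (use f_closed in blast)
  then show ?thesis using s q_kernel by (auto simp: a_kernel_def')
qed

lemma triple_left_derivation:
  assumes T: "poisson_triple P V \<alpha>' \<beta>'"
  shows "left_derivation V (\<lambda>g. \<alpha>' (q g)) (\<lambda>g. \<beta>' (q g))"
  unfolding twisted_derivation_def
  by (simp add: q_simps poisson_tripleD[OF poisson_algebra_axioms T])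

text \<open>The chain rule, valid in every triple: both sides are left derivations over the same
  homomorphism and agree on the x_i. It shows that relations (a) and (c) hold in \<open>U\<close>
  and that each \<delta>_a lies in the left ideal generated by the \<delta>_i.\<close>

lemma triple_pd_sum:
  assumes T: "poisson_triple P V \<alpha>' \<beta>'" and g: "g \<in> carrier L"
  shows "pd_sum V \<alpha>' (\<lambda>i. \<beta>' (q (xv i))) \<Lambda> S q g = \<beta>' (q g)"
proof -
  note D = poisson_tripleD[OF poisson_algebra_axioms T]
  have t: "(\<lambda>g. \<alpha>' (q g)) \<in> alg_hom L V" by (rule alg_hom_comp[OF q_hom D(2)])
  have y: "\<And>i. i \<in> \<Lambda> \<Longrightarrow> \<beta>' (q (xv i)) \<in> carrier V" by (simp add: D(4) q_simps xv_closed)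
  show ?thesis
    by (rule left_derivation_unique[OF D(1) t pd_sum_derivation[where \<iota> = \<alpha>' and q = q and y = "\<lambda>i. \<beta>' (q (xv i))", OF D(1) t y] triple_left_derivation[OF T] _ g])
      (simp_all add: pd_sum_xv[where \<iota> = \<alpha>' and q = q and y = "\<lambda>i. \<beta>' (q (xv i))", OF D(1) t y])
qed

section \<open>Constructing \<beta> from its values on the variables\<close>

context
  fixes V :: "('k, 'v) module" and \<gamma> :: "'p \<Rightarrow> 'v" and y :: "'i \<Rightarrow> 'v"
  assumes V: "assoc_algebra V" and \<gamma>: "\<gamma> \<in> alg_hom P V"
    and y: "\<And>i. i \<in> \<Lambda> \<Longrightarrow> y i \<in> carrier V"
    and fs: "\<And>s. s \<in> \<Gamma> \<Longrightarrow> pd_sum V \<gamma> y \<Lambda> S q (f s) = \<zero>\<^bsub>V\<^esub>"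
begin

interpretation V: assoc_algebra V by (rule V)

abbreviation "D \<equiv> pd_sum V \<gamma> y \<Lambda> S q"

lemma \<theta>_hom: "(\<lambda>g. \<gamma> (q g)) \<in> alg_hom L V"
  by (rule alg_hom_comp[OF q_hom \<gamma>])

lemmas \<gamma>_simps = alg_homD[OF \<gamma>]
lemmas D_derivation = pd_sum_derivation[where \<iota> = \<gamma> and q = q and y = y, OF V \<theta>_hom y]
lemmas D_xv = pd_sum_xv[where \<iota> = \<gamma> and q = q and y = y, OF V \<theta>_hom y]

lemma D_simps:
  assumes "g \<in> carrier L" "h \<in> carrier L"
  shows "D g \<in> carrier V" "D (g \<oplus>\<^bsub>L\<^esub> h) = D g \<oplus>\<^bsub>V\<^esub> D h" "D (c \<odot>\<^bsub>L\<^esub> g) = c \<odot>\<^bsub>V\<^esub> D g"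
    "D (g \<otimes>\<^bsub>L\<^esub> h) = (\<gamma> (q h) \<otimes>\<^bsub>V\<^esub> D g) \<oplus>\<^bsub>V\<^esub> (\<gamma> (q g) \<otimes>\<^bsub>V\<^esub> D h)"
  using D_derivation assms unfolding twisted_derivation_def by simp_all

lemma \<gamma>_zero: "\<gamma> \<zero>\<^bsub>P\<^esub> = \<zero>\<^bsub>V\<^esub>"
  using alg_homD(5)[OF \<theta>_hom L.zero_closed, of 0] alg_homD(1)[OF \<theta>_hom L.zero_closed]
  by (simp add: L.smult_simps V.smult_simps q_zero)

text \<open>The kernel of \<open>D\<close> alone need not be an ideal: D (g h) contains \<gamma> (q
  h) times D g. Imposing q h = 0 together with D h = 0 kills both terms, and each f_s satisfies both
  conditions.\<close>

lemma D_kernel: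
  assumes g: "g \<in> carrier L" "q g = \<zero>\<^bsub>P\<^esub>"
  shows "D g = \<zero>\<^bsub>V\<^esub>"
proof -
  let ?I = "{g \<in> carrier L. q g = \<zero>\<^bsub>P\<^esub> \<and> D g = \<zero>\<^bsub>V\<^esub>}"
  have Dz: "D \<zero>\<^bsub>L\<^esub> = \<zero>\<^bsub>V\<^esub>"
    using D_simps(3)[OF L.zero_closed L.zero_closed, of 0] D_simps(1)[OF L.zero_closed L.zero_closed]
    by (simp add: L.smult_simps V.smult_simps)
  have neg: "\<ominus>\<^bsub>L\<^esub> g \<in> ?I" if "g \<in> ?I" for g
  proof -
    have "\<ominus>\<^bsub>L\<^esub> g = (-1) \<odot>\<^bsub>L\<^esub> g" using that by (simp add: L.smult_neg_one)
    moreover have "(-1) \<odot> \<zero>\<^bsub>P\<^esub> = \<zero>\<^bsub>P\<^esub>" by (rule smult_r_null) simp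
    ultimately show ?thesis
      using that D_simps(3)[of g g "-1"] by (simp add: q_simps(5) V.smult_simps del: L.smult_closed')
  qed
  have "ideal ?I L"
  proof (rule idealI[OF L.ring_axioms])
    show "subgroup ?I (add_monoid L)"
      by (rule L.add.subgroupI) (use neg q_zero Dz in \<open>auto simp: q_simps D_simps simp flip: a_inv_def\<close>)
  qed (auto simp: q_simps(1,2) D_simps(4) D_simps(1) \<gamma>_zero \<gamma>_simps(1))
  then have "Idl\<^bsub>L\<^esub> (f ` \<Gamma>) \<subseteq> ?I"
    by (rule L.genideal_minimal) (use fs q_f f_closed in auto)
  then show ?thesis using g by (auto simp: a_kernel_def' simp flip: q_kernel)
qed

lemma D_eq:
  assumes g: "g \<in> carrier L" and h: "h \<in> carrier L" and "q g = q h"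
  shows "D g = D h"
proof -
  interpret Pa: assoc_algebra P by (rule assoc_algebra_P)
  let ?k = "g \<oplus>\<^bsub>L\<^esub> ((-1) \<odot>\<^bsub>L\<^esub> h)"
  have "q ?k = \<zero>\<^bsub>P\<^esub>"
    using assms by (simp add: q_simps Pa.smult_neg_one M.r_neg)
  then have "D ?k = \<zero>\<^bsub>V\<^esub>" using g h by (intro D_kernel) simp_all
  then have "D g \<ominus>\<^bsub>V\<^esub> D h = \<zero>\<^bsub>V\<^esub>"
    using g h by (simp add: D_simps(1,2) D_simps(3)[OF h h] V.smult_neg_one V.minus_eq)
  then show ?thesis using D_simps(1) g h by (simp add: V.r_right_minus_eq)
qed

text \<open>Two passes. With y_i fixed, the commutator with \<gamma> (q h) is a bimodule derivation
  in h, whose first term has \<gamma> (q h) on the right. With b fixed, the commutator of D g with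
  \<gamma> b is a left derivation in g, because values of \<gamma> commute with each other.\<close>

lemma D_commutator_elt:
  assumes yx: "\<And>i j. \<lbrakk>i \<in> \<Lambda>; j \<in> \<Lambda>\<rbrakk> \<Longrightarrow> commutator V (y i) (\<gamma> (q (xv j))) = \<gamma> \<lbrace>q (xv i), q (xv j)\<rbrace>"
    and g: "g \<in> carrier L" and b: "b \<in> carrier P"
  shows "commutator V (D g) (\<gamma> b) = \<gamma> \<lbrace>q g, b\<rbrace>"
proof -
  note cl = q_simps(1) \<gamma>_simps(1) bracket_closed commutator_closed[OF V.ring_axioms] xv_closed D_simps(1) y
  have y\<gamma>: "commutator V (y i) (\<gamma> (q h)) = \<gamma> \<lbrace>q (xv i), q h\<rbrace>" if i: "i \<in> \<Lambda>" and h: "h \<in> carrier L" for i h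
  proof (rule twisted_derivation_unique[OF V \<theta>_hom, where r = "\<lambda>g h x. x \<otimes>\<^bsub>V\<^esub> \<gamma> (q h)"])
    show "twisted_derivation V (\<lambda>g. \<gamma> (q g)) (\<lambda>g h x. x \<otimes>\<^bsub>V\<^esub> \<gamma> (q h)) (\<lambda>h. commutator V (y i) (\<gamma> (q h)))"
      unfolding twisted_derivation_def using i
      by (simp add: cl q_simps \<gamma>_simps V.commutator_add_right V.commutator_smult_right V.commutator_mult_right)
    show "twisted_derivation V (\<lambda>g. \<gamma> (q g)) (\<lambda>g h x. x \<otimes>\<^bsub>V\<^esub> \<gamma> (q h)) (\<lambda>h. \<gamma> \<lbrace>q (xv i), q h\<rbrace>)"
      unfolding twisted_derivation_def using i
      by (simp add: cl q_simps(2-5) \<gamma>_simps(2-5) bracket_add_right bracket_smult_right leibniz)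
    show "commutator V (y i) (\<gamma> (q \<one>\<^bsub>L\<^esub>)) = \<gamma> \<lbrace>q (xv i), q \<one>\<^bsub>L\<^esub>\<rbrace>"
      using i by (simp add: q_simps(4) \<gamma>_simps(4) bracket_one q_simps(1) xv_closed \<gamma>_zero
          commutator_eq_iff V.ring_axioms y)
  qed (simp_all add: cl yx i h)
  have \<gamma>\<gamma>: "commutator V (\<gamma> a) (\<gamma> b) = \<zero>\<^bsub>V\<^esub>" if "a \<in> carrier P" for a
    using that b by (simp add: commutator_eq_iff V.ring_axioms cl m_comm flip: \<gamma>_simps(2))
  show ?thesis
  proof (rule left_derivation_unique[OF V \<theta>_hom _ _ _ g])
    show "left_derivation V (\<lambda>g. \<gamma> (q g)) (\<lambda>g. commutator V (D g) (\<gamma> b))"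
      unfolding twisted_derivation_def using b
      by (simp add: cl D_simps V.commutator_add_left V.commutator_smult_left V.commutator_mult_left \<gamma>\<gamma>)
    show "left_derivation V (\<lambda>g. \<gamma> (q g)) (\<lambda>g. \<gamma> \<lbrace>q g, b\<rbrace>)"
      unfolding twisted_derivation_def using b
      by (simp add: cl q_simps(2-5) \<gamma>_simps(2-5) bracket_add_left bracket_smult_left leibniz_left V.a_comm)
    show "commutator V (D (xv i)) (\<gamma> b) = \<gamma> \<lbrace>q (xv i), b\<rbrace>" if "i \<in> \<Lambda>" for i
      using q_surj[OF b] y\<gamma>[OF that] that by (auto simp: D_xv)
  qed
qed

text \<open>
  The bracket relation \<open>[\<beta>' a, \<beta>' b] = \<beta>' {a, b}\<close> is reduced to coordinates one argument at a time: for fixed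
  \<open>b\<close> both sides satisfy the same inhomogeneous product rule in \<open>a\<close>.
\<close>
lemma coordinate_triple:
  assumes yx: "\<And>i j. \<lbrakk>i \<in> \<Lambda>; j \<in> \<Lambda>\<rbrakk> \<Longrightarrow> commutator V (y i) (\<gamma> (q (xv j))) = \<gamma> \<lbrace>q (xv i), q (xv j)\<rbrace>"
    and r: "\<And>i j. \<lbrakk>i \<in> \<Lambda>; j \<in> \<Lambda>\<rbrakk> \<Longrightarrow> r i j \<in> carrier L \<and> q (r i j) = \<lbrace>q (xv i), q (xv j)\<rbrace>"
    and yy: "\<And>i j. \<lbrakk>i \<in> \<Lambda>; j \<in> \<Lambda>; i \<noteq> j\<rbrakk> \<Longrightarrow> commutator V (y i) (y j) = D (r i j)"
  shows "\<exists>\<beta>'. poisson_triple P V \<gamma> \<beta>' \<and> (\<forall>g \<in> carrier L. \<beta>' (q g) = D g)"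
proof -
  define \<beta>' where "\<beta>' a = D (SOME g. g \<in> carrier L \<and> q g = a)" for a
  have \<beta>q: "\<beta>' (q g) = D g" if g: "g \<in> carrier L" for g
  proof -
    have "(SOME h. h \<in> carrier L \<and> q h = q g) \<in> carrier L \<and> q (SOME h. h \<in> carrier L \<and> q h = q g) = q g"
      by (rule someI[of _ g]) (simp add: g)
    then show ?thesis unfolding \<beta>'_def by (intro D_eq g) auto
  qed
  have lin: "\<beta>' a \<in> carrier V" "\<beta>' (a \<oplus>\<^bsub>P\<^esub> b) = \<beta>' a \<oplus>\<^bsub>V\<^esub> \<beta>' b" "\<beta>' (c \<odot> a) = c \<odot>\<^bsub>V\<^esub> \<beta>' a"
    "\<beta>' (a \<otimes>\<^bsub>P\<^esub> b) = (\<gamma> b \<otimes>\<^bsub>V\<^esub> \<beta>' a) \<oplus>\<^bsub>V\<^esub> (\<gamma> a \<otimes>\<^bsub>V\<^esub> \<beta>' b)"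
    "commutator V (\<beta>' a) (\<gamma> b) = \<gamma> \<lbrace>a, b\<rbrace>"
    if ab: "a \<in> carrier P" "b \<in> carrier P" for a b c
  proof -
    obtain g where g: "g \<in> carrier L" "q g = a" using q_surj[OF ab(1)] by blast
    obtain h where h: "h \<in> carrier L" "q h = b" using q_surj[OF ab(2)] by blast
    note [simp] = g(1) h(1) g(2)[symmetric] h(2)[symmetric]
    show "\<beta>' a \<in> carrier V" by (simp add: \<beta>q D_simps(1)[of g g])
    show "\<beta>' (a \<oplus>\<^bsub>P\<^esub> b) = \<beta>' a \<oplus>\<^bsub>V\<^esub> \<beta>' b"
      by (simp add: \<beta>q D_simps(2) flip: q_simps(3))
    show "\<beta>' (c \<odot> a) = c \<odot>\<^bsub>V\<^esub> \<beta>' a"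
      by (simp add: \<beta>q D_simps(3)[of g g] flip: q_simps(5))
    show "\<beta>' (a \<otimes>\<^bsub>P\<^esub> b) = (\<gamma> b \<otimes>\<^bsub>V\<^esub> \<beta>' a) \<oplus>\<^bsub>V\<^esub> (\<gamma> a \<otimes>\<^bsub>V\<^esub> \<beta>' b)"
      by (simp add: \<beta>q D_simps(4) flip: q_simps(2))
    show "commutator V (\<beta>' a) (\<gamma> b) = \<gamma> \<lbrace>a, b\<rbrace>"
      using D_commutator_elt[OF yx g(1) ab(2)] by (simp add: \<beta>q)
  qed
  note cl = q_simps(1) \<gamma>_simps(1) bracket_closed commutator_closed[OF V.ring_axioms] xv_closed D_simps(1) y lin(1)
  have \<beta>_zero: "\<beta>' \<zero>\<^bsub>P\<^esub> = \<zero>\<^bsub>V\<^esub>" using \<beta>q[OF L.zero_closed] D_kernel[OF L.zero_closed q_zero] by (simp add: q_zero)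
  have \<beta>_uminus: "\<beta>' (\<ominus>\<^bsub>P\<^esub> a) = \<ominus>\<^bsub>V\<^esub> \<beta>' a" if "a \<in> carrier P" for a
  proof -
    interpret Pa: assoc_algebra P by (rule assoc_algebra_P)
    show ?thesis using that lin(3)[OF that that, of "-1"] by (simp add: Pa.smult_neg_one V.smult_neg_one cl)
  qed
  \<comment> \<open>The inhomogeneous part of the product rule arises on the left from commutators
    of \<gamma> with \<beta>' b, and on the right from applying the product rule of \<beta>' to the
    terms g {h, b} and h {g, b}.\<close>
  have comm: "commutator V (D g) (\<beta>' b) = \<beta>' \<lbrace>q g, b\<rbrace>"
    if b: "b \<in> carrier P" and var: "\<And>i. i \<in> \<Lambda> \<Longrightarrow> commutator V (y i) (\<beta>' b) = \<beta>' \<lbrace>q (xv i), b\<rbrace>"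
      and g: "g \<in> carrier L" for g b
  proof (rule twisted_derivation_unique[OF V \<theta>_hom, where r = "\<lambda>g h x. (\<gamma> (q h) \<otimes>\<^bsub>V\<^esub> x) \<oplus>\<^bsub>V\<^esub>
        ((\<gamma> \<lbrace>q h, b\<rbrace> \<otimes>\<^bsub>V\<^esub> D g) \<oplus>\<^bsub>V\<^esub> (\<gamma> \<lbrace>q g, b\<rbrace> \<otimes>\<^bsub>V\<^esub> D h))"])
    have elt: "commutator V (\<gamma> a) (\<beta>' b) = \<gamma> \<lbrace>a, b\<rbrace>" if a: "a \<in> carrier P" for a
    proof -
      interpret Pa: assoc_algebra P by (rule assoc_algebra_P)
      have "commutator V (\<gamma> a) (\<beta>' b) = (-1) \<odot>\<^bsub>V\<^esub> \<gamma> \<lbrace>b, a\<rbrace>"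
        using a b by (simp add: V.commutator_antisym[of "\<beta>' b" "\<gamma> a"] cl lin(5) V.smult_neg_one)
      also have "\<dots> = \<gamma> \<lbrace>a, b\<rbrace>"
        using a b by (simp add: bracket_antisym[of b a] cl Pa.smult_neg_one flip: \<gamma>_simps(5))
      finally show ?thesis .
    qed
    let ?r = "\<lambda>g h x. (\<gamma> (q h) \<otimes>\<^bsub>V\<^esub> x) \<oplus>\<^bsub>V\<^esub>
        ((\<gamma> \<lbrace>q h, b\<rbrace> \<otimes>\<^bsub>V\<^esub> D g) \<oplus>\<^bsub>V\<^esub> (\<gamma> \<lbrace>q g, b\<rbrace> \<otimes>\<^bsub>V\<^esub> D h))"
    show "twisted_derivation V (\<lambda>g. \<gamma> (q g)) ?r (\<lambda>g. commutator V (D g) (\<beta>' b))"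
      unfolding twisted_derivation_def using b
      by (simp add: cl D_simps V.commutator_add_left V.commutator_smult_left V.commutator_mult_left elt V.a_ac)
    show "twisted_derivation V (\<lambda>g. \<gamma> (q g)) ?r (\<lambda>g. \<beta>' \<lbrace>q g, b\<rbrace>)"
      unfolding twisted_derivation_def using b
      by (simp add: cl q_simps(2-5) lin(2-4) bracket_add_left bracket_smult_left leibniz_left \<beta>q V.a_ac)
    show "commutator V (D \<one>\<^bsub>L\<^esub>) (\<beta>' b) = \<beta>' \<lbrace>q \<one>\<^bsub>L\<^esub>, b\<rbrace>"
      using b by (simp add: left_derivation_one[OF V \<theta>_hom D_derivation] q_simps(4) bracket_one \<beta>_zero
          commutator_eq_iff V.ring_axioms cl)
  qed (use var g b in \<open>simp_all add: cl D_xv\<close>)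
  have \<beta>xv: "\<beta>' (q (xv i)) = y i" if "i \<in> \<Lambda>" for i
    using that by (simp add: \<beta>q xv_closed D_xv)
  have yy': "commutator V (y i) (y j) = \<beta>' \<lbrace>q (xv i), q (xv j)\<rbrace>" if "i \<in> \<Lambda>" "j \<in> \<Lambda>" for i j
  \<comment> \<open>Relation (a) is imposed off the diagonal only; on it both sides vanish.\<close>
  proof (cases "i = j")
    case True
    then show ?thesis using that
      by (simp add: bracket_self cl \<beta>_zero commutator_eq_iff V.ring_axioms)
  next
    case False
    then show ?thesis using that yy[OF that False] r[OF that] \<beta>q[of "r i j"] by simp
  qed
  \<comment> \<open>\<open>comm\<close> can only generalize the first argument. It is used with a
    coordinate in the second, then antisymmetry swaps the two, and a second use frees the remaining
    argument.\<close>
  have c1: "commutator V (D g) (y j) = \<beta>' \<lbrace>q g, q (xv j)\<rbrace>" if "g \<in> carrier L" "j \<in> \<Lambda>" for g j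
    using comm[of "q (xv j)" g] that by (simp add: cl \<beta>xv yy')
  have c2: "commutator V (y i) (\<beta>' b) = \<beta>' \<lbrace>q (xv i), b\<rbrace>" if i: "i \<in> \<Lambda>" and b: "b \<in> carrier P" for i b
  proof -
    obtain h where h: "h \<in> carrier L" "q h = b" using q_surj[OF b] by blast
    have "commutator V (y i) (\<beta>' b) = \<ominus>\<^bsub>V\<^esub> \<beta>' \<lbrace>b, q (xv i)\<rbrace>"
      using c1[OF h(1) i] i b h by (subst V.commutator_antisym[of "\<beta>' b"]) (auto simp: cl \<beta>q)
    then show ?thesis using i b
      by (simp add: bracket_antisym[of b "q (xv i)"] cl \<beta>_uminus)
  qed
  have c3: "commutator V (\<beta>' a) (\<beta>' b) = \<beta>' \<lbrace>a, b\<rbrace>" if "a \<in> carrier P" "b \<in> carrier P" for a b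
    using comm[OF that(2) c2[OF _ that(2)]] q_surj[OF that(1)] by (auto simp: \<beta>q)
  have "poisson_triple P V \<gamma> \<beta>'"
    unfolding poisson_triple_def by (simp add: V \<gamma> lin c3)
  then show ?thesis using \<beta>q by blast
qed

end

section \<open>The annihilator of 1 as a left ideal\<close>

lemma annihilator_eq_left_ideal_sum:
  assumes act: "natural_poisson_module P U \<alpha> \<beta> act"
  shows "annihilator U P act \<one>\<^bsub>P\<^esub> = left_ideal_sum U (\<lambda>i. \<beta> (q (xv i))) \<Lambda>"
proof -
  note A = natural_poisson_moduleD[OF act]
  let ?N = "annihilator U P act \<one>\<^bsub>P\<^esub>" and ?d = "\<lambda>i. \<beta> (q (xv i))"
  let ?J = "left_ideal_sum U ?d \<Lambda>"
  have d: "?d i \<in> carrier U" if "i \<in> \<Lambda>" for i using that by (simp add: U_triple(4) q_simps(1) xv_closed)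
  have Jc: "j \<in> carrier U" if "j \<in> ?J" for j
    using that d unfolding left_ideal_sum_def by (auto intro!: U.finsum_closed simp: Pi_iff subset_iff)
  have Jz: "\<zero>\<^bsub>U\<^esub> \<in> ?J"
    unfolding left_ideal_sum_def by (rule CollectI, rule exI[of _ "{}"]) simp
  have Jadd: "j \<oplus>\<^bsub>U\<^esub> j' \<in> ?J" if j: "j \<in> ?J" "j' \<in> ?J" for j j'
  proof -
    obtain I u where I: "finite I" "I \<subseteq> \<Lambda>" "u \<in> I \<rightarrow> carrier U" "j = (\<Oplus>\<^bsub>U\<^esub>i\<in>I. u i \<otimes>\<^bsub>U\<^esub> ?d i)"
      using j(1) unfolding left_ideal_sum_def by blast
    obtain I' u' where I': "finite I'" "I' \<subseteq> \<Lambda>" "u' \<in> I' \<rightarrow> carrier U" "j' = (\<Oplus>\<^bsub>U\<^esub>i\<in>I'. u' i \<otimes>\<^bsub>U\<^esub> ?d i)"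
      using j(2) unfolding left_ideal_sum_def by blast
    \<comment> \<open>Coefficients are extended by zero, so that two sums over different finite sets
      can be added over their union.\<close>
    have ext: "(\<Oplus>\<^bsub>U\<^esub>i\<in>K. u i \<otimes>\<^bsub>U\<^esub> ?d i) = (\<Oplus>\<^bsub>U\<^esub>i\<in>I \<union> I'. (if i \<in> K then u i else \<zero>\<^bsub>U\<^esub>) \<otimes>\<^bsub>U\<^esub> ?d i)"
      if "K \<subseteq> I \<union> I'" "u \<in> K \<rightarrow> carrier U" for K u
      by (rule U.add.finprod_mono_neutral_cong_left)
        (use that I(1,2) I'(1,2) d in \<open>auto simp: Pi_iff subset_iff\<close>)
    let ?v = "\<lambda>i. if i \<in> I then u i else \<zero>\<^bsub>U\<^esub>" and ?v' = "\<lambda>i. if i \<in> I' then u' i else \<zero>\<^bsub>U\<^esub>"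
    have v: "?v i \<in> carrier U" "?v' i \<in> carrier U" for i using I(3) I'(3) by auto
    have dI: "?d i \<in> carrier U" if "i \<in> I \<union> I'" for i using that d I(2) I'(2) by blast
    have "j \<oplus>\<^bsub>U\<^esub> j' = (\<Oplus>\<^bsub>U\<^esub>i\<in>I \<union> I'. (?v i \<otimes>\<^bsub>U\<^esub> ?d i) \<oplus>\<^bsub>U\<^esub> (?v' i \<otimes>\<^bsub>U\<^esub> ?d i))"
      unfolding I(4) I'(4) ext[OF Un_upper1 I(3)] ext[OF Un_upper2 I'(3)]
      by (rule U.finsum_addf[symmetric]) (use v dI in auto)
    also have "\<dots> = (\<Oplus>\<^bsub>U\<^esub>i\<in>I \<union> I'. (?v i \<oplus>\<^bsub>U\<^esub> ?v' i) \<otimes>\<^bsub>U\<^esub> ?d i)"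
      by (rule U.finsum_cong'[OF refl]) (use v dI in \<open>auto simp: U.l_distr simp del: Un_iff\<close>)
    moreover have "(\<lambda>i. ?v i \<oplus>\<^bsub>U\<^esub> ?v' i) \<in> I \<union> I' \<rightarrow> carrier U"
      by (rule Pi_I, rule U.a_closed[OF v])
    ultimately show ?thesis
      unfolding left_ideal_sum_def using I(1,2) I'(1,2)
      by (intro CollectI exI[of _ "I \<union> I'"] exI[of _ "\<lambda>i. ?v i \<oplus>\<^bsub>U\<^esub> ?v' i"] conjI) simp_all
  qed
  have Jmult: "w \<otimes>\<^bsub>U\<^esub> j \<in> ?J" if w: "w \<in> carrier U" and j: "j \<in> ?J" for w j
  proof -
    obtain I u where I: "finite I" "I \<subseteq> \<Lambda>" "u \<in> I \<rightarrow> carrier U" "j = (\<Oplus>\<^bsub>U\<^esub>i\<in>I. u i \<otimes>\<^bsub>U\<^esub> ?d i)"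
      using j unfolding left_ideal_sum_def by blast
    have "w \<otimes>\<^bsub>U\<^esub> j = (\<Oplus>\<^bsub>U\<^esub>i\<in>I. w \<otimes>\<^bsub>U\<^esub> (u i \<otimes>\<^bsub>U\<^esub> ?d i))"
      unfolding I(4) by (rule U.finsum_rdistr[OF I(1) w]) (use I d in auto)
    also have "\<dots> = (\<Oplus>\<^bsub>U\<^esub>i\<in>I. (w \<otimes>\<^bsub>U\<^esub> u i) \<otimes>\<^bsub>U\<^esub> ?d i)"
      by (rule U.finsum_cong'[OF refl]) (use I d w in \<open>auto simp: U.m_assoc Pi_iff subset_iff\<close>)
    finally show ?thesis
      unfolding left_ideal_sum_def using I w
      by (intro CollectI exI[of _ I] exI[of _ "\<lambda>i. w \<otimes>\<^bsub>U\<^esub> u i"]) auto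
  qed
  have J\<beta>: "\<beta> a \<in> ?J" if a: "a \<in> carrier P" for a
  proof -
    obtain g where g: "g \<in> carrier L" "q g = a" using q_surj[OF a] by blast
    have "\<beta> a = pd_sum U \<alpha> ?d \<Lambda> S q g" using triple_pd_sum[OF triple g(1)] g(2) by simp
    then show ?thesis unfolding pd_sum_def left_ideal_sum_def using loc_pd_finite[OF g(1)] g(1)
      by (intro CollectI exI[of _ "{i \<in> \<Lambda>. loc_pd \<Lambda> S i g \<noteq> \<zero>\<^bsub>L\<^esub>}"] exI[of _ "\<lambda>i. \<alpha> (q (loc_pd \<Lambda> S i g))"])
        (auto simp: U_triple(3) q_simps(1) loc_pd_closed)
  qed
  let ?W = "{\<alpha> a \<oplus>\<^bsub>U\<^esub> j | a j. a \<in> carrier P \<and> j \<in> ?J}"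
  have W: "\<alpha> a \<oplus>\<^bsub>U\<^esub> j \<in> ?W" if "a \<in> carrier P" "j \<in> ?J" for a j using that by blast
  have UW: "carrier U \<subseteq> ?W"
  proof (rule carrier_subset_if_stable)
    show "?W \<subseteq> carrier U" using Jc by (auto simp: U_triple(3))
    show "\<one>\<^bsub>U\<^esub> \<in> ?W" using W[OF one_closed Jz] by (simp add: \<alpha>_hom(4))
  next
    fix x y assume "x \<in> ?W" "y \<in> ?W"
    then obtain a j b k where x: "a \<in> carrier P" "j \<in> ?J" "x = \<alpha> a \<oplus>\<^bsub>U\<^esub> j"
      and y: "b \<in> carrier P" "k \<in> ?J" "y = \<alpha> b \<oplus>\<^bsub>U\<^esub> k" by blast
    have "x \<oplus>\<^bsub>U\<^esub> y = \<alpha> (a \<oplus>\<^bsub>P\<^esub> b) \<oplus>\<^bsub>U\<^esub> (j \<oplus>\<^bsub>U\<^esub> k)"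
      using x y Jc by (simp add: \<alpha>_hom(3) U_triple(3) U.a_ac)
    then show "x \<oplus>\<^bsub>U\<^esub> y \<in> ?W" using W[OF _ Jadd[OF x(2) y(2)], of "a \<oplus>\<^bsub>P\<^esub> b"] x y by simp
  next
    fix b w assume b: "b \<in> carrier P" and "w \<in> ?W"
    then obtain a j where w: "a \<in> carrier P" "j \<in> ?J" "w = \<alpha> a \<oplus>\<^bsub>U\<^esub> j" by blast
    have "\<alpha> b \<otimes>\<^bsub>U\<^esub> w = \<alpha> (b \<otimes>\<^bsub>P\<^esub> a) \<oplus>\<^bsub>U\<^esub> (\<alpha> b \<otimes>\<^bsub>U\<^esub> j)"
      using w b Jc by (simp add: \<alpha>_hom(2) U_triple(3) U.r_distr)
    then show "\<alpha> b \<otimes>\<^bsub>U\<^esub> w \<in> ?W"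
      using W[OF _ Jmult[OF _ w(2)], of "b \<otimes>\<^bsub>P\<^esub> a" "\<alpha> b"] w b by (simp add: U_triple(3))
    \<comment> \<open>Moving \<beta> b past \<alpha> a costs \<alpha> {b, a}, which stays in the
      first summand; the term \<alpha> a \<beta> b falls into the left ideal.\<close>
    have "\<beta> b \<otimes>\<^bsub>U\<^esub> w = \<alpha> \<lbrace>b, a\<rbrace> \<oplus>\<^bsub>U\<^esub> ((\<alpha> a \<otimes>\<^bsub>U\<^esub> \<beta> b) \<oplus>\<^bsub>U\<^esub> (\<beta> b \<otimes>\<^bsub>U\<^esub> j))"
      using w b Jc by (simp add: U_triple(3,4) U.r_distr U_triple(8)[of b a] bracket_closed U.a_assoc)
    moreover have "(\<alpha> a \<otimes>\<^bsub>U\<^esub> \<beta> b) \<oplus>\<^bsub>U\<^esub> (\<beta> b \<otimes>\<^bsub>U\<^esub> j) \<in> ?J"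
      using w b by (intro Jadd Jmult J\<beta> U_triple(3,4))
    ultimately show "\<beta> b \<otimes>\<^bsub>U\<^esub> w \<in> ?W" using W[of "\<lbrace>b, a\<rbrace>"] w b by (simp add: bracket_closed)
  qed
  have act0: "act u \<zero>\<^bsub>P\<^esub> = \<zero>\<^bsub>P\<^esub>" if "u \<in> carrier U" for u
    using A(2)[of u "\<zero>\<^bsub>P\<^esub>" "\<zero>\<^bsub>P\<^esub>"] A(1)[of u "\<zero>\<^bsub>P\<^esub>"] that by (simp add: M.add.l_cancel_one)
  have zact: "act \<zero>\<^bsub>U\<^esub> \<one>\<^bsub>P\<^esub> = \<zero>\<^bsub>P\<^esub>"
    using A(3)[of "\<zero>\<^bsub>U\<^esub>" "\<zero>\<^bsub>U\<^esub>" "\<one>\<^bsub>P\<^esub>"] A(1)[of "\<zero>\<^bsub>U\<^esub>" "\<one>\<^bsub>P\<^esub>"] by (simp add: M.add.l_cancel_one)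
  have JN: "act j \<one>\<^bsub>P\<^esub> = \<zero>\<^bsub>P\<^esub>" if j: "j \<in> ?J" for j
  proof -
    obtain I u where I: "finite I" "I \<subseteq> \<Lambda>" "u \<in> I \<rightarrow> carrier U" "j = (\<Oplus>\<^bsub>U\<^esub>i\<in>I. u i \<otimes>\<^bsub>U\<^esub> ?d i)"
      using j unfolding left_ideal_sum_def by blast
    have "act (\<Oplus>\<^bsub>U\<^esub>i\<in>I. u i \<otimes>\<^bsub>U\<^esub> ?d i) \<one>\<^bsub>P\<^esub> = \<zero>\<^bsub>P\<^esub>" using I(1-3)
    proof (induction I rule: finite_induct)
      case empty
      then show ?case by (simp add: zact)
    next
      case (insert i I)
      have "act (u i \<otimes>\<^bsub>U\<^esub> ?d i) \<one>\<^bsub>P\<^esub> = \<zero>\<^bsub>P\<^esub>"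
        using insert.prems d by (simp add: A(4,7) q_simps(1) xv_closed bracket_one act0)
      moreover have "u i \<otimes>\<^bsub>U\<^esub> ?d i \<in> carrier U" "(\<lambda>i. u i \<otimes>\<^bsub>U\<^esub> ?d i) \<in> I \<rightarrow> carrier U"
        using insert.prems d by auto
      ultimately show ?case using insert by (simp add: A(3))
    qed
    then show ?thesis by (simp add: I(4))
  qed
  show ?thesis
  proof
    show "?J \<subseteq> ?N" using JN Jc by (auto simp: annihilator_def)
    show "?N \<subseteq> ?J"
    proof
      fix u assume "u \<in> ?N"
      then have u: "u \<in> carrier U" "act u \<one>\<^bsub>P\<^esub> = \<zero>\<^bsub>P\<^esub>" by (auto simp: annihilator_def)
      then obtain a j where aj: "a \<in> carrier P" "j \<in> ?J" "u = \<alpha> a \<oplus>\<^bsub>U\<^esub> j" using UW by blast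
      have "act u \<one>\<^bsub>P\<^esub> = a"
        using aj Jc by (simp add: A(3,6) U_triple(3) JN)
      then have "a = \<zero>\<^bsub>P\<^esub>" using u by simp
      then have "\<alpha> a = \<zero>\<^bsub>U\<^esub>"
        by (simp add: \<alpha>_zero)
      then show "u \<in> ?J" using aj Jc by simp
    qed
  qed
qed

section \<open>The isomorphism with the presentation by coordinates\<close>

lemma coordinate_presentation:
  assumes r: "\<And>i j. \<lbrakk>i \<in> \<Lambda>; j \<in> \<Lambda>\<rbrakk> \<Longrightarrow> r i j \<in> carrier L \<and> q (r i j) = \<lbrace>q (xv i), q (xv j)\<rbrace>"
  defines "G \<equiv> Sum_Type.Plus (carrier P) \<Lambda>" and "R \<equiv> delta_rels P \<Lambda> S \<Gamma> f q r"
  shows "\<exists>\<psi> \<in> alg_iso (presented_alg G R) U.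
     (\<forall>a \<in> carrier P. \<psi> (presented_gen G R (Inl a)) = \<alpha> a) \<and>
     (\<forall>i \<in> \<Lambda>. \<psi> (presented_gen G R (Inr i)) = \<beta> (q (xv i)))"
proof -
  let ?F = "free_alg G :: ('k, ('p + 'i) list \<Rightarrow> 'k) module"
  let ?\<iota> = "\<lambda>a. free_gen (Inl a) :: ('p + 'i) list \<Rightarrow> 'k" and ?\<delta> = "\<lambda>i. free_gen (Inr i) :: ('p + 'i) list \<Rightarrow> 'k"
  let ?x = "\<lambda>i. q (xv i)"
  interpret F: assoc_algebra ?F by (rule free_assoc)
  have mem: "Inl a \<in> G \<longleftrightarrow> a \<in> carrier P" "Inr i \<in> G \<longleftrightarrow> i \<in> \<Lambda>" for a i by (auto simp: G_def)
  have gens: "a \<in> carrier P \<Longrightarrow> ?\<iota> a \<in> carrier ?F" "i \<in> \<Lambda> \<Longrightarrow> ?\<delta> i \<in> carrier ?F" for a i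
    by (simp_all add: free_gen_closed mem)
  note cl = gens q_simps(1) xv_closed bracket_closed
  have pdF: "pd_sum ?F ?\<iota> ?\<delta> \<Lambda> S q g \<in> carrier ?F" if "g \<in> carrier L" for g
    unfolding pd_sum_def using that by (intro F.finsum_closed) (auto simp: cl loc_pd_closed)
  have R_eq: "R = alg_rels ?F P ?\<iota> \<union>
       {commutator ?F (?\<delta> i) (?\<delta> j) \<ominus>\<^bsub>?F\<^esub> pd_sum ?F ?\<iota> ?\<delta> \<Lambda> S q (r i j) | i j. i \<in> \<Lambda> \<and> j \<in> \<Lambda> \<and> i \<noteq> j} \<union>
       {commutator ?F (?\<delta> i) (?\<iota> (?x j)) \<ominus>\<^bsub>?F\<^esub> ?\<iota> \<lbrace>?x i, ?x j\<rbrace> | i j. i \<in> \<Lambda> \<and> j \<in> \<Lambda>} \<union>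
       {pd_sum ?F ?\<iota> ?\<delta> \<Lambda> S q (f s) | s. s \<in> \<Gamma>}"
    by (simp add: R_def G_def delta_rels_def Let_def)
  have Rc: "R \<subseteq> carrier ?F"
    unfolding R_eq using F.alg_rels_closed[OF assoc_algebra_P gens(1)] r
    by (auto intro!: F.minus_closed commutator_closed F.ring_axioms pdF f_closed cl)
  let ?V = "presented_alg G R" and ?\<phi> = "\<lambda>p. Idl\<^bsub>?F\<^esub> R +>\<^bsub>?F\<^esub> p"
  have V: "assoc_algebra ?V" by (rule presented_assoc[OF Rc])
  interpret V: assoc_algebra ?V by (rule V)
  note \<phi> = presented_proj[OF Rc] note \<phi>_simps = alg_homD[OF \<phi>]
  let ?a = "\<lambda>a. ?\<phi> (?\<iota> a)" and ?y = "\<lambda>i. ?\<phi> (?\<delta> i)"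
  have a: "?a \<in> alg_hom P ?V"
    by (rule presented_alg_rels_hom[OF Rc assoc_algebra_P gens(1)]) (auto simp: R_eq)
  have y: "?y i \<in> carrier ?V" if "i \<in> \<Lambda>" for i by (rule \<phi>_simps(1)[OF gens(2)[OF that]])
  have \<phi>pd: "?\<phi> (pd_sum ?F ?\<iota> ?\<delta> \<Lambda> S q g) = pd_sum ?V ?a ?y \<Lambda> S q g" if "g \<in> carrier L" for g
    by (rule pd_sum_hom[OF F.ring_axioms V.ring_axioms \<phi> that]) (simp_all add: cl)
  have \<phi>comm: "?\<phi> (commutator ?F p p') = commutator ?V (?\<phi> p) (?\<phi> p')"
    if "p \<in> carrier ?F" "p' \<in> carrier ?F" for p p'
    using that by (simp add: commutator_def alg_hom_minus[OF F.ring_axioms V.ring_axioms \<phi>] \<phi>_simps(2))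
  have fs: "pd_sum ?V ?a ?y \<Lambda> S q (f s) = \<zero>\<^bsub>?V\<^esub>" if "s \<in> \<Gamma>" for s
  proof -
    have "pd_sum ?F ?\<iota> ?\<delta> \<Lambda> S q (f s) \<in> R" using that unfolding R_eq by blast
    from presented_rel[OF Rc this] show ?thesis by (simp add: \<phi>pd f_closed that)
  qed
  have yx: "commutator ?V (?y i) (?a (?x j)) = ?a \<lbrace>?x i, ?x j\<rbrace>" if "i \<in> \<Lambda>" "j \<in> \<Lambda>" for i j
  proof -
    have "commutator ?F (?\<delta> i) (?\<iota> (?x j)) \<ominus>\<^bsub>?F\<^esub> ?\<iota> \<lbrace>?x i, ?x j\<rbrace> \<in> R" using that unfolding R_eq by blast
    from presented_eqI[OF Rc _ _ this] show ?thesis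
      using that by (simp add: cl \<phi>comm commutator_closed F.ring_axioms)
  qed
  have yy: "commutator ?V (?y i) (?y j) = pd_sum ?V ?a ?y \<Lambda> S q (r i j)" if "i \<in> \<Lambda>" "j \<in> \<Lambda>" "i \<noteq> j" for i j
  proof -
    have "commutator ?F (?\<delta> i) (?\<delta> j) \<ominus>\<^bsub>?F\<^esub> pd_sum ?F ?\<iota> ?\<delta> \<Lambda> S q (r i j) \<in> R"
      using that unfolding R_eq by blast
    from presented_eqI[OF Rc _ _ this] show ?thesis
      using that r[OF that(1,2)] by (simp add: cl \<phi>comm pdF \<phi>pd commutator_closed F.ring_axioms)
  qed
  have "\<exists>b. poisson_triple P ?V ?a b \<and> (\<forall>g \<in> carrier L. b (q g) = pd_sum ?V ?a ?y \<Lambda> S q g)"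
    by (rule coordinate_triple[OF V a y fs yx r yy])
  then obtain b where T: "poisson_triple P ?V ?a b"
    and b: "\<And>g. g \<in> carrier L \<Longrightarrow> b (q g) = pd_sum ?V ?a ?y \<Lambda> S q g" by blast
  have by': "b (?x i) = ?y i" if "i \<in> \<Lambda>" for i
    using that pd_sum_xv[where \<iota> = ?a and q = q and y = ?y, OF V alg_hom_comp[OF q_hom a] y that] by (simp add: b xv_closed)
  let ?g = "case_sum \<alpha> (\<lambda>i. \<beta> (?x i))"
  have g: "?g \<in> G \<rightarrow> carrier U" by (auto simp: G_def U_triple(3,4) cl)
  define h where "h = U.ev ?g"
  have h: "h \<in> alg_hom ?F U" unfolding h_def by (rule U.ev_hom[OF g])
  have hg: "h (?\<iota> a) = \<alpha> a" if "a \<in> carrier P" for a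
    using that U.ev_gen[OF g, of "Inl a"] by (simp add: h_def mem)
  have hd: "h (?\<delta> i) = \<beta> (?x i)" if "i \<in> \<Lambda>" for i
    using that U.ev_gen[OF g, of "Inr i"] by (simp add: h_def mem)
  note h_simps = alg_homD[OF h]
  \<comment> \<open>In \<open>U\<close> the sums of partial derivatives become values of \<beta>.
    Thus (a) turns into the bracket law for the representative \<open>r i j\<close>, and (c) into
    \<beta> 0 = 0.\<close>
  have hpd: "h (pd_sum ?F ?\<iota> ?\<delta> \<Lambda> S q k) = \<beta> (q k)" if k: "k \<in> carrier L" for k
  proof -
    have "h (pd_sum ?F ?\<iota> ?\<delta> \<Lambda> S q k) = pd_sum U (\<lambda>a. h (?\<iota> a)) (\<lambda>i. h (?\<delta> i)) \<Lambda> S q k"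
      by (rule pd_sum_hom[OF F.ring_axioms U.ring_axioms h k]) (simp_all add: cl)
    also have "\<dots> = pd_sum U \<alpha> (\<lambda>i. \<beta> (?x i)) \<Lambda> S q k"
      unfolding pd_sum_def using k
      by (intro U.finsum_cong') (auto simp: hg hd q_simps(1) loc_pd_closed U_triple(3,4) cl)
    finally show ?thesis by (simp add: triple_pd_sum[OF triple k])
  qed
  have hcomm: "h (commutator ?F p p') = commutator U (h p) (h p')" if "p \<in> carrier ?F" "p' \<in> carrier ?F" for p p'
    using that by (simp add: commutator_def alg_hom_minus[OF F.ring_axioms U.ring_axioms h] h_simps(2))
  have \<beta>z: "\<beta> \<zero>\<^bsub>P\<^esub> = \<zero>\<^bsub>U\<^esub>"
    using U_triple(5)[of "\<zero>\<^bsub>P\<^esub>" "\<zero>\<^bsub>P\<^esub>"] U_triple(4)[of "\<zero>\<^bsub>P\<^esub>"] by (simp add: U.add.l_cancel_one)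
  have bracket: "commutator U (\<beta> a) (\<beta> b) = \<beta> \<lbrace>a, b\<rbrace>" "commutator U (\<beta> a) (\<alpha> b) = \<alpha> \<lbrace>a, b\<rbrace>"
    if "a \<in> carrier P" "b \<in> carrier P" for a b
    using triple that unfolding poisson_triple_def by simp_all
  have "h p = \<zero>\<^bsub>U\<^esub>" if "p \<in> alg_rels ?F P ?\<iota>" for p
    by (rule F.alg_rels_zero[OF U.ring_axioms h assoc_algebra_P gens(1) U_triple(2) hg that])
  moreover have "h (commutator ?F (?\<delta> i) (?\<delta> j) \<ominus>\<^bsub>?F\<^esub> pd_sum ?F ?\<iota> ?\<delta> \<Lambda> S q (r i j)) = \<zero>\<^bsub>U\<^esub>"
    if "i \<in> \<Lambda>" "j \<in> \<Lambda>" for i j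
    using that r[OF that]
    by (intro F.hom_diff_zero[OF U.ring_axioms h])
      (simp_all add: commutator_closed F.ring_axioms pdF cl hcomm hd hpd bracket)
  moreover have "h (commutator ?F (?\<delta> i) (?\<iota> (?x j)) \<ominus>\<^bsub>?F\<^esub> ?\<iota> \<lbrace>?x i, ?x j\<rbrace>) = \<zero>\<^bsub>U\<^esub>"
    if "i \<in> \<Lambda>" "j \<in> \<Lambda>" for i j
    using that
    by (intro F.hom_diff_zero[OF U.ring_axioms h])
      (simp_all add: commutator_closed F.ring_axioms cl hcomm hd hg bracket)
  moreover have "h (pd_sum ?F ?\<iota> ?\<delta> \<Lambda> S q (f s)) = \<zero>\<^bsub>U\<^esub>" if "s \<in> \<Gamma>" for s
    using that by (simp add: hpd f_closed q_f \<beta>z)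
  ultimately have "h p = \<zero>\<^bsub>U\<^esub>" if "p \<in> R" for p
    using that unfolding R_eq by blast
  from presented_universal[OF Rc U.assoc_algebra_axioms h this]
  obtain \<psi> where \<psi>: "\<psi> \<in> alg_hom ?V U" and \<psi>G: "\<forall>x\<in>G. \<psi> (presented_gen G R x) = h (free_gen x)" by blast
  have \<psi>a: "\<psi> (?a c) = \<alpha> c" if "c \<in> carrier P" for c
    using \<psi>G[rule_format, of "Inl c"] that by (simp add: mem hg presented_gen_def)
  have \<psi>y: "\<psi> (?y i) = \<beta> (?x i)" if "i \<in> \<Lambda>" for i
    using \<psi>G[rule_format, of "Inr i"] that by (simp add: mem hd presented_gen_def)
  \<comment> \<open>\<open>b\<close> is not given on generators, so it is first expanded in the y_i
    and then recognized in \<open>U\<close> by the chain rule.\<close>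
  have \<psi>b: "\<psi> (b c) = \<beta> c" if c: "c \<in> carrier P" for c
  proof -
    obtain k where k: "k \<in> carrier L" "q k = c" using q_surj[OF c] by blast
    have "\<psi> (b c) = pd_sum U (\<lambda>a. \<psi> (?a a)) (\<lambda>i. \<psi> (?y i)) \<Lambda> S q k"
      using k b[OF k(1)] pd_sum_hom[OF V.ring_axioms U.ring_axioms \<psi> k(1), of ?a q ?y]
      by (simp add: y alg_homD(1)[OF a] q_simps(1))
    also have "\<dots> = pd_sum U \<alpha> (\<lambda>i. \<beta> (?x i)) \<Lambda> S q k"
      unfolding pd_sum_def using k
      by (intro U.finsum_cong') (auto simp: \<psi>a \<psi>y q_simps(1) loc_pd_closed U_triple(3,4) cl)
    finally show ?thesis using triple_pd_sum[OF triple k(1)] k(2) by simp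
  qed
  have "\<psi> \<in> alg_iso ?V U"
  proof (rule iso_of_triple(1)[OF T \<psi> \<psi>a \<psi>b])
    fix e x
    assume e: "e \<in> alg_hom ?V ?V" and x: "x \<in> carrier ?V"
      and ea: "\<And>c. c \<in> carrier P \<Longrightarrow> e (?a c) = ?a c" and eb: "\<And>c. c \<in> carrier P \<Longrightarrow> e (b c) = b c"
    \<comment> \<open>The generators y_i are themselves values of \<open>b\<close>, so fixing the
      triple fixes every generator of the presentation.\<close>
    have ey: "e (?y i) = ?y i" if "i \<in> \<Lambda>" for i
      using eb[of "?x i"] that by (simp add: by' cl)
    show "e x = x"
      by (rule presented_unique[OF Rc V.ring_axioms e alg_hom_id _ x])
        (use ea ey in \<open>auto simp: G_def presented_gen_def\<close>)
  qed auto
  then show ?thesis using \<psi>a \<psi>y by (auto simp: presented_gen_def)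
qed

end

theorem theorem2p2:
  fixes P :: "('k::field, 'p) poisson"
    and U :: "('k, 'u) module"
    and \<alpha> \<beta> :: "'p \<Rightarrow> 'u"
    and \<Lambda> :: "'i set"
    and S :: "(('i \<Rightarrow>\<^sub>0 nat) \<Rightarrow>\<^sub>0 'k) set"
    and \<Gamma> :: "'s set"
    and f :: "'s \<Rightarrow> ('k, 'i) poly_frac"
    and q :: "('k, 'i) poly_frac \<Rightarrow> 'p"
  assumes P: "poisson_algebra P"
    and U: "poisson_enveloping P U \<alpha> \<beta>"
  shows
    \<comment> \<open>(1)\<close>
    "(\<exists>\<phi> \<in> alg_iso U (alg_quot (pad_smash P) (poisson_ideal P)).
        \<forall>a \<in> carrier P.
          \<phi> (\<alpha> a) = poisson_ideal P +>\<^bsub>pad_smash P\<^esub> smash_elt P a \<and>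
          \<phi> (\<beta> a) = poisson_ideal P +>\<^bsub>pad_smash P\<^esub> smash_delta P a)
     \<and>
     \<comment> \<open>(2)\<close>
     (poisson_presentation P \<Lambda> S \<Gamma> f q \<longrightarrow>
       (\<forall>r. (\<forall>i \<in> \<Lambda>. \<forall>j \<in> \<Lambda>. r i j \<in> carrier (loc_poly \<Lambda> S) \<and>
                 q (r i j) = \<lbrace>q (loc_var \<Lambda> S i), q (loc_var \<Lambda> S j)\<rbrace>\<^bsub>P\<^esub>) \<longrightarrow>
          (\<exists>\<psi> \<in> alg_iso (presented_alg (Sum_Type.Plus (carrier P) \<Lambda>) (delta_rels P \<Lambda> S \<Gamma> f q r)) U.
             (\<forall>a \<in> carrier P.
                \<psi> (presented_gen (Sum_Type.Plus (carrier P) \<Lambda>) (delta_rels P \<Lambda> S \<Gamma> f q r) (Inl a)) = \<alpha> a) \<and>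
             (\<forall>i \<in> \<Lambda>.
                \<psi> (presented_gen (Sum_Type.Plus (carrier P) \<Lambda>) (delta_rels P \<Lambda> S \<Gamma> f q r) (Inr i))
                  = \<beta> (q (loc_var \<Lambda> S i))))))
     \<and>
     (\<exists>\<psi> \<in> alg_iso (presented_alg (Sum_Type.Plus (carrier P) (carrier P)) (delta_P_rels P)) U.
        \<forall>a \<in> carrier P.
          \<psi> (presented_gen (Sum_Type.Plus (carrier P) (carrier P)) (delta_P_rels P) (Inl a)) = \<alpha> a \<and>
          \<psi> (presented_gen (Sum_Type.Plus (carrier P) (carrier P)) (delta_P_rels P) (Inr a)) = \<beta> a)
     \<and>
     \<comment> \<open>(3)\<close>
     (\<exists>\<pi>. canonical_rep P U \<alpha> \<beta> \<pi>) \<and>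
     (\<forall>\<pi> \<pi>'. canonical_rep P U \<alpha> \<beta> \<pi> \<and> canonical_rep P U \<alpha> \<beta> \<pi>' \<longrightarrow>
        (\<forall>u \<in> carrier U. \<pi> u = \<pi>' u)) \<and>
     (\<forall>\<pi>. canonical_rep P U \<alpha> \<beta> \<pi> \<longrightarrow> \<pi> ` carrier U = poisson_diff_ops P)
     \<and>
     \<comment> \<open>(4)\<close>
     (\<alpha> \<in> alg_hom P U \<and> inj_on \<alpha> (carrier P)) \<and>
     (\<exists>act. natural_poisson_module P U \<alpha> \<beta> act) \<and>
     (\<forall>act. natural_poisson_module P U \<alpha> \<beta> act \<longrightarrow>
        direct_sum P (restricted_module U \<alpha>) (\<alpha> ` carrier P) (annihilator U P act \<one>\<^bsub>P\<^esub>) \<and>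
        (poisson_presentation P \<Lambda> S \<Gamma> f q \<longrightarrow>
           annihilator U P act \<one>\<^bsub>P\<^esub> = left_ideal_sum U (\<lambda>i. \<beta> (q (loc_var \<Lambda> S i))) \<Lambda>) \<and>
        (\<forall>\<pi>. canonical_rep P U \<alpha> \<beta> \<pi> \<longrightarrow>
           (\<forall>u \<in> carrier U. \<forall>p \<in> carrier P. act u p = \<pi> u p)))"
proof -
  interpret enveloping P U \<alpha> \<beta>
    by (rule enveloping.intro[OF P]) (rule enveloping_axioms.intro[OF U])
  \<comment> \<open>Only the coordinate statements assume a presentation of \<open>P\<close>, so the
    corresponding locale is entered conditionally.\<close>
  have pres: "presented_poisson P U \<alpha> \<beta> \<Lambda> S \<Gamma> f q" if "poisson_presentation P \<Lambda> S \<Gamma> f q"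
    by (rule presented_poisson.intro[OF enveloping_axioms]) (rule presented_poisson_axioms.intro[OF that])
  show ?thesis
  proof (intro conjI allI impI ballI)
    show "\<exists>\<phi> \<in> alg_iso U (alg_quot (pad_smash P) (poisson_ideal P)). \<forall>a \<in> carrier P.
        \<phi> (\<alpha> a) = poisson_ideal P +>\<^bsub>pad_smash P\<^esub> smash_elt P a \<and>
        \<phi> (\<beta> a) = poisson_ideal P +>\<^bsub>pad_smash P\<^esub> smash_delta P a"
      by (rule smash_presentation)
    show "\<exists>\<psi> \<in> alg_iso (presented_alg (Sum_Type.Plus (carrier P) \<Lambda>) (delta_rels P \<Lambda> S \<Gamma> f q r)) U.
        (\<forall>a \<in> carrier P.
           \<psi> (presented_gen (Sum_Type.Plus (carrier P) \<Lambda>) (delta_rels P \<Lambda> S \<Gamma> f q r) (Inl a)) = \<alpha> a) \<and>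
        (\<forall>i \<in> \<Lambda>.
           \<psi> (presented_gen (Sum_Type.Plus (carrier P) \<Lambda>) (delta_rels P \<Lambda> S \<Gamma> f q r) (Inr i))
             = \<beta> (q (loc_var \<Lambda> S i)))"
      if "poisson_presentation P \<Lambda> S \<Gamma> f q"
        and "\<forall>i \<in> \<Lambda>. \<forall>j \<in> \<Lambda>. r i j \<in> carrier (loc_poly \<Lambda> S) \<and>
               q (r i j) = \<lbrace>q (loc_var \<Lambda> S i), q (loc_var \<Lambda> S j)\<rbrace>\<^bsub>P\<^esub>" for r
      by (rule presented_poisson.coordinate_presentation[OF pres[OF that(1)]]) (use that(2) in blast)
    show "\<pi> u = \<pi>' u" if "canonical_rep P U \<alpha> \<beta> \<pi> \<and> canonical_rep P U \<alpha> \<beta> \<pi>'" "u \<in> carrier U" for \<pi> \<pi>' u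
      using canonical_rep_unique that by blast
    show "annihilator U P act \<one>\<^bsub>P\<^esub> = left_ideal_sum U (\<lambda>i. \<beta> (q (loc_var \<Lambda> S i))) \<Lambda>"
      if "natural_poisson_module P U \<alpha> \<beta> act" "poisson_presentation P \<Lambda> S \<Gamma> f q" for act
      by (rule presented_poisson.annihilator_eq_left_ideal_sum[OF pres[OF that(2)] that(1)])
  qed (fact delta_P_presentation canonical_rep_exists canonical_rep_image U_triple(2) \<alpha>_inj
      natural_module_exists annihilator_direct_sum natural_module_eq_rep)+
qed

end
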